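(* Suppose no anticipation, i.i.d. panel sampling, overlap, and the parallel trends assumption (PT) hold (see context), and that: (i) for each $g\ge1$, $\mathbb E[(\Delta Y-m_\Delta(X))^2\mid X,G=g]$, $1/p_g$, and $\omega_g$ are bounded functions of $X$; (ii) the first-stage estimators satisfy: (1) $\sum_{g\ge2}\hat w_g(x)=1$ for all $x\in\mathcal X$ and $\|\hat w_g\|_\infty=O_p(1)$ for all $g$; (2) $\|\hat m_\Delta-m_\Delta\|_{L_2(F_X)}=o_p(1)$, and for each $g\ge2$, $\|\hat p_1/\hat p_g-p_1/p_g\|_{L_2(F_X)}=o_p(1)$ and $\|\hat w_g-\omega_g\|_{L_2(F_X)}=o_p(1)$; (3) for each $g\ge2$, $$\|\hat p_1/\hat p_g-p_1/p_g\|_{L_2(F_X)}\,\|\hat m_\Delta-m_\Delta\|_{L_2(F_X)}=o_p(n^{-1/2}).$$ Then the cross-fitted estimator $\hat\theta$ satisfies $\sqrt n(\hat\theta-\theta)\overset{d}{\to}N(0,V_{\mathrm{PT}})$ as $n\to\infty$ (with $N_G,\mathcal T,L$ fixed), where $$V_{\mathrm{PT}}=\frac1{\pi_1^2}\mathbb E\Big[\mathcal G_1(\Delta Y-m_{1,\Delta}(X))^2+\mathcal G_1(m_{1,\Delta}(X)-m_\Delta(X)-\theta)^2+\sum_{g=2}^{N_G+1}\omega_g(X)^2\mathcal G_g\frac{p_1(X)^2}{p_g(X)^2}(\Delta Y-m_\Delta(X))^2\Big],$$ with $m_{1,\Delta}(X)=\mathbb E[\Delta Y\mid X,G=1]$.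
   Context: Setting. There are $N_G+1$ groups; $G\in\{1,\dots,N_G+1\}$, $\mathcal G_g=\mathbf 1\{G=g\}$. Group $1$ is treated in the final period $\mathcal T$ only; the other groups are never treated. $Y_t(1),Y_t(0)$ are potential outcomes, $Y_t=\mathcal G_1Y_t(1)+(1-\mathcal G_1)Y_t(0)$, $t=1,\dots,\mathcal T$. $X$ is a vector of covariates with support $\mathcal X$ and distribution $F_X$; $\|f\|_{L_2(F_X)}=(\int f(x)^2dF_X(x))^{1/2}$ (for an estimated function, evaluated at its realization). Target: $\theta=\mathbb E[Y_{\mathcal T}(1)-Y_{\mathcal T}(0)\mid G=1]$. Assumptions. No anticipation: $Y_t(1)=Y_t(0)$ for $t\le\mathcal T-1$. Panel sampling: $\{S_i\}_{i=1}^n$ is an i.i.d. sample of $S=(Y_1,\dots,Y_{\mathcal T},G,X)$. Overlap: $p_g(X)=\mathbb P(G=g\mid X)>0$ a.s. for all $g$. (PT): for each $g\ge2$, $\mathbb E[Y_{\mathcal T}(0)-Y_{\mathcal T-1}(0)\mid G=1,X]=\mathbb E[Y_{\mathcal T}(0)-Y_{\mathcal T-1}(0)\mid G=g,X]$ a.s. Notation. $\Delta Y=Y_{\mathcal T}-Y_{\mathcal T-1}$; $m_\Delta(X)=\mathbb E[\Delta Y\mid G\ne1,X]$; $\pi_1=\mathbb P(G=1)$; $$\phi(S;m_\Delta,p,w;\pi_1)=\frac1{\pi_1}\Big(\mathcal G_1-\sum_{g=2}^{N_G+1}w_g(X)\frac{p_1(X)}{p_g(X)}\mathcal G_g\Big)(\Delta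 Y-m_\Delta(X)).$$ Estimator. Split $\{1,\dots,n\}$ into $L$ equal folds $I_1,\dots,I_L$ ($n/L$ an integer), $I_\ell^c=\bigcup_{\ell'\ne\ell}I_{\ell'}$. For each $\ell$, nuisance estimators $\hat m_\Delta^\ell,\hat p^\ell,\hat w^\ell$ are functions on $\mathcal X$ constructed from the observations in $I_\ell^c$ only. With $\hat\pi_1=n^{-1}\sum_{i=1}^n\mathcal G_{1i}$, $$\hat\theta=\frac1n\sum_{\ell=1}^L\sum_{i\in I_\ell}\phi(S_i;\hat m_\Delta^\ell,\hat p^\ell,\hat w^\ell;\hat\pi_1).$$ Conditions on $\hat m_\Delta,\hat p,\hat w$ written without superscript are required of the fold-$\ell$ estimators for every $\ell$. The functions $\omega=(\omega_2,\dots,\omega_{N_G+1})$ are the probability limits (pseudo-true weights) of $\hat w$ (no synthetic control structure is assumed). Convention: $\hat w_1=\omega_1\equiv1$. *)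

theory Defs
  imports "HOL-Probability.Probability"
begin

section \<open>Probabilistic notions\<close>

text \<open>The normal law with mean \<open>\<mu>\<close> and variance \<open>v\<close>; for \<open>v = 0\<close> it is the point mass at \<open>\<mu>\<close>
  (whereas \<open>normal_density \<mu> 0\<close> is identically zero).\<close>

definition normal_law :: "real \<Rightarrow> real \<Rightarrow> real measure" where
  "normal_law \<mu> v = distr std_normal_distribution borel (\<lambda>z. \<mu> + sqrt v * z)"

definition support :: "'a::topological_space measure \<Rightarrow> 'a set" where
  "support F = {x. \<forall>U. open U \<and> x \<in> U \<longrightarrow> emeasure F U > 0}"

definition given :: "'w measure \<Rightarrow> ('w \<Rightarrow> bool) \<Rightarrow> 'w measure" where
  "given P A = uniform_measure P {\<omega> \<in> space P. A \<omega>}"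

text \<open>\<open>m\<close> is a version of the regression function \<open>x \<mapsto> E\<^sub>Q[Z | X = x]\<close>. Taking \<open>Q\<close> to be
  \<open>given P A\<close> yields \<open>x \<mapsto> E[Z | A, X = x]\<close>. Integrability is part of the notion because
  \<open>real_cond_exp\<close> is only meaningful for integrable \<open>Z\<close>.\<close>

definition regression_fn ::
  "'w measure \<Rightarrow> ('w \<Rightarrow> 'x::euclidean_space) \<Rightarrow> ('w \<Rightarrow> real) \<Rightarrow> ('x \<Rightarrow> real) \<Rightarrow> bool" where
  "regression_fn Q X Z m \<longleftrightarrow>
     integrable Q Z \<and> m \<in> borel_measurable borel \<and>
     (AE \<omega> in Q. m (X \<omega>) = real_cond_exp Q (vimage_algebra (space Q) X borel) Z \<omega>)"

text \<open>\<open>E\<^sub>Q[Z | X]\<close> is bounded, for a nonnegative \<open>Z\<close> that is not assumed to be integrable.\<close>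

definition bounded_nn_regression ::
  "'w measure \<Rightarrow> ('w \<Rightarrow> 'x::euclidean_space) \<Rightarrow> ('w \<Rightarrow> real) \<Rightarrow> bool" where
  "bounded_nn_regression Q X Z \<longleftrightarrow>
     (\<exists>C::real. AE \<omega> in Q.
        nn_cond_exp Q (vimage_algebra (space Q) X borel) (\<lambda>\<omega>. ennreal (Z \<omega>)) \<omega> \<le> ennreal C)"

definition AE_bounded :: "'x measure \<Rightarrow> ('x \<Rightarrow> real) \<Rightarrow> bool" where
  "AE_bounded F f \<longleftrightarrow> (\<exists>C::real. AE x in F. \<bar>f x\<bar> \<le> C)"

text \<open>Norms take values in \<open>[0, \<infinity>]\<close>, so that a function outside the respective space has
  norm \<open>\<infinity>\<close>.\<close>

definition L2_norm :: "'x measure \<Rightarrow> ('x \<Rightarrow> real) \<Rightarrow> ennreal" where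
  "L2_norm F f =
     (let I = (\<integral>\<^sup>+ x. ennreal ((f x)\<^sup>2) \<partial>F)
      in if I = \<infinity> then \<infinity> else ennreal (sqrt (enn2real I)))"

definition sup_norm_on :: "'x set \<Rightarrow> ('x \<Rightarrow> real) \<Rightarrow> ennreal" where
  "sup_norm_on A f = (SUP x\<in>A. ennreal \<bar>f x\<bar>)"

text \<open>Stochastic orders of magnitude of a sequence of \<open>[0, \<infinity>]\<close>-valued maps. The supremum norm of a
  random function need not be measurable, hence the outer probability, which agrees with the
  probability on events.\<close>

definition O_p :: "'v measure \<Rightarrow> (nat \<Rightarrow> 'v \<Rightarrow> ennreal) \<Rightarrow> bool" where
  "O_p M Z \<longleftrightarrow>
     (\<forall>\<epsilon>::real. \<epsilon> > 0 \<longrightarrow> (\<exists>K::real. \<forall>\<^sub>F k in sequentially.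
        outer_measure_of M {\<omega> \<in> space M. Z k \<omega> > ennreal K} \<le> ennreal \<epsilon>))"

definition o_p :: "'v measure \<Rightarrow> (nat \<Rightarrow> real) \<Rightarrow> (nat \<Rightarrow> 'v \<Rightarrow> ennreal) \<Rightarrow> bool" where
  "o_p M a Z \<longleftrightarrow>
     (\<forall>\<epsilon>::real. \<epsilon> > 0 \<longrightarrow>
        (\<lambda>k. outer_measure_of M {\<omega> \<in> space M. Z k \<omega> > ennreal (\<epsilon> * a k)}) \<longlonglongrightarrow> 0)"

definition iid_sample ::
  "'v measure \<Rightarrow> 's measure \<Rightarrow> (nat \<Rightarrow> 'v \<Rightarrow> 's) \<Rightarrow> 's measure \<Rightarrow> bool" where
  "iid_sample M N S \<mu> \<longleftrightarrow>
     prob_space.indep_vars M (\<lambda>_. N) S {1..} \<and> (\<forall>i\<ge>1. distr M N (S i) = \<mu>)"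

section \<open>Panel data\<close>

text \<open>An observation consists of the outcome path \<open>(Y\<^sub>1, \<dots>, Y\<^sub>T)\<close>, the group and the covariates.\<close>

type_synonym 'x obs = "(nat \<Rightarrow> real) \<times> nat \<times> 'x"

definition obs_space :: "nat \<Rightarrow> ('x::euclidean_space) obs measure" where
  "obs_space T = (\<Pi>\<^sub>M t\<in>{1..T}. borel) \<Otimes>\<^sub>M (count_space UNIV \<Otimes>\<^sub>M borel)"

definition grp :: "'x obs \<Rightarrow> nat" where
  "grp s = fst (snd s)"

definition cov :: "'x obs \<Rightarrow> 'x" where
  "cov s = snd (snd s)"

definition last_diff :: "nat \<Rightarrow> 'x obs \<Rightarrow> real" where
  "last_diff T s = fst s T - fst s (T - 1)"

definition observed_outcome ::
  "(nat \<Rightarrow> 'w \<Rightarrow> real) \<Rightarrow> (nat \<Rightarrow> 'w \<Rightarrow> real) \<Rightarrow> ('w \<Rightarrow> nat) \<Rightarrow> nat \<Rightarrow> 'w \<Rightarrow> real" where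
  "observed_outcome Y1 Y0 G t \<omega> =
     of_bool (G \<omega> = 1) * Y1 t \<omega> + (1 - of_bool (G \<omega> = 1)) * Y0 t \<omega>"

definition observation ::
  "nat \<Rightarrow> (nat \<Rightarrow> 'w \<Rightarrow> real) \<Rightarrow> (nat \<Rightarrow> 'w \<Rightarrow> real) \<Rightarrow> ('w \<Rightarrow> nat) \<Rightarrow> ('w \<Rightarrow> 'x) \<Rightarrow> 'w \<Rightarrow> 'x obs" where
  "observation T Y1 Y0 G X \<omega> =
     (restrict (\<lambda>t. observed_outcome Y1 Y0 G t \<omega>) {1..T}, G \<omega>, X \<omega>)"

definition Delta_Y ::
  "nat \<Rightarrow> (nat \<Rightarrow> 'w \<Rightarrow> real) \<Rightarrow> (nat \<Rightarrow> 'w \<Rightarrow> real) \<Rightarrow> ('w \<Rightarrow> nat) \<Rightarrow> 'w \<Rightarrow> real" where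
  "Delta_Y T Y1 Y0 G \<omega> = observed_outcome Y1 Y0 G T \<omega> - observed_outcome Y1 Y0 G (T - 1) \<omega>"

definition ATT ::
  "'w measure \<Rightarrow> nat \<Rightarrow> (nat \<Rightarrow> 'w \<Rightarrow> real) \<Rightarrow> (nat \<Rightarrow> 'w \<Rightarrow> real) \<Rightarrow> ('w \<Rightarrow> nat) \<Rightarrow> real" where
  "ATT P T Y1 Y0 G = (\<integral>\<omega>. Y1 T \<omega> - Y0 T \<omega> \<partial>given P (\<lambda>\<omega>. G \<omega> = 1))"

section \<open>The cross-fitted estimator\<close>

definition phi ::
  "nat \<Rightarrow> nat \<Rightarrow> ('x \<Rightarrow> real) \<Rightarrow> (nat \<Rightarrow> 'x \<Rightarrow> real) \<Rightarrow> (nat \<Rightarrow> 'x \<Rightarrow> real) \<Rightarrow> real \<Rightarrow> 'x obs \<Rightarrow> real" where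
  "phi T NG m p w \<pi>1 s =
     1 / \<pi>1 *
     (of_bool (grp s = 1) -
        (\<Sum>g = 2..NG + 1. w g (cov s) * (p 1 (cov s) / p g (cov s)) * of_bool (grp s = g))) *
     (last_diff T s - m (cov s))"

definition equal_folds :: "nat \<Rightarrow> nat \<Rightarrow> (nat \<Rightarrow> nat set) \<Rightarrow> bool" where
  "equal_folds n L I \<longleftrightarrow>
     disjoint_family_on I {1..L} \<and> (\<Union>l\<in>{1..L}. I l) = {1..n} \<and> (\<forall>l\<in>{1..L}. card (I l) = n div L)"

definition fold_compl :: "nat \<Rightarrow> (nat \<Rightarrow> nat set) \<Rightarrow> nat \<Rightarrow> nat set" where
  "fold_compl L I l = (\<Union>l'\<in>{1..L} - {l}. I l')"

definition training :: "nat \<Rightarrow> (nat \<Rightarrow> nat set) \<Rightarrow> nat \<Rightarrow> (nat \<Rightarrow> 's) \<Rightarrow> (nat \<Rightarrow> 's)" where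
  "training L I l s = restrict s (fold_compl L I l)"

definition pi1_hat :: "nat \<Rightarrow> (nat \<Rightarrow> 'x obs) \<Rightarrow> real" where
  "pi1_hat n s = (\<Sum>i = 1..n. of_bool (grp (s i) = 1)) / real n"

text \<open>For fold \<open>l\<close>, the maps \<open>mhat l\<close>, \<open>phat l\<close>, \<open>what l\<close> send training data to the estimated
  functions; they are only ever applied to the observations outside fold \<open>l\<close>.\<close>

definition theta_hat ::
  "nat \<Rightarrow> nat \<Rightarrow> nat \<Rightarrow> nat \<Rightarrow> (nat \<Rightarrow> nat set) \<Rightarrow>
   (nat \<Rightarrow> (nat \<Rightarrow> 'x obs) \<Rightarrow> 'x \<Rightarrow> real) \<Rightarrow>
   (nat \<Rightarrow> (nat \<Rightarrow> 'x obs) \<Rightarrow> nat \<Rightarrow> 'x \<Rightarrow> real) \<Rightarrow>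
   (nat \<Rightarrow> (nat \<Rightarrow> 'x obs) \<Rightarrow> nat \<Rightarrow> 'x \<Rightarrow> real) \<Rightarrow> (nat \<Rightarrow> 'x obs) \<Rightarrow> real" where
  "theta_hat T NG L n I mhat phat what s =
     1 / real n * (\<Sum>l = 1..L. \<Sum>i\<in>I l.
       phi T NG (mhat l (training L I l s)) (phat l (training L I l s)) (what l (training L I l s))
         (pi1_hat n s) (s i))"

definition V_PT ::
  "'w measure \<Rightarrow> nat \<Rightarrow> nat \<Rightarrow> (nat \<Rightarrow> 'w \<Rightarrow> real) \<Rightarrow> (nat \<Rightarrow> 'w \<Rightarrow> real) \<Rightarrow> ('w \<Rightarrow> nat) \<Rightarrow> ('w \<Rightarrow> 'x) \<Rightarrow>
   (nat \<Rightarrow> 'x \<Rightarrow> real) \<Rightarrow> ('x \<Rightarrow> real) \<Rightarrow> ('x \<Rightarrow> real) \<Rightarrow> (nat \<Rightarrow> 'x \<Rightarrow> real) \<Rightarrow> real" where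
  "V_PT P T NG Y1 Y0 G X p m m1 w =
     1 / (measure P {\<omega> \<in> space P. G \<omega> = 1})\<^sup>2 *
     (\<integral>\<omega>. of_bool (G \<omega> = 1) * (Delta_Y T Y1 Y0 G \<omega> - m1 (X \<omega>))\<^sup>2
          + of_bool (G \<omega> = 1) * (m1 (X \<omega>) - m (X \<omega>) - ATT P T Y1 Y0 G)\<^sup>2
          + (\<Sum>g = 2..NG + 1. (w g (X \<omega>))\<^sup>2 * of_bool (G \<omega> = g) *
               ((p 1 (X \<omega>))\<^sup>2 / (p g (X \<omega>))\<^sup>2) * (Delta_Y T Y1 Y0 G \<omega> - m (X \<omega>))\<^sup>2) \<partial>P)"

end

theory Submission
  imports Defs
begin

text \<open>
  Parallel trends identify \<open>m\<^sub>\<Delta>\<close> with the untreated trend of every group, so the residual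
  \<open>\<epsilon> = \<Delta>Y - m\<^sub>\<Delta>(X)\<close> is conditionally centred in each control group and
  \<open>E[G\<^sub>1 \<epsilon>] = \<pi>\<^sub>1 \<theta>\<close>. Write \<open>r\<^sub>g = p\<^sub>1 / p\<^sub>g\<close> with estimate \<open>\<rho>\<^sub>g\<close>, and let
  \<open>\<delta>\<close> be the error in \<open>m\<^sub>\<Delta>\<close>. The error in the unnormalised score then splits into
  \<open>- \<Sum>\<^sub>g (w\<^sub>g \<rho>\<^sub>g - \<omega>\<^sub>g r\<^sub>g) G\<^sub>g \<epsilon> - (G\<^sub>1 - \<Sum>\<^sub>g w\<^sub>g r\<^sub>g G\<^sub>g) \<delta>\<close>
  and \<open>\<Sum>\<^sub>g w\<^sub>g (\<rho>\<^sub>g - r\<^sub>g) G\<^sub>g \<delta>\<close>. Given the training folds the first part has mean zero, the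
  weights summing to one, and a vanishing second moment, so that Chebyshev's inequality applies on
  each fold; the second part is \<open>o\<^sub>p(n\<^sup>-\<^sup>1\<^sup>/\<^sup>2)\<close> on average by Cauchy-Schwarz and the product rate.
  What remains is a sum of the i.i.d. variables
  \<open>(G\<^sub>1 - \<Sum>\<^sub>g \<omega>\<^sub>g r\<^sub>g G\<^sub>g) \<epsilon> - \<theta> G\<^sub>1\<close> divided by the estimated \<open>\<pi>\<^sub>1\<close>, to which the central
  limit theorem and Slutsky's lemma apply.
\<close>

section \<open>Limit theorems and cross-fitting\<close>

text \<open>The weights need consistency but no rate: given X, the factor \<open>r h\<close> turns
  the indicator of group h into that of group 1 on average, so under parallel trends all weights
  that sum to one give a centred score, and their error only multiplies a centred residual. Among
  the ratios only the true \<open>r h\<close> is bounded; its estimate \<rho> is merely close to it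
  in L2. Hence w \<rho> \<delta> need not be square integrable and is cut into w r \<delta>, which
  has a second moment, and w (\<rho> - r) \<delta>, which has only a first moment and must therefore
  be of smaller order than n^(-1/2). For the centred part a second moment that tends to zero is
  enough. Conditioning on the training folds is done by Fubini's theorem with the training data
  frozen; bad training data are covered by an event of small probability. Estimating the treated
  share calls for no further expansion: \<theta> is subtracted only on the treated units, whose
  number is exactly n times the estimate.\<close>

text \<open>Compares characteristic functions: at t the integrands differ by at most |t| \<eta>
  where the variables are within \<eta> of each other, and by at most 2 elsewhere. Levy's continuity
  theorem asks for convergence at each fixed t only, so \<eta> may depend on t.\<close>

lemma (in prob_space) weak_conv_m_slutsky:
  assumes A[measurable]: "\<And>k. A k \<in> borel_measurable M"
    and B[measurable]: "\<And>k. B k \<in> borel_measurable M"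
    and N: "real_distribution N"
    and BN: "weak_conv_m (\<lambda>k. distr M borel (B k)) N"
    and diff: "\<And>\<eta>. \<eta> > 0 \<Longrightarrow> (\<lambda>k. prob {\<omega>\<in>space M. \<bar>A k \<omega> - B k \<omega>\<bar> > \<eta>}) \<longlonglongrightarrow> 0"
  shows "weak_conv_m (\<lambda>k. distr M borel (A k)) N"
proof (rule levy_continuity)
  show rA: "real_distribution (distr M borel (A k))" for k
    by (rule real_distribution_distr) simp
  have rB: "real_distribution (distr M borel (B k))" for k
    by (rule real_distribution_distr) simp
  show "real_distribution N" by fact
  fix t
  have cB: "(\<lambda>k. char (distr M borel (B k)) t) \<longlonglongrightarrow> char N t"
    by (rule levy_continuity1[OF rB N BN])
  have int_A: "integrable M (\<lambda>\<omega>. iexp (t * A k \<omega>))" and int_B: "integrable M (\<lambda>\<omega>. iexp (t * B k \<omega>))" for k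
    by (auto intro!: integrable_const_bound[where B=1])
  have bnd: "cmod (char (distr M borel (A k)) t - char (distr M borel (B k)) t)
     \<le> \<bar>t\<bar> * \<eta> + 2 * prob {\<omega>\<in>space M. \<bar>A k \<omega> - B k \<omega>\<bar> > \<eta>}" if "\<eta> > 0" for k \<eta>
  proof -
    let ?E = "{\<omega>\<in>space M. \<bar>A k \<omega> - B k \<omega>\<bar> > \<eta>}"
    have ind: "integrable M (indicator ?E :: _ \<Rightarrow> real)"
      by (rule integrable_real_indicator) (measurable, simp add: emeasure_eq_measure)
    have pw: "cmod (iexp (t * A k \<omega>) - iexp (t * B k \<omega>)) \<le> \<bar>t\<bar> * \<eta> + 2 * indicator ?E \<omega>"
      if w: "\<omega> \<in> space M" for \<omega>
    proof -
      have "cmod (iexp (t * A k \<omega>) - iexp (t * B k \<omega>))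
          = cmod (iexp (t * B k \<omega>) * (iexp (t * (A k \<omega> - B k \<omega>)) - 1))"
        by (simp add: algebra_simps flip: exp_add)
      also have "\<dots> = cmod (iexp (t * (A k \<omega> - B k \<omega>)) - 1)"
        by (simp add: norm_mult)
      finally have e: "cmod (iexp (t * A k \<omega>) - iexp (t * B k \<omega>)) = cmod (iexp (t * (A k \<omega> - B k \<omega>)) - 1)" .
      show ?thesis
      proof (cases "\<omega> \<in> ?E")
        case True
        have "cmod (iexp (t * (A k \<omega> - B k \<omega>)) - 1) \<le> cmod (iexp (t * (A k \<omega> - B k \<omega>))) + cmod 1"
          by (rule norm_triangle_ineq4)
        also have "\<dots> = 2" by simp
        moreover have "0 \<le> \<bar>t\<bar> * \<eta>" using \<open>\<eta> > 0\<close> by simp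
        ultimately show ?thesis using True e by simp
      next
        case False
        have "cmod (iexp (t * (A k \<omega> - B k \<omega>)) - 1) \<le> \<bar>t * (A k \<omega> - B k \<omega>)\<bar>"
          using iexp_approx1[of "t * (A k \<omega> - B k \<omega>)" 0] by simp
        also have "\<dots> \<le> \<bar>t\<bar> * \<eta>" using False w by (auto simp: abs_mult intro!: mult_left_mono)
        finally show ?thesis using False e by simp
      qed
    qed
    have "char (distr M borel (A k)) t - char (distr M borel (B k)) t
        = (\<integral>\<omega>. iexp (t * A k \<omega>) - iexp (t * B k \<omega>) \<partial>M)"
      unfolding char_def using int_A int_B by (simp add: integral_distr)
    also have "cmod \<dots> \<le> (\<integral>\<omega>. cmod (iexp (t * A k \<omega>) - iexp (t * B k \<omega>)) \<partial>M)"
      by (rule integral_norm_bound)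
    also have "\<dots> \<le> (\<integral>\<omega>. \<bar>t\<bar> * \<eta> + 2 * indicator ?E \<omega> \<partial>M)"
    proof (rule integral_mono)
      show "integrable M (\<lambda>\<omega>. cmod (iexp (t * A k \<omega>) - iexp (t * B k \<omega>)))"
        using int_A int_B by (intro integrable_norm Bochner_Integration.integrable_diff)
      show "integrable M (\<lambda>\<omega>. \<bar>t\<bar> * \<eta> + 2 * indicator ?E \<omega>)"
        by (intro Bochner_Integration.integrable_add integrable_mult_right ind) simp
    qed (rule pw)
    also have "\<dots> = \<bar>t\<bar> * \<eta> + 2 * prob ?E"
      using ind by (subst Bochner_Integration.integral_add) (auto simp: prob_space)
    finally show ?thesis .
  qed
  have "(\<lambda>k. char (distr M borel (A k)) t - char (distr M borel (B k)) t) \<longlonglongrightarrow> 0"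
  proof (rule tendstoI)
    fix e :: real assume e: "e > 0"
    \<comment> \<open>Leaves |t| \<eta> < e / 2; the summand 1 avoids dividing by zero at t = 0. The
      other half of e comes from the probability bound e / 4, which is counted twice.\<close>
    define \<eta> where "\<eta> = e / (2 * (\<bar>t\<bar> + 1))"
    have \<eta>: "\<eta> > 0" using e by (simp add: \<eta>_def)
    have "\<bar>t\<bar> * \<eta> < e / 2" using e by (simp add: \<eta>_def field_simps)
    have "\<forall>\<^sub>F k in sequentially. prob {\<omega>\<in>space M. \<bar>A k \<omega> - B k \<omega>\<bar> > \<eta>} < e / 4"
      using diff[OF \<eta>] e by (intro order_tendstoD) auto
    then show "\<forall>\<^sub>F k in sequentially. dist (char (distr M borel (A k)) t - char (distr M borel (B k)) t) 0 < e"
    proof eventually_elim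
      case (elim k)
      then show ?case using bnd[OF \<eta>, of k] \<open>\<bar>t\<bar> * \<eta> < e / 2\<close> by simp
    qed
  qed
  from tendsto_add[OF this cB] show "(\<lambda>k. char (distr M borel (A k)) t) \<longlonglongrightarrow> char N t"
    by simp
qed

lemma real_distribution_normal_law: "real_distribution (normal_law \<mu> v)"
proof -
  interpret real_distribution std_normal_distribution by (rule real_dist_normal_dist)
  show ?thesis unfolding normal_law_def
    by (rule real_distribution_distr) simp
qed

text \<open>Singletons are disjoint blocks, so independence over disjoint blocks also re-indexes the
  family along an injection. The sample is indexed from 1, the central limit theorem from 0.\<close>

lemma (in prob_space) indep_vars_singletons:
  assumes "indep_vars (\<lambda>_. N) S I" and "range \<sigma> \<subseteq> I" "inj \<sigma>" and f[measurable]: "f \<in> borel_measurable N"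
  shows "indep_vars (\<lambda>_. borel) (\<lambda>i \<omega>. f (S (\<sigma> i) \<omega>)) UNIV"
proof -
  have "indep_vars (\<lambda>j. PiM {\<sigma> j} (\<lambda>_. N)) (\<lambda>j \<omega>. restrict (\<lambda>i. S i \<omega>) {\<sigma> j}) UNIV"
    using assms by (intro indep_vars_restrict[OF assms(1)]) (auto simp: disjoint_family_on_def inj_eq)
  then have "indep_vars (\<lambda>_. borel) (\<lambda>j \<omega>. f (restrict (\<lambda>i. S i \<omega>) {\<sigma> j} (\<sigma> j))) UNIV"
    by (rule indep_vars_compose2) measurable
  then show ?thesis by simp
qed

lemma (in prob_space) clt_iid:
  assumes ind: "indep_vars (\<lambda>_. N) S {1..}"
    and law: "\<And>i. i \<ge> 1 \<Longrightarrow> distr M N (S i) = \<mu>"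
    and f: "f \<in> borel_measurable N" "integrable \<mu> (\<lambda>s. (f s)\<^sup>2)" "(\<integral>s. f s \<partial>\<mu>) = 0"
  shows "weak_conv_m (\<lambda>n. distr M borel (\<lambda>\<omega>. (\<Sum>i = 1..n. f (S i \<omega>)) / sqrt (real n)))
    (normal_law 0 (\<integral>s. (f s)\<^sup>2 \<partial>\<mu>))"
proof -
  note [measurable] = f(1)
  have S[measurable]: "S i \<in> M \<rightarrow>\<^sub>M N" if "i \<ge> 1" for i
    using ind that by (auto simp: indep_vars_def2)
  define Z where "Z i \<omega> = f (S (Suc i) \<omega>)" for i \<omega>
  define v where "v = (\<integral>s. (f s)\<^sup>2 \<partial>\<mu>)"
  have Z[measurable]: "Z i \<in> borel_measurable M" for i
    unfolding Z_def by measurable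
  have \<mu>: "\<mu> = distr M N (S (Suc i))" for i using law by simp
  have Z_ind: "indep_vars (\<lambda>_. borel) Z UNIV"
    unfolding Z_def by (rule indep_vars_singletons[OF ind _ _ f(1)]) auto
  have Z0: "expectation (Z i) = 0" for i
    using f(3) unfolding Z_def \<mu>[of i] by (subst (asm) integral_distr) auto
  have Z2: "integrable M (\<lambda>\<omega>. (Z i \<omega>)\<^sup>2)" for i
    using f(2) unfolding Z_def \<mu>[of i] by (subst (asm) integrable_distr_eq) auto
  have Zv: "expectation (\<lambda>\<omega>. (Z i \<omega>)\<^sup>2) = v" for i
    unfolding Z_def v_def \<mu>[of i] by (subst integral_distr) auto
  have sum_eq: "(\<Sum>i = 1..n. f (S i \<omega>)) = (\<Sum>i<n. Z i \<omega>)" for n \<omega>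
    unfolding Z_def by (rule sum.reindex_bij_witness[of _ Suc "\<lambda>i. i - 1"]) auto
  have "v \<ge> 0" unfolding v_def by simp
  show ?thesis
  proof (cases "v = 0")
    \<comment> \<open>The central limit theorem excludes zero variance. Here every summand vanishes
      almost surely, and \<open>normal_law 0 0\<close> is the point mass at 0.\<close>
    case True
    have "AE \<omega> in M. (Z i \<omega>)\<^sup>2 = 0" for i
      using Zv[of i] True integral_nonneg_eq_0_iff_AE[OF Z2[of i]] by simp
    then have "AE \<omega> in M. \<forall>i. Z i \<omega> = 0" by (simp add: AE_all_countable)
    then have eq: "distr M borel (\<lambda>\<omega>. (\<Sum>i<n. Z i \<omega>) / sqrt (real n)) = distr M borel (\<lambda>_. 0)" for n
      by (intro distr_cong_AE) auto
    interpret std: prob_space std_normal_distribution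
      using real_dist_normal_dist by (simp add: real_distribution_def)
    have "distr M borel (\<lambda>_. 0::real) = normal_law 0 0"
      unfolding normal_law_def by (simp add: prob_space.distr_const[OF prob_space_axioms] std.distr_const)
    then show ?thesis unfolding sum_eq eq v_def[symmetric] True
      by (simp add: weak_conv_m_def weak_conv_def)
  next
    case False
    with \<open>v \<ge> 0\<close> have "v > 0" by simp
    have clt: "weak_conv_m (\<lambda>n. distr M borel (\<lambda>x. (\<Sum>i<n. Z i x) / sqrt (n * (sqrt v)\<^sup>2))) std_normal_distribution"
    proof (rule central_limit_theorem_zero_mean[OF Z_ind Z0])
      show "0 < sqrt v" using \<open>v > 0\<close> by simp
      show "variance (Z n) = (sqrt v)\<^sup>2" for n
        using Zv Z0 \<open>v > 0\<close> by simp
      show "distr M borel (Z n) = distr \<mu> borel f" for n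
        unfolding \<mu>[of n] Z_def by (subst distr_distr) (auto simp: comp_def)
    qed (rule Z2)
    show ?thesis unfolding sum_eq v_def[symmetric]
    proof (rule levy_continuity)
      show "real_distribution (distr M borel (\<lambda>\<omega>. (\<Sum>i<n. Z i \<omega>) / sqrt (real n)))" for n
        by (rule real_distribution_distr) simp
      show "real_distribution (normal_law 0 v)" by (rule real_distribution_normal_law)
      fix t
      \<comment> \<open>The central limit theorem normalises by sqrt (n v). Dropping v rescales the
        argument of both characteristic functions by \<open>sqrt v\<close>.\<close>
      have "char (distr M borel (\<lambda>\<omega>. (\<Sum>i<n. Z i \<omega>) / sqrt (real n))) t
         = char (distr M borel (\<lambda>x. (\<Sum>i<n. Z i x) / sqrt (n * (sqrt v)\<^sup>2))) (sqrt v * t)" for n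
        using \<open>v > 0\<close> unfolding char_def
        by (simp add: integral_distr real_sqrt_mult field_simps)
      moreover have "char (normal_law 0 v) t = char std_normal_distribution (sqrt v * t)"
        unfolding char_def normal_law_def by (simp add: integral_distr field_simps)
      moreover have "(\<lambda>n. char (distr M borel (\<lambda>x. (\<Sum>i<n. Z i x) / sqrt (n * (sqrt v)\<^sup>2))) (sqrt v * t))
        \<longlonglongrightarrow> char std_normal_distribution (sqrt v * t)"
        by (rule levy_continuity1[OF _ real_dist_normal_dist clt]) (rule real_distribution_distr, simp)
      ultimately show "(\<lambda>n. char (distr M borel (\<lambda>\<omega>. (\<Sum>i<n. Z i \<omega>) / sqrt (real n))) t) \<longlonglongrightarrow> char (normal_law 0 v) t"
        by simp
    qed
  qed
qed

section \<open>Tail bounds for i.i.d. sums, and cross-fitting\<close>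

text \<open>A new summand is centred and independent of the sum so far, so the cross term integrates
  to zero and second moments add.\<close>

lemma (in prob_space) iid_sum_second_moment:
  assumes ind: "indep_vars (\<lambda>_. N) S J" and "finite J"
    and law: "\<And>i. i \<in> J \<Longrightarrow> distr M N (S i) = \<mu>"
    and u: "u \<in> borel_measurable N" "integrable \<mu> (\<lambda>s. (u s)\<^sup>2)" "(\<integral>s. u s \<partial>\<mu>) = 0"
  shows "integrable M (\<lambda>\<omega>. (\<Sum>i\<in>J. u (S i \<omega>))\<^sup>2)"
    and "(\<integral>\<omega>. (\<Sum>i\<in>J. u (S i \<omega>))\<^sup>2 \<partial>M) = card J * (\<integral>s. (u s)\<^sup>2 \<partial>\<mu>)"
proof -
  have "integrable M (\<lambda>\<omega>. (\<Sum>i\<in>J. u (S i \<omega>))\<^sup>2) \<and>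
    (\<integral>\<omega>. (\<Sum>i\<in>J. u (S i \<omega>))\<^sup>2 \<partial>M) = card J * (\<integral>s. (u s)\<^sup>2 \<partial>\<mu>)"
    using \<open>finite J\<close> ind law
  proof (induction J rule: finite_induct)
    case (insert j J)
    note [measurable] = u(1)
    have S[measurable]: "S i \<in> M \<rightarrow>\<^sub>M N" if "i \<in> insert j J" for i
      using insert.prems(1) that unfolding indep_vars_def2 by blast
    have sq: "integrable M (\<lambda>\<omega>. (u (S i \<omega>))\<^sup>2)"
      and m2: "(\<integral>\<omega>. (u (S i \<omega>))\<^sup>2 \<partial>M) = (\<integral>s. (u s)\<^sup>2 \<partial>\<mu>)"
      and m1: "(\<integral>\<omega>. u (S i \<omega>) \<partial>M) = 0" if "i \<in> insert j J" for i
      using u S[OF that]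
      by (auto simp flip: insert.prems(2)[OF that] simp: integral_distr integrable_distr_eq)
    have int: "integrable M (\<lambda>\<omega>. u (S i \<omega>))" if "i \<in> insert j J" for i
      by (rule square_integrable_imp_integrable[OF _ sq[OF that]]) (use S[OF that] in measurable)
    have "indep_vars (\<lambda>_. borel) (\<lambda>i \<omega>. u (S i \<omega>)) (insert j J)"
      by (rule indep_vars_compose2[OF insert.prems(1)]) measurable
    then have iv: "indep_var borel (\<lambda>\<omega>. u (S j \<omega>)) borel (\<lambda>\<omega>. \<Sum>i\<in>J. u (S i \<omega>))"
      by (rule indep_vars_sum[OF insert.hyps(1,2)])
    have intS: "integrable M (\<lambda>\<omega>. \<Sum>i\<in>J. u (S i \<omega>))"
      using int by (intro Bochner_Integration.integrable_sum) auto
    note cross = indep_var_integrable[OF iv int[of j] intS] indep_var_lebesgue_integral[OF iv int[of j] intS]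
    have IH: "integrable M (\<lambda>\<omega>. (\<Sum>i\<in>J. u (S i \<omega>))\<^sup>2)"
      "(\<integral>\<omega>. (\<Sum>i\<in>J. u (S i \<omega>))\<^sup>2 \<partial>M) = card J * (\<integral>s. (u s)\<^sup>2 \<partial>\<mu>)"
      using insert.IH[OF indep_vars_subset[OF insert.prems(1)]] insert.prems(2) by auto
    have exp: "(\<Sum>i\<in>insert j J. u (S i \<omega>))\<^sup>2 =
       (u (S j \<omega>))\<^sup>2 + (2 * (u (S j \<omega>) * (\<Sum>i\<in>J. u (S i \<omega>))) + (\<Sum>i\<in>J. u (S i \<omega>))\<^sup>2)" for \<omega>
      using insert.hyps by (simp add: power2_sum)
    show ?case unfolding exp
      using cross IH sq[of j] m2[of j] m1[of j] insert.hyps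
      by (simp add: algebra_simps)
  qed simp
  then show "integrable M (\<lambda>\<omega>. (\<Sum>i\<in>J. u (S i \<omega>))\<^sup>2)"
    and "(\<integral>\<omega>. (\<Sum>i\<in>J. u (S i \<omega>))\<^sup>2 \<partial>M) = card J * (\<integral>s. (u s)\<^sup>2 \<partial>\<mu>)" by auto
qed

text \<open>The centred \<open>u\<close> enters through its second moment (Chebyshev),
  \<open>v\<close> only through its first absolute moment (Markov). Each is given half of \<eta>,
  hence the factors 4 and 2. With \<eta> of order sqrt n and \<open>card J\<close> of order n,
  \<open>c\<close> only has to vanish, whereas \<open>e\<close> has to be of smaller order than
  n^(-1/2).\<close>

lemma (in prob_space) prob_iid_sum_le:
  fixes u v :: "'s \<Rightarrow> real" and c e \<eta> :: real
  assumes ind: "indep_vars (\<lambda>_. N) S J" and J: "finite J"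
    and law: "\<And>i. i \<in> J \<Longrightarrow> distr M N (S i) = \<mu>"
    and u: "u \<in> borel_measurable N" "integrable \<mu> (\<lambda>s. (u s)\<^sup>2)" "(\<integral>s. u s \<partial>\<mu>) = 0" "(\<integral>s. (u s)\<^sup>2 \<partial>\<mu>) \<le> c"
    and v: "v \<in> borel_measurable N" "integrable \<mu> v" "(\<integral>s. \<bar>v s\<bar> \<partial>\<mu>) \<le> e"
    and \<eta>: "\<eta> > 0"
  shows "prob {\<omega>\<in>space M. \<bar>\<Sum>i\<in>J. u (S i \<omega>) + v (S i \<omega>)\<bar> > \<eta>} \<le> 4 * card J * c / \<eta>\<^sup>2 + 2 * card J * e / \<eta>"
proof -
  note [measurable] = u(1) v(1)
  have S[measurable]: "S i \<in> M \<rightarrow>\<^sub>M N" if "i \<in> J" for i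
    using ind that unfolding indep_vars_def2 by blast
  have vi: "integrable M (\<lambda>\<omega>. \<bar>v (S i \<omega>)\<bar>)" "(\<integral>\<omega>. \<bar>v (S i \<omega>)\<bar> \<partial>M) = (\<integral>s. \<bar>v s\<bar> \<partial>\<mu>)" if "i \<in> J" for i
    using v(2) S[OF that] by (auto simp flip: law[OF that] simp: integrable_distr_eq integral_distr)
  let ?U = "\<lambda>\<omega>. \<Sum>i\<in>J. u (S i \<omega>)" and ?V = "\<lambda>\<omega>. \<Sum>i\<in>J. v (S i \<omega>)"
  have [measurable]: "?U \<in> borel_measurable M" "?V \<in> borel_measurable M"
    by (auto intro!: borel_measurable_sum)
  have "{\<omega>\<in>space M. \<bar>\<Sum>i\<in>J. u (S i \<omega>) + v (S i \<omega>)\<bar> > \<eta>}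
    \<subseteq> {\<omega>\<in>space M. (?U \<omega>)\<^sup>2 \<ge> (\<eta>/2)\<^sup>2} \<union> {\<omega>\<in>space M. (\<Sum>i\<in>J. \<bar>v (S i \<omega>)\<bar>) \<ge> \<eta>/2}"
  proof (rule subsetI)
    fix \<omega> assume "\<omega> \<in> {\<omega>\<in>space M. \<bar>\<Sum>i\<in>J. u (S i \<omega>) + v (S i \<omega>)\<bar> > \<eta>}"
    then have w: "\<omega> \<in> space M" "\<bar>?U \<omega> + ?V \<omega>\<bar> > \<eta>" by (auto simp: sum.distrib)
    then have "\<bar>?U \<omega>\<bar> \<ge> \<eta>/2 \<or> \<bar>?V \<omega>\<bar> \<ge> \<eta>/2" by linarith
    moreover have "(\<eta>/2)\<^sup>2 \<le> (?U \<omega>)\<^sup>2" if "\<bar>?U \<omega>\<bar> \<ge> \<eta>/2"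
      using that \<eta> by (metis abs_le_square_iff abs_of_pos half_gt_zero)
    moreover have "\<bar>?V \<omega>\<bar> \<le> (\<Sum>i\<in>J. \<bar>v (S i \<omega>)\<bar>)" by (rule sum_abs)
    ultimately have "(?U \<omega>)\<^sup>2 \<ge> (\<eta>/2)\<^sup>2 \<or> (\<Sum>i\<in>J. \<bar>v (S i \<omega>)\<bar>) \<ge> \<eta>/2"
      by linarith
    then show "\<omega> \<in> {\<omega>\<in>space M. (?U \<omega>)\<^sup>2 \<ge> (\<eta>/2)\<^sup>2} \<union> {\<omega>\<in>space M. (\<Sum>i\<in>J. \<bar>v (S i \<omega>)\<bar>) \<ge> \<eta>/2}"
      using w(1) by blast
  qed
  then have "prob {\<omega>\<in>space M. \<bar>\<Sum>i\<in>J. u (S i \<omega>) + v (S i \<omega>)\<bar> > \<eta>}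
    \<le> prob ({\<omega>\<in>space M. (?U \<omega>)\<^sup>2 \<ge> (\<eta>/2)\<^sup>2} \<union> {\<omega>\<in>space M. (\<Sum>i\<in>J. \<bar>v (S i \<omega>)\<bar>) \<ge> \<eta>/2})"
    by (intro finite_measure_mono) measurable
  also have "\<dots> \<le> prob {\<omega>\<in>space M. (?U \<omega>)\<^sup>2 \<ge> (\<eta>/2)\<^sup>2} + prob {\<omega>\<in>space M. (\<Sum>i\<in>J. \<bar>v (S i \<omega>)\<bar>) \<ge> \<eta>/2}"
    by (intro measure_Un_le) measurable
  also have "prob {\<omega>\<in>space M. (?U \<omega>)\<^sup>2 \<ge> (\<eta>/2)\<^sup>2} \<le> (\<integral>\<omega>. (?U \<omega>)\<^sup>2 \<partial>M) / (\<eta>/2)\<^sup>2"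
    using \<eta> iid_sum_second_moment(1)[OF ind J law u(1-3)]
    by (intro integral_Markov_inequality_measure[where A="{}"]) auto
  also have "\<dots> \<le> 4 * card J * c / \<eta>\<^sup>2"
    using mult_left_mono[OF u(4), of "real (card J)"] \<eta>
      iid_sum_second_moment(2)[OF ind J law u(1-3)]
    by (simp add: divide_simps mult.commute)
  also have "prob {\<omega>\<in>space M. (\<Sum>i\<in>J. \<bar>v (S i \<omega>)\<bar>) \<ge> \<eta>/2} \<le> (\<integral>\<omega>. (\<Sum>i\<in>J. \<bar>v (S i \<omega>)\<bar>) \<partial>M) / (\<eta>/2)"
  proof (rule integral_Markov_inequality_measure[where A="{}"])
    show "integrable M (\<lambda>\<omega>. \<Sum>i\<in>J. \<bar>v (S i \<omega>)\<bar>)"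
      using vi by (intro Bochner_Integration.integrable_sum) auto
  qed (use \<eta> in \<open>auto intro!: sum_nonneg\<close>)
  also have "(\<integral>\<omega>. (\<Sum>i\<in>J. \<bar>v (S i \<omega>)\<bar>) \<partial>M) = (\<Sum>i\<in>J. (\<integral>s. \<bar>v s\<bar> \<partial>\<mu>))"
    using vi by (subst Bochner_Integration.integral_sum) auto
  also have "\<dots> / (\<eta>/2) \<le> 2 * card J * e / \<eta>"
    using mult_left_mono[OF v(3), of "real (card J)"] \<eta> by (simp add: divide_simps mult.commute)
  finally show ?thesis by simp
qed

text \<open>The case \<open>v = 0\<close>. Half of \<eta> is given away, but the size of the
  constant is irrelevant for consistency and tightness.\<close>

lemma (in prob_space) prob_iid_centred_sum_le:
  fixes u :: "'s \<Rightarrow> real" and c \<eta> :: real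
  assumes "indep_vars (\<lambda>_. N) S J" "finite J" "\<And>i. i \<in> J \<Longrightarrow> distr M N (S i) = \<mu>"
    and "u \<in> borel_measurable N" "integrable \<mu> (\<lambda>s. (u s)\<^sup>2)" "(\<integral>s. u s \<partial>\<mu>) = 0" "(\<integral>s. (u s)\<^sup>2 \<partial>\<mu>) \<le> c"
    and "\<eta> > 0"
  shows "prob {\<omega>\<in>space M. \<bar>\<Sum>i\<in>J. u (S i \<omega>)\<bar> > \<eta>} \<le> 4 * card J * c / \<eta>\<^sup>2"
proof -
  have "prob {\<omega>\<in>space M. \<bar>\<Sum>i\<in>J. u (S i \<omega>) + (\<lambda>_. 0) (S i \<omega>)\<bar> > \<eta>}
    \<le> real (4 * card J) * c / \<eta>\<^sup>2 + real (2 * card J) * 0 / \<eta>"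
    by (rule prob_iid_sum_le[where v="\<lambda>_. 0", OF assms(1-7) _ _ _ assms(8)]) simp_all
  then show ?thesis by (simp only: add_0_right mult_zero_right div_0)
qed

text \<open>Disjoint index sets make the training data independent of the evaluation sample, so the
  joint law is a product and Fubini's theorem evaluates the probability with the training data
  frozen. Outside \<open>B\<close> the inner probability is at most \<open>b\<close>; on
  \<open>B\<close> it is bounded by 1, which integrates to \<open>prob B\<close>.\<close>

lemma (in prob_space) prob_crossfit_le:
  fixes h :: "('i \<Rightarrow> 's) \<Rightarrow> 's \<Rightarrow> real" and b \<eta> :: real
  assumes ind: "indep_vars (\<lambda>_. N) S I" and AJ: "A \<inter> J = {}" "A \<subseteq> I" "J \<subseteq> I" and J: "finite J"
    and h[measurable]: "(\<lambda>(d, s). h d s) \<in> borel_measurable (PiM A (\<lambda>_. N) \<Otimes>\<^sub>M N)"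
    and B[measurable]: "B \<in> events"
    and good: "\<And>\<omega>. \<omega> \<in> space M - B \<Longrightarrow>
      prob {\<omega>'\<in>space M. \<bar>\<Sum>i\<in>J. h (restrict (\<lambda>i. S i \<omega>) A) (S i \<omega>')\<bar> > \<eta>} \<le> b"
    and "b \<ge> 0"
  shows "prob {\<omega>\<in>space M. \<bar>\<Sum>i\<in>J. h (restrict (\<lambda>i. S i \<omega>) A) (S i \<omega>)\<bar> > \<eta>} \<le> prob B + b"
proof -
  let ?A = "\<lambda>\<omega>. restrict (\<lambda>i. S i \<omega>) A" and ?J = "\<lambda>\<omega>. restrict (\<lambda>i. S i \<omega>) J"
  let ?PA = "PiM A (\<lambda>_. N)" and ?PJ = "PiM J (\<lambda>_. N)"
  have S[measurable]: "S i \<in> M \<rightarrow>\<^sub>M N" if "i \<in> I" for i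
    using ind that unfolding indep_vars_def2 by blast
  have iv: "indep_var ?PA ?A ?PJ ?J"
    by (rule indep_var_restrict[OF ind AJ])
  have mA[measurable]: "?A \<in> M \<rightarrow>\<^sub>M ?PA" and mJ[measurable]: "?J \<in> M \<rightarrow>\<^sub>M ?PJ"
    using indep_var_rv1[OF iv] indep_var_rv2[OF iv] by auto
  define H where "H x = (\<Sum>i\<in>J. h (fst x) (snd x i))" for x
  have H[measurable]: "H \<in> borel_measurable (?PA \<Otimes>\<^sub>M ?PJ)"
    unfolding H_def
  proof (rule borel_measurable_sum)
    fix i assume "i \<in> J"
    then have "(\<lambda>x. (fst x, snd x i)) \<in> ?PA \<Otimes>\<^sub>M ?PJ \<rightarrow>\<^sub>M ?PA \<Otimes>\<^sub>M N" by measurable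
    from measurable_compose[OF this h]
    show "(\<lambda>x. h (fst x) (snd x i)) \<in> borel_measurable (?PA \<Otimes>\<^sub>M ?PJ)" by simp
  qed
  define E where "E = {x\<in>space (?PA \<Otimes>\<^sub>M ?PJ). \<bar>H x\<bar> > \<eta>}"
  have E[measurable]: "E \<in> sets (?PA \<Otimes>\<^sub>M ?PJ)" unfolding E_def by measurable
  interpret DA: prob_space "distr M ?PA ?A" by (rule prob_space_distr) fact
  interpret DJ: prob_space "distr M ?PJ ?J" by (rule prob_space_distr) fact
  interpret XY: pair_prob_space "distr M ?PA ?A" "distr M ?PJ ?J" ..
  have HJ: "H (?A \<omega>, ?J \<omega>') = (\<Sum>i\<in>J. h (?A \<omega>) (S i \<omega>'))" for \<omega> \<omega>'
    unfolding H_def by (auto intro!: sum.cong)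
  have sp: "?A \<omega> \<in> space ?PA" "?J \<omega> \<in> space ?PJ" if "\<omega> \<in> space M" for \<omega>
    using that measurable_space[OF mA] measurable_space[OF mJ] by auto
  have "emeasure M {\<omega>\<in>space M. \<bar>\<Sum>i\<in>J. h (?A \<omega>) (S i \<omega>)\<bar> > \<eta>}
      = emeasure M ((\<lambda>\<omega>. (?A \<omega>, ?J \<omega>)) -` E \<inter> space M)"
    by (rule arg_cong[where f="emeasure M"]) (auto simp: E_def HJ space_pair_measure sp simp del: restrict_apply)
  also have "\<dots> = emeasure (distr M (?PA \<Otimes>\<^sub>M ?PJ) (\<lambda>\<omega>. (?A \<omega>, ?J \<omega>))) E"
    by (subst emeasure_distr) auto
  also have "\<dots> = emeasure (distr M ?PA ?A \<Otimes>\<^sub>M distr M ?PJ ?J) E"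
    using iv by (simp add: indep_var_distribution_eq)
  also have "\<dots> = (\<integral>\<^sup>+d. emeasure (distr M ?PJ ?J) (Pair d -` E) \<partial>distr M ?PA ?A)"
    by (rule DJ.emeasure_pair_measure_alt) simp
  also have "\<dots> = (\<integral>\<^sup>+\<omega>. emeasure (distr M ?PJ ?J) (Pair (?A \<omega>) -` E) \<partial>M)"
    by (rule nn_integral_distr[OF mA]) (rule DJ.measurable_emeasure_Pair, simp)
  also have "\<dots> \<le> (\<integral>\<^sup>+\<omega>. indicator B \<omega> + ennreal b \<partial>M)"
  proof (rule nn_integral_mono)
    fix \<omega> assume w: "\<omega> \<in> space M"
    have "emeasure (distr M ?PJ ?J) (Pair (?A \<omega>) -` E) = emeasure M (?J -` (Pair (?A \<omega>) -` E) \<inter> space M)"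
      by (rule emeasure_distr) (auto intro!: sets_Pair1)
    also have "?J -` (Pair (?A \<omega>) -` E) \<inter> space M = {\<omega>'\<in>space M. \<bar>\<Sum>i\<in>J. h (?A \<omega>) (S i \<omega>')\<bar> > \<eta>}"
      using w by (auto simp: E_def HJ space_pair_measure sp simp del: restrict_apply)
    finally have eq: "emeasure (distr M ?PJ ?J) (Pair (?A \<omega>) -` E) = ennreal (prob {\<omega>'\<in>space M. \<bar>\<Sum>i\<in>J. h (?A \<omega>) (S i \<omega>')\<bar> > \<eta>})"
      by (simp only: emeasure_eq_measure)
    show "emeasure (distr M ?PJ ?J) (Pair (?A \<omega>) -` E) \<le> indicator B \<omega> + ennreal b"
    proof (cases "\<omega> \<in> B")
      case True
      have "emeasure (distr M ?PJ ?J) (Pair (?A \<omega>) -` E) \<le> 1" unfolding eq by (simp add: ennreal_le_1)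
      also have "\<dots> \<le> 1 + ennreal b" by simp
      finally show ?thesis using True by simp
    next
      case False
      then show ?thesis using good[of \<omega>] w unfolding eq by (simp add: ennreal_leI)
    qed
  qed
  also have "\<dots> = emeasure M B + ennreal b"
    by (subst nn_integral_add) (auto simp: emeasure_space_1)
  also have "\<dots> = ennreal (prob B + b)"
    using \<open>b \<ge> 0\<close> by (simp add: emeasure_eq_measure ennreal_plus)
  finally show ?thesis
    unfolding emeasure_eq_measure using \<open>b \<ge> 0\<close> by (subst (asm) ennreal_le_iff) auto
qed

section \<open>Regression functions under conditioning on an event\<close>

text \<open>A real-valued density gives access to the transfer rules for Bochner integrals, by which
  expectations given a group become expectations under \<open>M\<close> with an indicator.\<close>

lemma (in prob_space) given_eq_density:
  assumes [measurable]: "Measurable.pred M A" and pos: "prob {\<omega>\<in>space M. A \<omega>} > 0"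
  shows "given M A = density M (\<lambda>\<omega>. ennreal (of_bool (A \<omega>) / prob {\<omega>\<in>space M. A \<omega>}))"
  unfolding given_def uniform_measure_def
proof (intro density_cong AE_I2)
  fix \<omega> assume "\<omega> \<in> space M"
  then have "indicator {\<omega>\<in>space M. A \<omega>} \<omega> = ennreal (of_bool (A \<omega>))" by simp
  then show "indicator {\<omega>\<in>space M. A \<omega>} \<omega> / emeasure M {\<omega>\<in>space M. A \<omega>}
      = ennreal (of_bool (A \<omega>) / prob {\<omega>\<in>space M. A \<omega>})"
    using pos unfolding emeasure_eq_measure by (simp add: divide_ennreal)
qed (use pos in measurable)

lemma (in prob_space) prob_space_given:
  assumes "prob {\<omega>\<in>space M. A \<omega>} > 0"
  shows "prob_space (given M A)"
  unfolding given_def using assms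
  by (intro prob_space_uniform_measure) (auto simp: emeasure_eq_measure)

lemma space_given[simp]: "space (given M A) = space M"
  by (simp add: given_def)

lemma sets_given[measurable_cong, simp]: "sets (given M A) = sets M"
  by (simp add: given_def)

lemma (in prob_space)
  fixes f :: "_ \<Rightarrow> real"
  assumes [measurable]: "Measurable.pred M A" "f \<in> borel_measurable M"
    and pos: "prob {\<omega>\<in>space M. A \<omega>} > 0"
  shows integral_given_eq: "(\<integral>\<omega>. f \<omega> \<partial>given M A) = (\<integral>\<omega>. of_bool (A \<omega>) * f \<omega> \<partial>M) / prob {\<omega>\<in>space M. A \<omega>}"
    and integrable_given_iff: "integrable (given M A) f \<longleftrightarrow> integrable M (\<lambda>\<omega>. of_bool (A \<omega>) * f \<omega>)"
proof -
  show "(\<integral>\<omega>. f \<omega> \<partial>given M A) = (\<integral>\<omega>. of_bool (A \<omega>) * f \<omega> \<partial>M) / prob {\<omega>\<in>space M. A \<omega>}"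
    unfolding given_eq_density[OF assms(1) pos] by (subst integral_density) (auto simp flip: integral_divide_zero)
  have "integrable (given M A) f \<longleftrightarrow> integrable M (\<lambda>\<omega>. (of_bool (A \<omega>) * f \<omega>) / prob {\<omega>\<in>space M. A \<omega>})"
    unfolding given_eq_density[OF assms(1) pos] by (subst integrable_density) auto
  also have "\<dots> \<longleftrightarrow> integrable M (\<lambda>\<omega>. of_bool (A \<omega>) * f \<omega>)"
    unfolding divide_inverse using pos by (subst integrable_mult_right_iff) auto
  finally show "integrable (given M A) f \<longleftrightarrow> integrable M (\<lambda>\<omega>. of_bool (A \<omega>) * f \<omega>)" .
qed

lemma (in prob_space) nn_integral_given:
  assumes [measurable]: "Measurable.pred M A" "f \<in> borel_measurable M"
    and pos: "prob {\<omega>\<in>space M. A \<omega>} > 0"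
  shows "(\<integral>\<^sup>+\<omega>. of_bool (A \<omega>) * f \<omega> \<partial>M) = ennreal (prob {\<omega>\<in>space M. A \<omega>}) * (\<integral>\<^sup>+\<omega>. f \<omega> \<partial>given M A)"
proof -
  let ?c = "prob {\<omega>\<in>space M. A \<omega>}"
  have "ennreal ?c * (\<integral>\<^sup>+\<omega>. f \<omega> \<partial>given M A) = (\<integral>\<^sup>+\<omega>. ennreal ?c * (ennreal (of_bool (A \<omega>) / ?c) * f \<omega>) \<partial>M)"
    unfolding given_eq_density[OF assms(1) pos]
    by (subst nn_integral_density) (auto simp: nn_integral_cmult)
  also have "\<dots> = (\<integral>\<^sup>+\<omega>. of_bool (A \<omega>) * f \<omega> \<partial>M)"
    using pos by (intro nn_integral_cong) (auto simp flip: mult.assoc ennreal_mult)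
  finally show ?thesis ..
qed

lemma (in prob_space) AE_given_iff:
  assumes [measurable]: "Measurable.pred M A" and pos: "prob {\<omega>\<in>space M. A \<omega>} > 0"
  shows "(AE \<omega> in given M A. R \<omega>) \<longleftrightarrow> (AE \<omega> in M. A \<omega> \<longrightarrow> R \<omega>)"
proof -
  have "(AE \<omega> in given M A. R \<omega>) \<longleftrightarrow> (AE \<omega> in M. \<omega> \<in> {\<omega>\<in>space M. A \<omega>} \<longrightarrow> R \<omega>)"
    unfolding given_def using pos
    by (intro AE_uniform_measure) (auto simp: emeasure_eq_measure)
  also have "\<dots> \<longleftrightarrow> (AE \<omega> in M. A \<omega> \<longrightarrow> R \<omega>)"
    by (intro AE_cong) auto
  finally show ?thesis .
qed

section \<open>Conditional expectation given the covariates\<close>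

lemma (in prob_space) finite_measure_subalgebra_vimage:
  assumes X: "X \<in> M \<rightarrow>\<^sub>M N"
  shows "finite_measure_subalgebra M (vimage_algebra (space M) X N)"
proof
  show "subalgebra M (vimage_algebra (space M) X N)"
    unfolding subalgebra_def using sets_vimage_algebra2[of X "space M" N] X measurable_space[OF X]
    by (auto simp: Pi_iff intro!: measurable_sets)
qed

lemma measurable_vimage_algebra_comp:
  assumes "X \<in> space Q \<rightarrow> space N" "f \<in> N \<rightarrow>\<^sub>M K"
  shows "(\<lambda>\<omega>. f (X \<omega>)) \<in> vimage_algebra (space Q) X N \<rightarrow>\<^sub>M K"
  by (rule measurable_compose[OF measurable_vimage_algebra1 assms(2)]) fact

text \<open>The X-measurable factor moves through the conditional expectation. Integrability is
  asked of the product only, since the multiplier may be unbounded, for instance \<open>m\<close>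
  itself.\<close>

lemma regression_fn_integral:
  fixes X :: "'w \<Rightarrow> 'x::euclidean_space"
  assumes Q: "prob_space Q" and X[measurable]: "X \<in> borel_measurable Q"
    and reg: "regression_fn Q X Z m"
    and f[measurable]: "f \<in> borel_measurable borel" and int: "integrable Q (\<lambda>\<omega>. f (X \<omega>) * Z \<omega>)"
  shows "integrable Q (\<lambda>\<omega>. f (X \<omega>) * m (X \<omega>))"
    and "(\<integral>\<omega>. f (X \<omega>) * m (X \<omega>) \<partial>Q) = (\<integral>\<omega>. f (X \<omega>) * Z \<omega> \<partial>Q)"
proof -
  interpret prob_space Q by fact
  let ?F = "vimage_algebra (space Q) X borel"
  interpret finite_measure_subalgebra Q ?F by (rule finite_measure_subalgebra_vimage) fact
  have Z[measurable]: "Z \<in> borel_measurable Q" and m[measurable]: "m \<in> borel_measurable borel"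
    and eq: "AE \<omega> in Q. m (X \<omega>) = real_cond_exp Q ?F Z \<omega>"
    using reg by (auto simp: regression_fn_def)
  have fX: "(\<lambda>\<omega>. f (X \<omega>)) \<in> borel_measurable ?F"
    by (rule measurable_vimage_algebra_comp) auto
  note ce = real_cond_exp_intg[OF int fX Z]
  have ae: "AE \<omega> in Q. f (X \<omega>) * real_cond_exp Q ?F Z \<omega> = f (X \<omega>) * m (X \<omega>)"
    using eq by auto
  show "integrable Q (\<lambda>\<omega>. f (X \<omega>) * m (X \<omega>))"
    using ce(1) ae by (subst integrable_cong_AE[symmetric, OF _ _ ae]) auto
  show "(\<integral>\<omega>. f (X \<omega>) * m (X \<omega>) \<partial>Q) = (\<integral>\<omega>. f (X \<omega>) * Z \<omega> \<partial>Q)"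
    using ce(2) by (subst integral_cong_AE[symmetric, OF _ _ ae]) auto
qed

lemma regression_fn_integrable:
  fixes X :: "'w \<Rightarrow> 'x::euclidean_space"
  assumes "prob_space Q" "X \<in> borel_measurable Q" "regression_fn Q X Z m"
  shows "integrable Q (\<lambda>\<omega>. m (X \<omega>))" "(\<integral>\<omega>. m (X \<omega>) \<partial>Q) = (\<integral>\<omega>. Z \<omega> \<partial>Q)"
  using regression_fn_integral[OF assms, of "\<lambda>_. 1"] assms(3) by (auto simp: regression_fn_def)

text \<open>Every set of the generated sigma-algebra is the preimage of a Borel set under X, so
  testing against indicators of such sets characterises the conditional expectation. This is how the
  pooled control group is handled.\<close>

lemma regression_fnI:
  fixes X :: "'w \<Rightarrow> 'x::euclidean_space"
  assumes Q: "prob_space Q" and X[measurable]: "X \<in> borel_measurable Q"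
    and Z: "integrable Q Z" and m[measurable]: "m \<in> borel_measurable borel" and mX: "integrable Q (\<lambda>\<omega>. m (X \<omega>))"
    and eq: "\<And>B. B \<in> sets borel \<Longrightarrow>
      (\<integral>\<omega>. indicator B (X \<omega>) * Z \<omega> \<partial>Q) = (\<integral>\<omega>. indicator B (X \<omega>) * m (X \<omega>) \<partial>Q)"
  shows "regression_fn Q X Z m"
proof -
  interpret prob_space Q by fact
  let ?F = "vimage_algebra (space Q) X borel"
  interpret finite_measure_subalgebra Q ?F by (rule finite_measure_subalgebra_vimage) fact
  have "AE \<omega> in Q. real_cond_exp Q ?F Z \<omega> = m (X \<omega>)"
  proof (rule real_cond_exp_charact)
    fix A assume "A \<in> sets ?F"
    then obtain B where B: "B \<in> sets borel" "A = X -` B \<inter> space Q"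
      by (auto simp: sets_vimage_algebra2)
    have "(\<integral>\<omega>\<in>A. Z \<omega> \<partial>Q) = (\<integral>\<omega>. indicator B (X \<omega>) * Z \<omega> \<partial>Q)"
      unfolding set_lebesgue_integral_def B(2) by (intro Bochner_Integration.integral_cong) (auto simp: indicator_def)
    moreover have "(\<integral>\<omega>\<in>A. m (X \<omega>) \<partial>Q) = (\<integral>\<omega>. indicator B (X \<omega>) * m (X \<omega>) \<partial>Q)"
      unfolding set_lebesgue_integral_def B(2) by (intro Bochner_Integration.integral_cong) (auto simp: indicator_def)
    ultimately show "(\<integral>\<omega>\<in>A. Z \<omega> \<partial>Q) = (\<integral>\<omega>\<in>A. m (X \<omega>) \<partial>Q)"
      using eq[OF B(1)] by simp
  qed (use Z mX in \<open>auto intro!: measurable_vimage_algebra_comp\<close>)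
  then show ?thesis unfolding regression_fn_def using Z by auto
qed

lemma regression_fn_AE_cong:
  assumes "regression_fn Q X Z m" "AE \<omega> in Q. m (X \<omega>) = m' (X \<omega>)" "m' \<in> borel_measurable borel"
  shows "regression_fn Q X Z m'"
  using assms unfolding regression_fn_def by auto

lemma regression_fn_minus:
  fixes X :: "'w \<Rightarrow> 'x::euclidean_space"
  assumes Q: "prob_space Q" and X[measurable]: "X \<in> borel_measurable Q"
    and reg: "regression_fn Q X Z m" and f[measurable]: "f \<in> borel_measurable borel" and fX: "integrable Q (\<lambda>\<omega>. f (X \<omega>))"
  shows "regression_fn Q X (\<lambda>\<omega>. Z \<omega> - f (X \<omega>)) (\<lambda>x. m x - f x)"
proof -
  interpret prob_space Q by fact
  let ?F = "vimage_algebra (space Q) X borel"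
  interpret finite_measure_subalgebra Q ?F by (rule finite_measure_subalgebra_vimage) fact
  have Z: "integrable Q Z" and m[measurable]: "m \<in> borel_measurable borel"
    and eq: "AE \<omega> in Q. m (X \<omega>) = real_cond_exp Q ?F Z \<omega>"
    using reg by (auto simp: regression_fn_def)
  have "(\<lambda>\<omega>. f (X \<omega>)) \<in> borel_measurable ?F" by (rule measurable_vimage_algebra_comp) auto
  from real_cond_exp_F_meas[OF fX this]
  have "AE \<omega> in Q. real_cond_exp Q ?F (\<lambda>\<omega>. f (X \<omega>)) \<omega> = f (X \<omega>)" .
  with real_cond_exp_diff[OF Z fX] eq have "AE \<omega> in Q. m (X \<omega>) - f (X \<omega>) = real_cond_exp Q ?F (\<lambda>\<omega>. Z \<omega> - f (X \<omega>)) \<omega>"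
    by eventually_elim simp
  then show ?thesis using Z fX unfolding regression_fn_def by auto
qed

text \<open>Conditional Jensen inequality for the square.\<close>

lemma regression_fn_square_integrable:
  fixes X :: "'w \<Rightarrow> 'x::euclidean_space"
  assumes Q: "prob_space Q" and X[measurable]: "X \<in> borel_measurable Q"
    and reg: "regression_fn Q X Z m" and Z2: "integrable Q (\<lambda>\<omega>. (Z \<omega>)\<^sup>2)"
  shows "integrable Q (\<lambda>\<omega>. (m (X \<omega>))\<^sup>2)"
proof -
  interpret prob_space Q by fact
  let ?F = "vimage_algebra (space Q) X borel"
  interpret finite_measure_subalgebra Q ?F by (rule finite_measure_subalgebra_vimage) fact
  have Z: "integrable Q Z" and m[measurable]: "m \<in> borel_measurable borel"
    and eq: "AE \<omega> in Q. m (X \<omega>) = real_cond_exp Q ?F Z \<omega>"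
    using reg by (auto simp: regression_fn_def)
  have "integrable Q (\<lambda>\<omega>. (real_cond_exp Q ?F Z \<omega>)\<^sup>2)"
    by (rule integrable_convex_cond_exp[where I=UNIV and q="\<lambda>x. x\<^sup>2"])
       (use Z Z2 convex_power2 in auto)
  moreover have "AE \<omega> in Q. (real_cond_exp Q ?F Z \<omega>)\<^sup>2 = (m (X \<omega>))\<^sup>2"
    using eq by auto
  ultimately show ?thesis by (subst integrable_cong_AE[symmetric]) auto
qed

lemma integrable_mult_square_integrable:
  fixes f g :: "'a \<Rightarrow> real"
  assumes [measurable]: "f \<in> borel_measurable M" "g \<in> borel_measurable M"
    and "integrable M (\<lambda>x. (f x)\<^sup>2)" "integrable M (\<lambda>x. (g x)\<^sup>2)"
  shows "integrable M (\<lambda>x. f x * g x)"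
proof (rule Bochner_Integration.integrable_bound)
  show "integrable M (\<lambda>x. (f x)\<^sup>2 + (g x)\<^sup>2)" using assms by auto
  have "\<bar>a * b\<bar> \<le> a\<^sup>2 + b\<^sup>2" for a b :: real
  proof -
    have "2 * (\<bar>a\<bar> * \<bar>b\<bar>) \<le> a\<^sup>2 + b\<^sup>2" "0 \<le> \<bar>a\<bar> * \<bar>b\<bar>"
      using sum_squares_bound[of "\<bar>a\<bar>" "\<bar>b\<bar>"] by (simp_all add: mult.assoc)
    then show ?thesis unfolding abs_mult by linarith
  qed
  then show "AE x in M. norm (f x * g x) \<le> norm ((f x)\<^sup>2 + (g x)\<^sup>2)" by simp
qed measurable

text \<open>Pythagoras: \<open>Z - m (X)\<close> is orthogonal to square integrable functions of X,
  and \<open>m (X) - \<theta>\<close> is one of them. This produces the first two summands of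
  \<open>V_PT\<close>.\<close>

lemma regression_fn_second_moment:
  fixes X :: "'w \<Rightarrow> 'x::euclidean_space"
  assumes Q: "prob_space Q" and X[measurable]: "X \<in> borel_measurable Q"
    and reg: "regression_fn Q X Z m" and Z2: "integrable Q (\<lambda>\<omega>. (Z \<omega>)\<^sup>2)"
  shows "integrable Q (\<lambda>\<omega>. (Z \<omega> - m (X \<omega>))\<^sup>2)" "integrable Q (\<lambda>\<omega>. (m (X \<omega>) - \<theta>)\<^sup>2)" 
    "(\<integral>\<omega>. (Z \<omega> - \<theta>)\<^sup>2 \<partial>Q) = (\<integral>\<omega>. (Z \<omega> - m (X \<omega>))\<^sup>2 \<partial>Q) + (\<integral>\<omega>. (m (X \<omega>) - \<theta>)\<^sup>2 \<partial>Q)"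
proof -
  interpret prob_space Q by fact
  have Z: "integrable Q Z" and m[measurable]: "m \<in> borel_measurable borel"
    using reg by (auto simp: regression_fn_def)
  then have [measurable]: "Z \<in> borel_measurable Q" by auto
  note m2 = regression_fn_square_integrable[OF Q X reg Z2]
  note m1 = regression_fn_integrable[OF Q X reg]
  note Zm = integrable_mult_square_integrable[OF _ _ Z2 m2]
  have mZ: "integrable Q (\<lambda>\<omega>. m (X \<omega>) * Z \<omega>)" using Zm by (simp add: mult.commute)
  note reg_m = regression_fn_integral[OF Q X reg m mZ]
  show i1: "integrable Q (\<lambda>\<omega>. (Z \<omega> - m (X \<omega>))\<^sup>2)"
    using Z2 m2 Zm by (simp add: power2_diff mult.assoc)
  show i2: "integrable Q (\<lambda>\<omega>. (m (X \<omega>) - \<theta>)\<^sup>2)"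
    using m2 m1 by (simp add: power2_diff)
  have "(\<integral>\<omega>. (Z \<omega> - \<theta>)\<^sup>2 \<partial>Q) = (\<integral>\<omega>. (Z \<omega>)\<^sup>2 \<partial>Q) + \<theta>\<^sup>2 - 2 * \<theta> * (\<integral>\<omega>. Z \<omega> \<partial>Q)"
    using Z2 Z by (simp add: power2_diff prob_space algebra_simps)
  moreover have "(\<integral>\<omega>. (m (X \<omega>) - \<theta>)\<^sup>2 \<partial>Q) = (\<integral>\<omega>. (m (X \<omega>))\<^sup>2 \<partial>Q) + \<theta>\<^sup>2 - 2 * \<theta> * (\<integral>\<omega>. Z \<omega> \<partial>Q)"
    using m2 m1 by (simp add: power2_diff prob_space algebra_simps)
  moreover have "(\<integral>\<omega>. (Z \<omega> - m (X \<omega>))\<^sup>2 \<partial>Q)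
      = (\<integral>\<omega>. (Z \<omega>)\<^sup>2 + (m (X \<omega>))\<^sup>2 - 2 * (m (X \<omega>) * Z \<omega>) \<partial>Q)"
    by (simp add: power2_diff algebra_simps)
  moreover have "\<dots> = (\<integral>\<omega>. (Z \<omega>)\<^sup>2 \<partial>Q) - (\<integral>\<omega>. (m (X \<omega>))\<^sup>2 \<partial>Q)"
    using Z2 m2 mZ reg_m by (simp add: power2_eq_square[of "m _"])
  ultimately show "(\<integral>\<omega>. (Z \<omega> - \<theta>)\<^sup>2 \<partial>Q) = (\<integral>\<omega>. (Z \<omega> - m (X \<omega>))\<^sup>2 \<partial>Q) + (\<integral>\<omega>. (m (X \<omega>) - \<theta>)\<^sup>2 \<partial>Q)"
    by simp
qed

lemma regression_fn_cong_AE: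
  assumes "regression_fn Q X Z m" "AE \<omega> in Q. Z \<omega> = Z' \<omega>" "Z' \<in> borel_measurable Q" "prob_space Q"
    and X: "X \<in> borel_measurable Q"
  shows "regression_fn Q X Z' m"
proof -
  interpret prob_space Q by fact
  let ?F = "vimage_algebra (space Q) X borel"
  interpret finite_measure_subalgebra Q ?F by (rule finite_measure_subalgebra_vimage[OF X])
  have Z: "integrable Q Z" "m \<in> borel_measurable borel" "AE \<omega> in Q. m (X \<omega>) = real_cond_exp Q ?F Z \<omega>"
    using assms(1) by (auto simp: regression_fn_def)
  then have [measurable]: "Z \<in> borel_measurable Q" by auto
  have "integrable Q Z'"
    using integrable_cong_AE[OF _ assms(3) assms(2)] Z(1) by simp
  moreover have "AE \<omega> in Q. real_cond_exp Q ?F Z \<omega> = real_cond_exp Q ?F Z' \<omega>"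
    by (rule real_cond_exp_cong) (use assms in auto)
  with Z(3) have "AE \<omega> in Q. m (X \<omega>) = real_cond_exp Q ?F Z' \<omega>"
    by eventually_elim simp
  ultimately show ?thesis using Z(2) by (simp add: regression_fn_def)
qed

lemma regression_fn_unique:
  assumes "regression_fn Q X Z m" "regression_fn Q X Z m'"
  shows "AE \<omega> in Q. m (X \<omega>) = m' (X \<omega>)"
proof -
  have "AE \<omega> in Q. m (X \<omega>) = real_cond_exp Q (vimage_algebra (space Q) X borel) Z \<omega>"
    "AE \<omega> in Q. m' (X \<omega>) = real_cond_exp Q (vimage_algebra (space Q) X borel) Z \<omega>"
    using assms by (auto simp: regression_fn_def)
  then show ?thesis by eventually_elim simp
qed

section \<open>Norms and outer probabilities\<close>

declare sum.cl_ivl_Suc[simp del] One_nat_def[simp del]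

lemma ennreal_power2_le_imp_le:
  assumes "x\<^sup>2 \<le> (ennreal c)\<^sup>2" "c \<ge> 0"
  shows "x \<le> ennreal c"
proof (cases x)
  case (real y)
  have "ennreal (y\<^sup>2) \<le> ennreal (c\<^sup>2)"
    using assms(1) real assms(2) by (simp only: ennreal_power)
  then have "y\<^sup>2 \<le> c\<^sup>2" by (simp only: ennreal_le_iff zero_le_power2)
  then have "y \<le> c" using assms(2) by (rule power2_le_imp_le)
  then show ?thesis unfolding real(2) by (rule ennreal_leI)
next
  case top
  have t: "(top::ennreal)\<^sup>2 = top" by simp
  have "x\<^sup>2 \<noteq> top"
    using assms ennreal_power[of c 2] by (metis ennreal_neq_top top_unique)
  then show ?thesis using top t by simp
qed

text \<open>The complement of the support is a union of null open sets, and by Lindelof countably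
  many of them suffice. Conditions imposed on the support thereby become almost sure statements
  about X.\<close>

lemma AE_in_support:
  fixes F :: "'a::second_countable_topology measure"
  assumes F: "sets F = sets borel"
  shows "AE x in F. x \<in> support F"
proof -
  define \<U> where "\<U> = {U :: 'a set. open U \<and> emeasure F U = 0}"
  obtain \<V> where \<V>: "\<V> \<subseteq> \<U>" "countable \<V>" "\<Union>\<V> = \<Union>\<U>"
    by (rule Lindelof[of \<U>]) (auto simp: \<U>_def)
  have "(\<Union>U\<in>\<V>. U) \<in> null_sets F"
  proof (rule null_sets_UN')
    fix U assume "U \<in> \<V>"
    then show "U \<in> null_sets F" using \<V>(1) F by (auto simp: \<U>_def null_sets_def)
  qed (rule \<V>(2))
  then have "\<Union>\<U> \<in> null_sets F" using \<V>(3) by simp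
  then have "AE x in F. x \<notin> \<Union>\<U>" by (rule AE_not_in)
  then show ?thesis
    by eventually_elim (auto simp: support_def \<U>_def zero_less_iff_neq_zero)
qed

lemma L2_norm_eq_power2:
  assumes "L2_norm F f \<noteq> \<infinity>"
  shows "(\<integral>\<^sup>+x. ennreal ((f x)\<^sup>2) \<partial>F) = (L2_norm F f)\<^sup>2"
proof -
  define I where "I = (\<integral>\<^sup>+x. ennreal ((f x)\<^sup>2) \<partial>F)"
  have "I \<noteq> \<infinity>" using assms by (auto simp: L2_norm_def I_def Let_def split: if_splits)
  then obtain c where c: "I = ennreal c" "c \<ge> 0" by (cases I) auto
  have "L2_norm F f = ennreal (sqrt c)"
    using c \<open>I \<noteq> \<infinity>\<close> by (simp add: L2_norm_def I_def[symmetric])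
  moreover have "(ennreal (sqrt c))\<^sup>2 = ennreal c" using c(2) by (simp add: ennreal_power)
  ultimately show ?thesis using c(1) unfolding I_def by simp
qed

lemma nn_integral_le_of_L2_norm_le:
  assumes "L2_norm F f \<le> ennreal e" "e \<ge> 0"
  shows "(\<integral>\<^sup>+x. ennreal ((f x)\<^sup>2) \<partial>F) \<le> ennreal (e\<^sup>2)"
proof -
  have "L2_norm F f \<noteq> \<infinity>" using assms(1) by (metis ennreal_neq_top infinity_ennreal_def top_unique)
  from L2_norm_eq_power2[OF this] have "(\<integral>\<^sup>+x. ennreal ((f x)\<^sup>2) \<partial>F) = (L2_norm F f)\<^sup>2" .
  also have "\<dots> \<le> (ennreal e)\<^sup>2" using assms(1) by (rule power_mono) simp
  finally show ?thesis using assms(2) by (simp add: ennreal_power)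
qed

lemma nn_integral_mult_le_of_L2_norm_le:
  assumes "L2_norm F f * L2_norm F g \<le> ennreal e" "e \<ge> 0" "L2_norm F f \<le> ennreal a" "L2_norm F g \<le> ennreal b"
  shows "(\<integral>\<^sup>+x. ennreal ((f x)\<^sup>2) \<partial>F) * (\<integral>\<^sup>+x. ennreal ((g x)\<^sup>2) \<partial>F) \<le> ennreal (e\<^sup>2)"
proof -
  have "L2_norm F f \<noteq> \<infinity>" "L2_norm F g \<noteq> \<infinity>"
    using assms(3,4) by (metis ennreal_neq_top infinity_ennreal_def top_unique)+
  then have "(\<integral>\<^sup>+x. ennreal ((f x)\<^sup>2) \<partial>F) * (\<integral>\<^sup>+x. ennreal ((g x)\<^sup>2) \<partial>F) = (L2_norm F f * L2_norm F g)\<^sup>2"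
    by (simp add: L2_norm_eq_power2 power_mult_distrib)
  also have "\<dots> \<le> (ennreal e)\<^sup>2" using assms(1) by (rule power_mono) simp
  finally show ?thesis using assms(2) by (simp add: ennreal_power)
qed

text \<open>The rates are stated with outer measures, because a supremum norm need not be measurable.
  Covering the exceptional set by an event makes them usable in Fubini arguments.\<close>

definition holds_outside :: "'v measure \<Rightarrow> real \<Rightarrow> ('v \<Rightarrow> bool) \<Rightarrow> bool" where
  "holds_outside M \<delta> R \<longleftrightarrow> (\<exists>B\<in>sets M. measure M B \<le> \<delta> \<and> (\<forall>\<omega>\<in>space M - B. R \<omega>))"

lemma holds_outside_mono:
  "holds_outside M \<delta> R \<Longrightarrow> \<delta> \<le> \<delta>' \<Longrightarrow> (\<And>\<omega>. \<omega> \<in> space M \<Longrightarrow> R \<omega> \<Longrightarrow> R' \<omega>) \<Longrightarrow> holds_outside M \<delta>' R'"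
  unfolding holds_outside_def by (meson DiffD1 order_trans)

context prob_space
begin

lemma holds_outside_conj:
  assumes "holds_outside M \<delta>\<^sub>1 R\<^sub>1" "holds_outside M \<delta>\<^sub>2 R\<^sub>2"
  shows "holds_outside M (\<delta>\<^sub>1 + \<delta>\<^sub>2) (\<lambda>\<omega>. R\<^sub>1 \<omega> \<and> R\<^sub>2 \<omega>)"
proof -
  obtain B\<^sub>1 B\<^sub>2 where B: "B\<^sub>1 \<in> events" "prob B\<^sub>1 \<le> \<delta>\<^sub>1" "\<forall>\<omega>\<in>space M - B\<^sub>1. R\<^sub>1 \<omega>"
    "B\<^sub>2 \<in> events" "prob B\<^sub>2 \<le> \<delta>\<^sub>2" "\<forall>\<omega>\<in>space M - B\<^sub>2. R\<^sub>2 \<omega>"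
    using assms unfolding holds_outside_def by auto
  have "prob (B\<^sub>1 \<union> B\<^sub>2) \<le> \<delta>\<^sub>1 + \<delta>\<^sub>2"
    using measure_Un_le[OF B(1,4)] B(2,5) by linarith
  then show ?thesis unfolding holds_outside_def using B by (intro bexI[of _ "B\<^sub>1 \<union> B\<^sub>2"]) auto
qed

lemma holds_outside_ball:
  assumes "finite H" "\<And>h. h \<in> H \<Longrightarrow> holds_outside M \<delta> (R h)"
  shows "holds_outside M (real (card H) * \<delta>) (\<lambda>\<omega>. \<forall>h\<in>H. R h \<omega>)"
  using assms
proof (induction H rule: finite_induct)
  case empty
  show ?case unfolding holds_outside_def by (intro bexI[of _ "{}"]) auto
next
  case (insert h H)
  from holds_outside_conj[OF insert.prems[of h] insert.IH] insert.prems insert.hyps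
  show ?case by (simp add: algebra_simps)
qed

lemma holds_outside_AE:
  assumes "AE \<omega> in M. R \<omega>"
  shows "holds_outside M 0 R"
proof -
  obtain B where "{\<omega>\<in>space M. \<not> R \<omega>} \<subseteq> B" "emeasure M B = 0" "B \<in> events"
    using AE_E[OF assms] by metis
  then show ?thesis unfolding holds_outside_def by (intro bexI[of _ B]) (auto simp: measure_def)
qed

lemma holds_outside_prob:
  assumes [measurable]: "f \<in> borel_measurable M"
  shows "holds_outside M (prob {\<omega>\<in>space M. \<bar>f \<omega>\<bar> > (\<eta>::real)}) (\<lambda>\<omega>. \<bar>f \<omega>\<bar> \<le> \<eta>)"
  unfolding holds_outside_def by (intro bexI[of _ "{\<omega>\<in>space M. \<bar>f \<omega>\<bar> > \<eta>}"]) auto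

lemma prob_le_of_holds_outside:
  assumes "holds_outside M \<delta> (\<lambda>\<omega>. \<bar>f \<omega>\<bar> \<le> (\<eta>::real))"
  shows "prob {\<omega>\<in>space M. \<bar>f \<omega>\<bar> > \<eta>} \<le> \<delta>"
proof -
  obtain B where B: "B \<in> events" "prob B \<le> \<delta>" "\<forall>\<omega>\<in>space M - B. \<bar>f \<omega>\<bar> \<le> \<eta>"
    using assms unfolding holds_outside_def by auto
  have "prob {\<omega>\<in>space M. \<bar>f \<omega>\<bar> > \<eta>} \<le> prob B"
    using B by (intro finite_measure_mono) (auto simp: not_le[symmetric])
  with B(2) show ?thesis by simp
qed

text \<open>An outer measure is attained by a measurable superset, which serves as the exceptional
  event.\<close>

lemma holds_outside_outer:
  assumes "outer_measure_of M {\<omega>\<in>space M. Z \<omega> > (c::ennreal)} \<le> ennreal \<delta>" "\<delta> \<ge> 0"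
  shows "holds_outside M \<delta> (\<lambda>\<omega>. Z \<omega> \<le> c)"
proof -
  obtain B where B: "B \<in> events" "{\<omega>\<in>space M. Z \<omega> > c} \<subseteq> B"
    "outer_measure_of M {\<omega>\<in>space M. Z \<omega> > c} = emeasure M B"
    using outer_measure_of_attain[of "{\<omega>\<in>space M. Z \<omega> > c}" M] by auto
  have "prob B \<le> \<delta>" using assms B(3) by (simp add: emeasure_eq_measure)
  then show ?thesis unfolding holds_outside_def using B by (intro bexI[of _ B]) auto
qed

lemma O_p_holds_outside:
  assumes "O_p M Z" "\<delta> > 0"
  obtains K where "K \<ge> 0" "\<forall>\<^sub>F k in sequentially. holds_outside M \<delta> (\<lambda>\<omega>. Z k \<omega> \<le> ennreal K)"
proof -
  obtain K where K: "\<forall>\<^sub>F k in sequentially. outer_measure_of M {\<omega>\<in>space M. Z k \<omega> > ennreal K} \<le> ennreal \<delta>"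
    using assms unfolding O_p_def by blast
  have "\<forall>\<^sub>F k in sequentially. holds_outside M \<delta> (\<lambda>\<omega>. Z k \<omega> \<le> ennreal (max K 0))"
    using K
  proof eventually_elim
    case (elim k)
    \<comment> \<open>The constant supplied by \<open>O_p\<close> may be negative. Since
      \<open>ennreal\<close> sends negative reals to 0, truncating it at 0 leaves the bound as it
      was.\<close>
    have "ennreal (max K 0) = ennreal K" by (simp add: max_def ennreal_neg)
    then show ?case using holds_outside_outer[OF elim] assms(2) by simp
  qed
  then show thesis by (intro that[of "max K 0"]) auto
qed

lemma o_p_holds_outside:
  assumes "o_p M a Z" "\<delta> > 0" "\<epsilon> > 0"
  shows "\<forall>\<^sub>F k in sequentially. holds_outside M \<delta> (\<lambda>\<omega>. Z k \<omega> \<le> ennreal (\<epsilon> * a k))"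
proof -
  have "(\<lambda>k. outer_measure_of M {\<omega>\<in>space M. Z k \<omega> > ennreal (\<epsilon> * a k)}) \<longlonglongrightarrow> 0"
    using assms unfolding o_p_def by blast
  then have "\<forall>\<^sub>F k in sequentially. outer_measure_of M {\<omega>\<in>space M. Z k \<omega> > ennreal (\<epsilon> * a k)} < ennreal \<delta>"
    using assms(2) by (intro order_tendstoD) auto
  then show ?thesis
    by eventually_elim (use assms(2) in \<open>auto intro!: holds_outside_outer\<close>)
qed

end

section \<open>The score in the population\<close>

locale propensity_design = prob_space P for P :: "'w measure" +
  fixes G :: "'w \<Rightarrow> nat" and X :: "'w \<Rightarrow> 'x::euclidean_space"
    and NG :: nat and p :: "nat \<Rightarrow> 'x \<Rightarrow> real" and C :: real
  assumes G[measurable]: "G \<in> P \<rightarrow>\<^sub>M count_space UNIV"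
    and X[measurable]: "X \<in> borel_measurable P"
    and groups: "\<And>\<omega>. \<omega> \<in> space P \<Longrightarrow> G \<omega> \<in> {1..NG + 1}"
    and propensity: "\<And>g. g \<in> {1..NG + 1} \<Longrightarrow> regression_fn P X (\<lambda>\<omega>. of_bool (G \<omega> = g)) (p g)"
    and propensity_pos: "\<And>g. g \<in> {1..NG + 1} \<Longrightarrow> AE \<omega> in P. p g (X \<omega>) > 0"
    and overlap_bound: "\<And>g. g \<in> {1..NG + 1} \<Longrightarrow> AE \<omega> in P. 1 / p g (X \<omega>) \<le> C"
    and C_nonneg: "C \<ge> 0"
begin

definition r :: "nat \<Rightarrow> 'x \<Rightarrow> real" where "r g x = p 1 x / p g x"

lemma p_measurable: "g \<in> {1..NG + 1} \<Longrightarrow> p g \<in> borel_measurable borel"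
  using propensity[of g] by (auto simp: regression_fn_def)

lemma r_measurable: "g \<in> {1..NG + 1} \<Longrightarrow> r g \<in> borel_measurable borel"
  unfolding r_def[abs_def] by (intro borel_measurable_divide p_measurable) auto

lemma propensity_integral:
  assumes g: "g \<in> {1..NG + 1}" and [measurable]: "f \<in> borel_measurable borel" and f: "integrable P (\<lambda>\<omega>. f (X \<omega>))"
  shows "integrable P (\<lambda>\<omega>. f (X \<omega>) * of_bool (G \<omega> = g))"
    and "integrable P (\<lambda>\<omega>. f (X \<omega>) * p g (X \<omega>))"
    and "(\<integral>\<omega>. f (X \<omega>) * of_bool (G \<omega> = g) \<partial>P) = (\<integral>\<omega>. f (X \<omega>) * p g (X \<omega>) \<partial>P)"
proof -
  show i: "integrable P (\<lambda>\<omega>. f (X \<omega>) * of_bool (G \<omega> = g))"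
    by (rule Bochner_Integration.integrable_bound[OF f]) auto
  show "integrable P (\<lambda>\<omega>. f (X \<omega>) * p g (X \<omega>))"
    "(\<integral>\<omega>. f (X \<omega>) * of_bool (G \<omega> = g) \<partial>P) = (\<integral>\<omega>. f (X \<omega>) * p g (X \<omega>) \<partial>P)"
    using regression_fn_integral[OF prob_space_axioms X propensity[OF g] _ i] by auto
qed

text \<open>An almost surely positive propensity cannot integrate to zero. On a group without mass,
  \<open>given\<close> would not be a probability measure.\<close>

lemma prob_group_pos:
  assumes g: "g \<in> {1..NG + 1}"
  shows "prob {\<omega>\<in>space P. G \<omega> = g} > 0"
proof (rule ccontr)
  assume "\<not> ?thesis"
  then have 0: "prob {\<omega>\<in>space P. G \<omega> = g} = 0" using measure_nonneg by (metis less_eq_real_def)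
  then have "AE \<omega> in P. G \<omega> \<noteq> g"
    by (subst (asm) prob_Collect_eq_0) measurable
  then have "AE \<omega> in P. of_bool (G \<omega> = g) = (0::real)" by eventually_elim simp
  then have z: "(\<integral>\<omega>. of_bool (G \<omega> = g) \<partial>P) = (0::real)" by (rule integral_eq_zero_AE)
  have one: "(\<lambda>_. 1::real) \<in> borel_measurable borel" "integrable P (\<lambda>\<omega>. 1::real)" by simp_all
  note pi = propensity_integral[OF g one, unfolded mult_1]
  have i: "integrable P (\<lambda>\<omega>. p g (X \<omega>))" by (rule pi(2))
  have 0: "(\<integral>\<omega>. p g (X \<omega>) \<partial>P) = 0" by (rule trans[OF pi(3)[symmetric] z])
  have "AE \<omega> in P. p g (X \<omega>) = 0"
  proof -
    have "AE \<omega> in P. 0 \<le> p g (X \<omega>)" using propensity_pos[OF g] by eventually_elim simp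
    from integral_nonneg_eq_0_iff_AE[OF i this] 0 show ?thesis by simp
  qed
  with propensity_pos[OF g] have "AE \<omega> in P. False" by eventually_elim simp
  then show False by simp
qed

lemma prob_space_group:
  "g \<in> {1..NG + 1} \<Longrightarrow> prob_space (given P (\<lambda>\<omega>. G \<omega> = g))"
  by (rule prob_space_given) (rule prob_group_pos)

lemma X_measurable_group[measurable]: "X \<in> borel_measurable (given P A)"
  unfolding measurable_cong_sets[OF sets_given refl] by (rule X)

text \<open>As a version of a conditional probability \<open>p 1\<close> is at most 1 almost surely,
  so the bound on the inverse of \<open>p g\<close> also bounds the ratio.\<close>

lemma propensity_ratio:
  assumes g: "g \<in> {1..NG + 1}"
  shows "AE \<omega> in P. \<bar>r g (X \<omega>)\<bar> \<le> C" and "AE \<omega> in P. r g (X \<omega>) * p g (X \<omega>) = p 1 (X \<omega>)"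
proof -
  let ?F = "vimage_algebra (space P) X borel"
  interpret F: finite_measure_subalgebra P ?F by (rule finite_measure_subalgebra_vimage[OF X])
  have 1: "1 \<in> {1..NG + 1}" by simp
  have "AE \<omega> in P. real_cond_exp P ?F (\<lambda>\<omega>. of_bool (G \<omega> = 1)) \<omega> \<le> 1"
    by (rule F.real_cond_exp_le_c) (use propensity[OF 1] in \<open>auto simp: regression_fn_def\<close>)
  then have p1: "AE \<omega> in P. p 1 (X \<omega>) \<le> 1"
    using propensity[OF 1] by (auto simp: regression_fn_def elim: eventually_elim2)
  from p1 propensity_pos[OF 1] propensity_pos[OF g] overlap_bound[OF g]
  show "AE \<omega> in P. \<bar>r g (X \<omega>)\<bar> \<le> C"
  proof eventually_elim
    case (elim \<omega>)
    have "r g (X \<omega>) \<le> 1 / p g (X \<omega>)" unfolding r_def using elim by (intro divide_right_mono) auto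
    moreover have "0 \<le> r g (X \<omega>)" unfolding r_def using elim by simp
    ultimately show ?case using elim by simp
  qed
  from propensity_pos[OF g] show "AE \<omega> in P. r g (X \<omega>) * p g (X \<omega>) = p 1 (X \<omega>)"
    by eventually_elim (simp add: r_def)
qed

text \<open>A unit belongs to exactly one group, so at most one control indicator is active.\<close>

lemma sum_group:
  assumes "\<omega> \<in> space P"
  shows "(\<Sum>g = 2..NG + 1. c g * of_bool (G \<omega> = g)) = (if G \<omega> = 1 then 0 else c (G \<omega>) :: real)"
  using groups[OF assms] by (auto simp: of_bool_def if_distrib[of "\<lambda>x. _ * x"] cong: if_cong)

end

text \<open>\<open>E\<close> will be the residual \<Delta>Y - m(X), but the analysis of the score
  rests on two properties only: centring given X in every control group and a bounded conditional
  second moment in every group. In group 1 no centring is asked for; the mean there will be the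
  treatment effect.\<close>

locale residual_design = propensity_design P G X NG p C
  for P :: "'w measure" and G and X :: "'w \<Rightarrow> 'x::euclidean_space" and NG p C +
  fixes E :: "'w \<Rightarrow> real"
  assumes E[measurable]: "E \<in> borel_measurable P"
    and residual_centred: "\<And>g. g \<in> {2..NG + 1} \<Longrightarrow> regression_fn (given P (\<lambda>\<omega>. G \<omega> = g)) X E (\<lambda>_. 0)"
    and residual_bound: "\<And>g. g \<in> {1..NG + 1} \<Longrightarrow> AE \<omega> in given P (\<lambda>\<omega>. G \<omega> = g).
      nn_cond_exp (given P (\<lambda>\<omega>. G \<omega> = g)) (vimage_algebra (space P) X borel) (\<lambda>\<omega>. ennreal ((E \<omega>)\<^sup>2)) \<omega> \<le> ennreal C"
begin

lemma integral_residual_eq_0: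
  assumes g: "g \<in> {2..NG + 1}" and f[measurable]: "f \<in> borel_measurable borel"
    and i: "integrable P (\<lambda>\<omega>. f (X \<omega>) * of_bool (G \<omega> = g) * E \<omega>)"
  shows "(\<integral>\<omega>. f (X \<omega>) * of_bool (G \<omega> = g) * E \<omega> \<partial>P) = 0"
proof -
  have g': "g \<in> {1..NG + 1}" using g by auto
  let ?Q = "given P (\<lambda>\<omega>. G \<omega> = g)"
  have eq: "(\<lambda>\<omega>. of_bool (G \<omega> = g) * (f (X \<omega>) * E \<omega>)) = (\<lambda>\<omega>. f (X \<omega>) * of_bool (G \<omega> = g) * E \<omega>)"
    by (simp add: fun_eq_iff)
  have "integrable ?Q (\<lambda>\<omega>. f (X \<omega>) * E \<omega>)"
    using i by (subst integrable_given_iff[OF _ _ prob_group_pos[OF g']]) (auto simp: eq)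
  from regression_fn_integral(2)[OF prob_space_group[OF g'] _ residual_centred[OF g] f this]
  have "(\<integral>\<omega>. f (X \<omega>) * E \<omega> \<partial>?Q) = 0" by simp
  then show ?thesis
    using prob_group_pos[OF g'] by (subst (asm) integral_given_eq) (auto simp: eq)
qed

text \<open>Under the law of group g the square of \<open>f (X)\<close> moves out of the conditional
  expectation, and the remaining conditional second moment is at most C. Working with nonnegative
  integrals presupposes no integrability; that of the terms of the score is deduced from this
  bound.\<close>

lemma nn_integral_residual_le:
  assumes g: "g \<in> {1..NG + 1}" and f[measurable]: "f \<in> borel_measurable borel"
  shows "(\<integral>\<^sup>+\<omega>. ennreal ((f (X \<omega>) * of_bool (G \<omega> = g) * E \<omega>)\<^sup>2) \<partial>P)
    \<le> ennreal C * (\<integral>\<^sup>+\<omega>. ennreal ((f (X \<omega>))\<^sup>2) \<partial>P)"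
proof -
  let ?Q = "given P (\<lambda>\<omega>. G \<omega> = g)"
  let ?F = "vimage_algebra (space P) X borel"
  interpret Q: prob_space ?Q by (rule prob_space_group[OF g])
  interpret F: finite_measure_subalgebra ?Q ?F
    using Q.finite_measure_subalgebra_vimage[of X borel] by simp
  have fX: "(\<lambda>\<omega>. ennreal ((f (X \<omega>))\<^sup>2)) \<in> borel_measurable ?F"
    by (rule measurable_vimage_algebra_comp) auto
  have "(\<integral>\<^sup>+\<omega>. ennreal ((f (X \<omega>))\<^sup>2) * ennreal ((E \<omega>)\<^sup>2) \<partial>?Q)
     = (\<integral>\<^sup>+\<omega>. ennreal ((f (X \<omega>))\<^sup>2) * nn_cond_exp ?Q ?F (\<lambda>\<omega>. ennreal ((E \<omega>)\<^sup>2)) \<omega> \<partial>?Q)"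
    by (rule F.nn_cond_exp_intg[symmetric]) (use fX in auto)
  also have "\<dots> \<le> (\<integral>\<^sup>+\<omega>. ennreal C * ennreal ((f (X \<omega>))\<^sup>2) \<partial>?Q)"
    using residual_bound[OF g] 
    by (intro nn_integral_mono_AE) (auto elim!: eventually_mono simp: mult.commute[of "ennreal C"] intro!: mult_left_mono)
  finally have Q: "(\<integral>\<^sup>+\<omega>. ennreal ((f (X \<omega>))\<^sup>2) * ennreal ((E \<omega>)\<^sup>2) \<partial>?Q) \<le> (\<integral>\<^sup>+\<omega>. ennreal C * ennreal ((f (X \<omega>))\<^sup>2) \<partial>?Q)" .
  have "(\<integral>\<^sup>+\<omega>. ennreal ((f (X \<omega>) * of_bool (G \<omega> = g) * E \<omega>)\<^sup>2) \<partial>P)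
     = (\<integral>\<^sup>+\<omega>. of_bool (G \<omega> = g) * (ennreal ((f (X \<omega>))\<^sup>2) * ennreal ((E \<omega>)\<^sup>2)) \<partial>P)"
    by (intro nn_integral_cong) (auto simp: power_mult_distrib ennreal_mult)
  also have "\<dots> \<le> (\<integral>\<^sup>+\<omega>. of_bool (G \<omega> = g) * (ennreal C * ennreal ((f (X \<omega>))\<^sup>2)) \<partial>P)"
    using Q prob_group_pos[OF g] by (subst (1 2) nn_integral_given) (auto intro!: mult_left_mono)
  also have "\<dots> \<le> (\<integral>\<^sup>+\<omega>. ennreal C * ennreal ((f (X \<omega>))\<^sup>2) \<partial>P)"
    by (intro nn_integral_mono) auto
  also have "\<dots> = ennreal C * (\<integral>\<^sup>+\<omega>. ennreal ((f (X \<omega>))\<^sup>2) \<partial>P)"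
    by (rule nn_integral_cmult) measurable
  finally show ?thesis .
qed

lemma square_integrable_of_nn_integral_le:
  assumes [measurable]: "f \<in> borel_measurable P" and le: "(\<integral>\<^sup>+\<omega>. ennreal ((f \<omega>)\<^sup>2) \<partial>P) \<le> ennreal c"
  shows "integrable P (\<lambda>\<omega>. (f \<omega>)\<^sup>2)" "integrable P f"
proof -
  show i: "integrable P (\<lambda>\<omega>. (f \<omega>)\<^sup>2)"
    using le by (intro integrableI_nonneg) (auto simp: le_less_trans[OF le])
  show "integrable P f" by (rule square_integrable_imp_integrable[OF assms(1) i])
qed

text \<open>The part of the score error that has mean zero for fixed nuisance functions. The factor
  of \<delta> carries the true ratio \<open>r\<close> instead of the estimate \<rho>, because
  \<open>r\<close> is bounded and satisfies \<open>r h x * p h x = p 1 x\<close> almost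
  surely.\<close>

definition centred_part ::
  "(nat \<Rightarrow> 'x \<Rightarrow> real) \<Rightarrow> (nat \<Rightarrow> 'x \<Rightarrow> real) \<Rightarrow> (nat \<Rightarrow> 'x \<Rightarrow> real) \<Rightarrow> ('x \<Rightarrow> real) \<Rightarrow> nat \<Rightarrow> 'x \<Rightarrow> real \<Rightarrow> real" where
  "centred_part w \<rho> v \<delta> g x e =
     - (\<Sum>h = 2..NG + 1. (w h x * \<rho> h x - v h x * r h x) * of_bool (g = h)) * e
     - (of_bool (g = 1) - (\<Sum>h = 2..NG + 1. w h x * r h x * of_bool (g = h))) * \<delta> x"

definition product_part ::
  "(nat \<Rightarrow> 'x \<Rightarrow> real) \<Rightarrow> (nat \<Rightarrow> 'x \<Rightarrow> real) \<Rightarrow> ('x \<Rightarrow> real) \<Rightarrow> nat \<Rightarrow> 'x \<Rightarrow> real" where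
  "product_part w \<rho> \<delta> g x = (\<Sum>h = 2..NG + 1. w h x * (\<rho> h x - r h x) * of_bool (g = h)) * \<delta> x"

text \<open>The factors 2 come from (a + b)^2 <= 2 a^2 + 2 b^2. The square of \<delta> has
  coefficient 1 in group 1 and 2 (K C)^2 in a control group. Each of the NG residual terms
  contributes 2 times C, from the conditional second moment, times the constant of
  \<open>coefficient_L2\<close>.\<close>

definition centred_bound :: "real \<Rightarrow> real \<Rightarrow> real" where
  "centred_bound K \<epsilon> = ((1 + 2 * K\<^sup>2 * C\<^sup>2) + real NG * (2 * C * (2 * K\<^sup>2 + 2 * C\<^sup>2))) * \<epsilon>\<^sup>2"

text \<open>The estimated residual is e - \<delta>, and among the controls w \<rho> \<delta> = w r
  \<delta> + w (\<rho> - r) \<delta>.\<close>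

lemma score_difference:
  "(of_bool (g = 1) - (\<Sum>h = 2..NG + 1. w h x * \<rho> h x * of_bool (g = h))) * (e - \<delta> x)
     - (of_bool (g = 1) - (\<Sum>h = 2..NG + 1. v h x * r h x * of_bool (g = h))) * e
   = centred_part w \<rho> v \<delta> g x e + product_part w \<rho> \<delta> g x"
  unfolding centred_part_def product_part_def
  by (simp add: algebra_simps sum.distrib sum_subtractf)

section \<open>Moments of the two error parts for fixed nuisance functions\<close>

context
  fixes w \<rho> v :: "nat \<Rightarrow> 'x \<Rightarrow> real" and \<delta> :: "'x \<Rightarrow> real" and K \<epsilon> \<kappa> :: real
  assumes w: "\<And>h. h \<in> {2..NG + 1} \<Longrightarrow> w h \<in> borel_measurable borel"
    and \<rho>: "\<And>h. h \<in> {2..NG + 1} \<Longrightarrow> \<rho> h \<in> borel_measurable borel"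
    and v: "\<And>h. h \<in> {2..NG + 1} \<Longrightarrow> v h \<in> borel_measurable borel"
    and \<delta>[measurable]: "\<delta> \<in> borel_measurable borel"
    and w_bound: "\<And>h. h \<in> {2..NG + 1} \<Longrightarrow> AE \<omega> in P. \<bar>w h (X \<omega>)\<bar> \<le> K"
    and w_sum: "AE \<omega> in P. (\<Sum>h = 2..NG + 1. w h (X \<omega>)) = 1"
    and \<delta>_L2: "(\<integral>\<^sup>+\<omega>. ennreal ((\<delta> (X \<omega>))\<^sup>2) \<partial>P) \<le> ennreal (\<epsilon>\<^sup>2)"
    and \<rho>_L2: "\<And>h. h \<in> {2..NG + 1} \<Longrightarrow> (\<integral>\<^sup>+\<omega>. ennreal ((\<rho> h (X \<omega>) - r h (X \<omega>))\<^sup>2) \<partial>P) \<le> ennreal (\<epsilon>\<^sup>2)"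
    and w_L2: "\<And>h. h \<in> {2..NG + 1} \<Longrightarrow> (\<integral>\<^sup>+\<omega>. ennreal ((w h (X \<omega>) - v h (X \<omega>))\<^sup>2) \<partial>P) \<le> ennreal (\<epsilon>\<^sup>2)"
    and product: "\<And>h. h \<in> {2..NG + 1} \<Longrightarrow>
      (\<integral>\<^sup>+\<omega>. ennreal ((\<rho> h (X \<omega>) - r h (X \<omega>))\<^sup>2) \<partial>P) * (\<integral>\<^sup>+\<omega>. ennreal ((\<delta> (X \<omega>))\<^sup>2) \<partial>P) \<le> ennreal (\<kappa>\<^sup>2)"
    and K: "K \<ge> 0" and \<kappa>: "\<kappa> \<ge> 0"
begin

lemma r': "h \<in> {2..NG + 1} \<Longrightarrow> r h \<in> borel_measurable borel"
  by (rule r_measurable) auto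

text \<open>Adding and subtracting w r gives w (\<rho> - r) + r (w - v). Each L2 error is multiplied
  by a bounded factor, K or C, while \<rho>, which has no bound, never occurs as a factor.\<close>

lemma coefficient_L2:
  assumes h: "h \<in> {2..NG + 1}"
  shows "(\<integral>\<^sup>+\<omega>. ennreal ((w h (X \<omega>) * \<rho> h (X \<omega>) - v h (X \<omega>) * r h (X \<omega>))\<^sup>2) \<partial>P)
    \<le> ennreal ((2 * K\<^sup>2 + 2 * C\<^sup>2) * \<epsilon>\<^sup>2)"
proof -
  note [measurable] = w[OF h] \<rho>[OF h] v[OF h] r'[OF h]
  have "AE \<omega> in P. \<bar>r h (X \<omega>)\<bar> \<le> C" using propensity_ratio(1)[of h] h by auto
  with w_bound[OF h] have "AE \<omega> in P. (w h (X \<omega>) * \<rho> h (X \<omega>) - v h (X \<omega>) * r h (X \<omega>))\<^sup>2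
      \<le> 2 * K\<^sup>2 * (\<rho> h (X \<omega>) - r h (X \<omega>))\<^sup>2 + 2 * C\<^sup>2 * (w h (X \<omega>) - v h (X \<omega>))\<^sup>2"
  proof eventually_elim
    case (elim \<omega>)
    let ?a = "w h (X \<omega>) * (\<rho> h (X \<omega>) - r h (X \<omega>))" and ?b = "r h (X \<omega>) * (w h (X \<omega>) - v h (X \<omega>))"
    have "(w h (X \<omega>) * \<rho> h (X \<omega>) - v h (X \<omega>) * r h (X \<omega>))\<^sup>2 = (?a + ?b)\<^sup>2"
      by (simp add: algebra_simps)
    also have "\<dots> \<le> 2 * ?a\<^sup>2 + 2 * ?b\<^sup>2"
      using sum_squares_bound[of ?a ?b] by (simp add: power2_sum)
    also have "?a\<^sup>2 \<le> K\<^sup>2 * (\<rho> h (X \<omega>) - r h (X \<omega>))\<^sup>2"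
      unfolding power_mult_distrib using elim K
      by (intro mult_right_mono) (auto simp flip: abs_le_square_iff)
    also have "?b\<^sup>2 \<le> C\<^sup>2 * (w h (X \<omega>) - v h (X \<omega>))\<^sup>2"
      unfolding power_mult_distrib using elim C_nonneg
      by (intro mult_right_mono) (auto simp flip: abs_le_square_iff)
    finally show ?case by simp
  qed
  then have "(\<integral>\<^sup>+\<omega>. ennreal ((w h (X \<omega>) * \<rho> h (X \<omega>) - v h (X \<omega>) * r h (X \<omega>))\<^sup>2) \<partial>P)
    \<le> (\<integral>\<^sup>+\<omega>. ennreal (2 * K\<^sup>2) * ennreal ((\<rho> h (X \<omega>) - r h (X \<omega>))\<^sup>2) + ennreal (2 * C\<^sup>2) * ennreal ((w h (X \<omega>) - v h (X \<omega>))\<^sup>2) \<partial>P)"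
    by (intro nn_integral_mono_AE) (auto elim!: eventually_mono simp flip: ennreal_mult ennreal_plus intro!: ennreal_leI)
  also have "\<dots> = ennreal (2 * K\<^sup>2) * (\<integral>\<^sup>+\<omega>. ennreal ((\<rho> h (X \<omega>) - r h (X \<omega>))\<^sup>2) \<partial>P)
      + ennreal (2 * C\<^sup>2) * (\<integral>\<^sup>+\<omega>. ennreal ((w h (X \<omega>) - v h (X \<omega>))\<^sup>2) \<partial>P)"
    by (subst nn_integral_add) (auto simp: nn_integral_cmult)
  also have "\<dots> \<le> ennreal (2 * K\<^sup>2) * ennreal (\<epsilon>\<^sup>2) + ennreal (2 * C\<^sup>2) * ennreal (\<epsilon>\<^sup>2)"
    by (intro add_mono mult_left_mono \<rho>_L2 w_L2 h) auto
  also have "\<dots> = ennreal ((2 * K\<^sup>2 + 2 * C\<^sup>2) * \<epsilon>\<^sup>2)"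
    by (simp add: algebra_simps flip: ennreal_mult ennreal_plus)
  finally show ?thesis .
qed

lemma centred_part_measurable:
  assumes [measurable]: "g \<in> N \<rightarrow>\<^sub>M count_space UNIV" "x \<in> borel_measurable N" "e \<in> borel_measurable N"
  shows "(\<lambda>s. centred_part w \<rho> v \<delta> (g s) (x s) (e s)) \<in> borel_measurable N"
proof -
  have *: "(\<lambda>s. w h (x s)) \<in> borel_measurable N" "(\<lambda>s. \<rho> h (x s)) \<in> borel_measurable N"
    "(\<lambda>s. v h (x s)) \<in> borel_measurable N" "(\<lambda>s. r h (x s)) \<in> borel_measurable N" if h: "h \<in> {2..NG + 1}" for h
    using measurable_compose[OF assms(2) w[OF h]] measurable_compose[OF assms(2) \<rho>[OF h]]
      measurable_compose[OF assms(2) v[OF h]] measurable_compose[OF assms(2) r'[OF h]] by auto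
  have **: "(\<lambda>s. of_bool (g s = h) :: real) \<in> borel_measurable N" for h by measurable
  show ?thesis unfolding centred_part_def
    by (intro borel_measurable_times borel_measurable_diff borel_measurable_uminus borel_measurable_sum * ** assms
        measurable_compose[OF assms(2) \<delta>])
qed

lemma centred_part_square:
  "(\<integral>\<^sup>+\<omega>. ennreal ((centred_part w \<rho> v \<delta> (G \<omega>) (X \<omega>) (E \<omega>))\<^sup>2) \<partial>P) \<le> ennreal (centred_bound K \<epsilon>)"
proof -
  let ?a = "\<lambda>h x. w h x * \<rho> h x - v h x * r h x"
  have wr: "AE \<omega> in P. \<forall>h\<in>{2..NG + 1}. \<bar>w h (X \<omega>) * r h (X \<omega>)\<bar> \<le> K * C"
  proof (rule AE_finite_allI)
    fix h assume h: "h \<in> {2..NG + 1}"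
    then have "AE \<omega> in P. \<bar>r h (X \<omega>)\<bar> \<le> C" using propensity_ratio(1)[of h] by auto
    with w_bound[OF h] show "AE \<omega> in P. \<bar>w h (X \<omega>) * r h (X \<omega>)\<bar> \<le> K * C"
      by eventually_elim (auto simp: abs_mult intro!: mult_mono K)
  qed simp
  have "AE \<omega> in P. (centred_part w \<rho> v \<delta> (G \<omega>) (X \<omega>) (E \<omega>))\<^sup>2
    \<le> (1 + 2 * K\<^sup>2 * C\<^sup>2) * (\<delta> (X \<omega>))\<^sup>2 + (\<Sum>h = 2..NG + 1. 2 * (?a h (X \<omega>) * of_bool (G \<omega> = h) * E \<omega>)\<^sup>2)"
    using wr AE_space
  proof eventually_elim
    case (elim \<omega>)
    note sg = sum_group[OF elim(2)]
    show ?case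
    proof (cases "G \<omega> = 1")
      case True
      have "(centred_part w \<rho> v \<delta> (G \<omega>) (X \<omega>) (E \<omega>))\<^sup>2 = (\<delta> (X \<omega>))\<^sup>2"
        unfolding centred_part_def sg using True by simp
      also have "\<dots> \<le> (1 + 2 * K\<^sup>2 * C\<^sup>2) * (\<delta> (X \<omega>))\<^sup>2" by (simp add: algebra_simps)
      also have "\<dots> \<le> (1 + 2 * K\<^sup>2 * C\<^sup>2) * (\<delta> (X \<omega>))\<^sup>2 + (\<Sum>h = 2..NG + 1. 2 * (?a h (X \<omega>) * of_bool (G \<omega> = h) * E \<omega>)\<^sup>2)"
        by (simp add: sum_nonneg)
      finally show ?thesis .
    next
      case False
      then have g: "G \<omega> \<in> {2..NG + 1}" using groups[OF elim(2)] by auto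
      let ?A = "?a (G \<omega>) (X \<omega>) * E \<omega>" and ?B = "w (G \<omega>) (X \<omega>) * r (G \<omega>) (X \<omega>) * \<delta> (X \<omega>)"
      have "(centred_part w \<rho> v \<delta> (G \<omega>) (X \<omega>) (E \<omega>))\<^sup>2 = (- ?A + ?B)\<^sup>2"
        unfolding centred_part_def sg using False by (simp only: of_bool_def if_False) (simp add: algebra_simps)
      also have "\<dots> \<le> 2 * ?A\<^sup>2 + 2 * ?B\<^sup>2"
        using sum_squares_bound[of "- ?A" ?B] unfolding power2_sum by simp
      also have "?B\<^sup>2 \<le> (K * C)\<^sup>2 * (\<delta> (X \<omega>))\<^sup>2"
        unfolding power_mult_distrib[of _ "\<delta> (X \<omega>)"] using elim(1) g K C_nonneg
        by (intro mult_right_mono) (auto simp flip: abs_le_square_iff simp: abs_mult)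
      \<comment> \<open>The single active term is rewritten as a sum over all control groups,
        because the integral is bounded group by group.\<close>
      also have "2 * ?A\<^sup>2 = (\<Sum>h = 2..NG + 1. (2 * (?a h (X \<omega>) * E \<omega>)\<^sup>2) * of_bool (G \<omega> = h))"
        unfolding sg using False by simp
      also have "\<dots> = (\<Sum>h = 2..NG + 1. 2 * (?a h (X \<omega>) * of_bool (G \<omega> = h) * E \<omega>)\<^sup>2)"
        by (intro sum.cong) (auto simp: power_mult_distrib)
      finally show ?thesis
        by (simp add: power_mult_distrib algebra_simps) (smt (verit) zero_le_power2)
    qed
  qed
  then have "(\<integral>\<^sup>+\<omega>. ennreal ((centred_part w \<rho> v \<delta> (G \<omega>) (X \<omega>) (E \<omega>))\<^sup>2) \<partial>P)
    \<le> (\<integral>\<^sup>+\<omega>. ennreal (1 + 2 * K\<^sup>2 * C\<^sup>2) * ennreal ((\<delta> (X \<omega>))\<^sup>2)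
        + (\<Sum>h = 2..NG + 1. 2 * ennreal ((?a h (X \<omega>) * of_bool (G \<omega> = h) * E \<omega>)\<^sup>2)) \<partial>P)"
  proof (intro nn_integral_mono_AE, elim eventually_mono)
    fix \<omega>
    let ?b = "\<lambda>h. (?a h (X \<omega>) * of_bool (G \<omega> = h) * E \<omega>)\<^sup>2"
    assume "(centred_part w \<rho> v \<delta> (G \<omega>) (X \<omega>) (E \<omega>))\<^sup>2
      \<le> (1 + 2 * K\<^sup>2 * C\<^sup>2) * (\<delta> (X \<omega>))\<^sup>2 + (\<Sum>h = 2..NG + 1. 2 * ?b h)"
    then have "ennreal ((centred_part w \<rho> v \<delta> (G \<omega>) (X \<omega>) (E \<omega>))\<^sup>2)
      \<le> ennreal ((1 + 2 * K\<^sup>2 * C\<^sup>2) * (\<delta> (X \<omega>))\<^sup>2 + (\<Sum>h = 2..NG + 1. 2 * ?b h))"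
      by (rule ennreal_leI)
    also have "\<dots> = ennreal ((1 + 2 * K\<^sup>2 * C\<^sup>2) * (\<delta> (X \<omega>))\<^sup>2) + ennreal (\<Sum>h = 2..NG + 1. 2 * ?b h)"
      by (intro ennreal_plus sum_nonneg) auto
    also have "ennreal (\<Sum>h = 2..NG + 1. 2 * ?b h) = (\<Sum>h = 2..NG + 1. 2 * ennreal (?b h))"
      by (subst sum_ennreal[symmetric]) (auto simp: ennreal_mult)
    also have "ennreal ((1 + 2 * K\<^sup>2 * C\<^sup>2) * (\<delta> (X \<omega>))\<^sup>2) = ennreal (1 + 2 * K\<^sup>2 * C\<^sup>2) * ennreal ((\<delta> (X \<omega>))\<^sup>2)"
      by (rule ennreal_mult) auto
    finally show "ennreal ((centred_part w \<rho> v \<delta> (G \<omega>) (X \<omega>) (E \<omega>))\<^sup>2)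
      \<le> ennreal (1 + 2 * K\<^sup>2 * C\<^sup>2) * ennreal ((\<delta> (X \<omega>))\<^sup>2) + (\<Sum>h = 2..NG + 1. 2 * ennreal (?b h))" .
  qed
  also have "\<dots> = ennreal (1 + 2 * K\<^sup>2 * C\<^sup>2) * (\<integral>\<^sup>+\<omega>. ennreal ((\<delta> (X \<omega>))\<^sup>2) \<partial>P)
        + (\<Sum>h = 2..NG + 1. 2 * (\<integral>\<^sup>+\<omega>. ennreal ((?a h (X \<omega>) * of_bool (G \<omega> = h) * E \<omega>)\<^sup>2) \<partial>P))"
  proof -
    have m: "(\<lambda>\<omega>. ennreal ((?a h (X \<omega>) * of_bool (G \<omega> = h) * E \<omega>)\<^sup>2)) \<in> borel_measurable P"
      if h: "h \<in> {2..NG + 1}" for h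
    proof -
      note [measurable] = w[OF h] \<rho>[OF h] v[OF h] r'[OF h]
      show ?thesis by measurable
    qed
    have "(\<integral>\<^sup>+\<omega>. (\<Sum>h = 2..NG + 1. 2 * ennreal ((?a h (X \<omega>) * of_bool (G \<omega> = h) * E \<omega>)\<^sup>2)) \<partial>P)
      = (\<Sum>h = 2..NG + 1. \<integral>\<^sup>+\<omega>. 2 * ennreal ((?a h (X \<omega>) * of_bool (G \<omega> = h) * E \<omega>)\<^sup>2) \<partial>P)"
      by (intro nn_integral_sum borel_measurable_times_ennreal borel_measurable_const m)
    also have "\<dots> = (\<Sum>h = 2..NG + 1. 2 * (\<integral>\<^sup>+\<omega>. ennreal ((?a h (X \<omega>) * of_bool (G \<omega> = h) * E \<omega>)\<^sup>2) \<partial>P))"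
      by (intro sum.cong refl nn_integral_cmult m)
    finally have i: "(\<integral>\<^sup>+\<omega>. (\<Sum>h = 2..NG + 1. 2 * ennreal ((?a h (X \<omega>) * of_bool (G \<omega> = h) * E \<omega>)\<^sup>2)) \<partial>P) = \<dots>" .
    have S: "(\<lambda>\<omega>. \<Sum>h = 2..NG + 1. 2 * ennreal ((?a h (X \<omega>) * of_bool (G \<omega> = h) * E \<omega>)\<^sup>2)) \<in> borel_measurable P"
      by (intro borel_measurable_sum borel_measurable_times_ennreal borel_measurable_const m)
    have d: "(\<lambda>\<omega>. ennreal ((\<delta> (X \<omega>))\<^sup>2)) \<in> borel_measurable P" by measurable
    show ?thesis unfolding i[symmetric]
      by (subst nn_integral_add[OF _ S])
        (simp_all only: nn_integral_cmult[OF d] borel_measurable_times_ennreal borel_measurable_const d)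
  qed
  also have "\<dots> \<le> ennreal (1 + 2 * K\<^sup>2 * C\<^sup>2) * ennreal (\<epsilon>\<^sup>2)
        + (\<Sum>h = 2..NG + 1. 2 * (ennreal C * ennreal ((2 * K\<^sup>2 + 2 * C\<^sup>2) * \<epsilon>\<^sup>2)))"
  proof (intro add_mono mult_left_mono \<delta>_L2 sum_mono)
    fix h assume h: "h \<in> {2..NG + 1}"
    note [measurable] = w[OF h] \<rho>[OF h] v[OF h] r'[OF h]
    have "(\<integral>\<^sup>+\<omega>. ennreal ((?a h (X \<omega>) * of_bool (G \<omega> = h) * E \<omega>)\<^sup>2) \<partial>P)
      \<le> ennreal C * (\<integral>\<^sup>+\<omega>. ennreal ((?a h (X \<omega>))\<^sup>2) \<partial>P)"
      by (rule nn_integral_residual_le) (use h in auto)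
    also have "\<dots> \<le> ennreal C * ennreal ((2 * K\<^sup>2 + 2 * C\<^sup>2) * \<epsilon>\<^sup>2)"
      by (intro mult_left_mono coefficient_L2 h) auto
    finally show "(\<integral>\<^sup>+\<omega>. ennreal ((?a h (X \<omega>) * of_bool (G \<omega> = h) * E \<omega>)\<^sup>2) \<partial>P) \<le> \<dots>" .
  qed auto
  also have "\<dots> = ennreal (centred_bound K \<epsilon>)"
  proof -
    let ?b = "(2 * K\<^sup>2 + 2 * C\<^sup>2) * \<epsilon>\<^sup>2"
    have "0 \<le> C * ?b" using C_nonneg by simp
    have "2 * (ennreal C * ennreal ?b) = ennreal (2 * (C * ?b))"
      using C_nonneg by (simp add: ennreal_mult)
    then have "(\<Sum>h = 2..NG + 1. 2 * (ennreal C * ennreal ?b)) = (\<Sum>h = 2..NG + 1. ennreal (2 * (C * ?b)))"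
      by (simp only:)
    also have "\<dots> = ennreal (\<Sum>h = 2..NG + 1. 2 * (C * ?b))"
      by (rule sum_ennreal) (use \<open>0 \<le> C * ?b\<close> in linarith)
    also have "\<dots> = ennreal (real NG * (2 * (C * ?b)))" by simp
    finally have s: "(\<Sum>h = 2..NG + 1. 2 * (ennreal C * ennreal ?b)) = ennreal (real NG * (2 * (C * ?b)))" .
    have "ennreal (1 + 2 * K\<^sup>2 * C\<^sup>2) * ennreal (\<epsilon>\<^sup>2) = ennreal ((1 + 2 * K\<^sup>2 * C\<^sup>2) * \<epsilon>\<^sup>2)"
      by (rule ennreal_mult[symmetric]) auto
    moreover have "ennreal ((1 + 2 * K\<^sup>2 * C\<^sup>2) * \<epsilon>\<^sup>2) + ennreal (real NG * (2 * (C * ?b)))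
      = ennreal ((1 + 2 * K\<^sup>2 * C\<^sup>2) * \<epsilon>\<^sup>2 + real NG * (2 * (C * ?b)))"
      using \<open>0 \<le> C * ?b\<close> by (intro ennreal_plus[symmetric]) auto
    moreover have "(1 + 2 * K\<^sup>2 * C\<^sup>2) * \<epsilon>\<^sup>2 + real NG * (2 * (C * ?b)) = centred_bound K \<epsilon>"
      unfolding centred_bound_def by (simp add: algebra_simps)
    ultimately show ?thesis unfolding s by simp
  qed
  finally show ?thesis .
qed

lemma product_part_measurable:
  assumes [measurable]: "g \<in> N \<rightarrow>\<^sub>M count_space UNIV" "x \<in> borel_measurable N"
  shows "(\<lambda>s. product_part w \<rho> \<delta> (g s) (x s)) \<in> borel_measurable N"
proof -
  have *: "(\<lambda>s. w h (x s)) \<in> borel_measurable N" "(\<lambda>s. \<rho> h (x s)) \<in> borel_measurable N"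
    "(\<lambda>s. r h (x s)) \<in> borel_measurable N" if h: "h \<in> {2..NG + 1}" for h
    using measurable_compose[OF assms(2) w[OF h]] measurable_compose[OF assms(2) \<rho>[OF h]]
      measurable_compose[OF assms(2) r'[OF h]] by auto
  have **: "(\<lambda>s. of_bool (g s = h) :: real) \<in> borel_measurable N" for h by measurable
  show ?thesis unfolding product_part_def
    by (intro borel_measurable_times borel_measurable_diff borel_measurable_sum * ** assms
        measurable_compose[OF assms(2) \<delta>])
qed

text \<open>Both error factors are controlled in L2 only, so Cauchy-Schwarz yields a first moment
  and nothing better; the product rate enters here as \<kappa>. The group indicators are bounded by
  1.\<close>

lemma product_part_abs:
  "(\<integral>\<^sup>+\<omega>. ennreal \<bar>product_part w \<rho> \<delta> (G \<omega>) (X \<omega>)\<bar> \<partial>P) \<le> ennreal (real NG * (K * \<kappa>))"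
proof -
  have "AE \<omega> in P. \<forall>h\<in>{2..NG + 1}. \<bar>w h (X \<omega>)\<bar> \<le> K"
    using w_bound by (intro AE_finite_allI) auto
  then have "AE \<omega> in P. \<bar>product_part w \<rho> \<delta> (G \<omega>) (X \<omega>)\<bar>
     \<le> (\<Sum>h = 2..NG + 1. K * (\<bar>\<rho> h (X \<omega>) - r h (X \<omega>)\<bar> * \<bar>\<delta> (X \<omega>)\<bar>))"
  proof eventually_elim
    case (elim \<omega>)
    have "\<bar>product_part w \<rho> \<delta> (G \<omega>) (X \<omega>)\<bar>
      \<le> (\<Sum>h = 2..NG + 1. \<bar>w h (X \<omega>) * (\<rho> h (X \<omega>) - r h (X \<omega>)) * of_bool (G \<omega> = h) * \<delta> (X \<omega>)\<bar>)"
      unfolding product_part_def sum_distrib_right by (rule sum_abs)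
    also have "\<dots> \<le> (\<Sum>h = 2..NG + 1. K * (\<bar>\<rho> h (X \<omega>) - r h (X \<omega>)\<bar> * \<bar>\<delta> (X \<omega>)\<bar>))"
    proof (rule sum_mono)
      fix h assume "h \<in> {2..NG + 1}"
      then have "\<bar>w h (X \<omega>)\<bar> * (\<bar>\<rho> h (X \<omega>) - r h (X \<omega>)\<bar> * \<bar>\<delta> (X \<omega>)\<bar>) \<le> K * (\<bar>\<rho> h (X \<omega>) - r h (X \<omega>)\<bar> * \<bar>\<delta> (X \<omega>)\<bar>)"
        using elim by (intro mult_right_mono) auto
      then show "\<bar>w h (X \<omega>) * (\<rho> h (X \<omega>) - r h (X \<omega>)) * of_bool (G \<omega> = h) * \<delta> (X \<omega>)\<bar> \<le> K * (\<bar>\<rho> h (X \<omega>) - r h (X \<omega>)\<bar> * \<bar>\<delta> (X \<omega>)\<bar>)"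
        using K by (auto simp: abs_mult mult.assoc)
    qed
    finally show ?case .
  qed
  then have "(\<integral>\<^sup>+\<omega>. ennreal \<bar>product_part w \<rho> \<delta> (G \<omega>) (X \<omega>)\<bar> \<partial>P)
    \<le> (\<integral>\<^sup>+\<omega>. (\<Sum>h = 2..NG + 1. ennreal K * (ennreal \<bar>\<rho> h (X \<omega>) - r h (X \<omega>)\<bar> * ennreal \<bar>\<delta> (X \<omega>)\<bar>)) \<partial>P)"
  proof (intro nn_integral_mono_AE, elim eventually_mono)
    fix \<omega>
    let ?b = "\<lambda>h. \<bar>\<rho> h (X \<omega>) - r h (X \<omega>)\<bar> * \<bar>\<delta> (X \<omega>)\<bar>"
    assume "\<bar>product_part w \<rho> \<delta> (G \<omega>) (X \<omega>)\<bar> \<le> (\<Sum>h = 2..NG + 1. K * ?b h)"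
    then have "ennreal \<bar>product_part w \<rho> \<delta> (G \<omega>) (X \<omega>)\<bar> \<le> ennreal (\<Sum>h = 2..NG + 1. K * ?b h)"
      by (rule ennreal_leI)
    also have "\<dots> = (\<Sum>h = 2..NG + 1. ennreal K * (ennreal \<bar>\<rho> h (X \<omega>) - r h (X \<omega>)\<bar> * ennreal \<bar>\<delta> (X \<omega>)\<bar>))"
      using K by (subst sum_ennreal[symmetric]) (auto simp: ennreal_mult)
    finally show "ennreal \<bar>product_part w \<rho> \<delta> (G \<omega>) (X \<omega>)\<bar> \<le> \<dots>" .
  qed
  also have "\<dots> = (\<Sum>h = 2..NG + 1. ennreal K * (\<integral>\<^sup>+\<omega>. ennreal \<bar>\<rho> h (X \<omega>) - r h (X \<omega>)\<bar> * ennreal \<bar>\<delta> (X \<omega>)\<bar> \<partial>P))"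
  proof -
    have m: "(\<lambda>\<omega>. ennreal \<bar>\<rho> h (X \<omega>) - r h (X \<omega>)\<bar> * ennreal \<bar>\<delta> (X \<omega>)\<bar>) \<in> borel_measurable P"
      if h: "h \<in> {2..NG + 1}" for h
    proof -
      note [measurable] = \<rho>[OF h] r'[OF h]
      show ?thesis by measurable
    qed
    have "(\<integral>\<^sup>+\<omega>. (\<Sum>h = 2..NG + 1. ennreal K * (ennreal \<bar>\<rho> h (X \<omega>) - r h (X \<omega>)\<bar> * ennreal \<bar>\<delta> (X \<omega>)\<bar>)) \<partial>P)
      = (\<Sum>h = 2..NG + 1. \<integral>\<^sup>+\<omega>. ennreal K * (ennreal \<bar>\<rho> h (X \<omega>) - r h (X \<omega>)\<bar> * ennreal \<bar>\<delta> (X \<omega>)\<bar>) \<partial>P)"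
      by (intro nn_integral_sum borel_measurable_times_ennreal borel_measurable_const m)
    also have "\<dots> = (\<Sum>h = 2..NG + 1. ennreal K * (\<integral>\<^sup>+\<omega>. ennreal \<bar>\<rho> h (X \<omega>) - r h (X \<omega>)\<bar> * ennreal \<bar>\<delta> (X \<omega>)\<bar> \<partial>P))"
      by (intro sum.cong refl nn_integral_cmult m)
    finally show ?thesis .
  qed
  also have "\<dots> \<le> (\<Sum>h = 2..NG + 1. ennreal K * ennreal \<kappa>)"
  proof (intro sum_mono mult_left_mono)
    fix h assume h: "h \<in> {2..NG + 1}"
    note [measurable] = w[OF h] \<rho>[OF h] v[OF h] r'[OF h]
    have "(\<integral>\<^sup>+\<omega>. ennreal \<bar>\<rho> h (X \<omega>) - r h (X \<omega>)\<bar> * ennreal \<bar>\<delta> (X \<omega>)\<bar> \<partial>P)\<^sup>2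
      \<le> (\<integral>\<^sup>+\<omega>. (ennreal \<bar>\<rho> h (X \<omega>) - r h (X \<omega>)\<bar>)\<^sup>2 \<partial>P) * (\<integral>\<^sup>+\<omega>. (ennreal \<bar>\<delta> (X \<omega>)\<bar>)\<^sup>2 \<partial>P)"
      by (rule Cauchy_Schwarz_nn_integral) measurable
    also have "\<dots> \<le> (ennreal \<kappa>)\<^sup>2"
      using product[OF h] \<kappa> by (simp add: ennreal_power)
    finally show "(\<integral>\<^sup>+\<omega>. ennreal \<bar>\<rho> h (X \<omega>) - r h (X \<omega>)\<bar> * ennreal \<bar>\<delta> (X \<omega>)\<bar> \<partial>P) \<le> ennreal \<kappa>"
      using \<kappa> by (rule ennreal_power2_le_imp_le)
  qed simp
  also have "\<dots> = ennreal (real NG * (K * \<kappa>))"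
    using K \<kappa> by (simp flip: ennreal_mult add: ennreal_of_nat_eq_real_of_nat)
  finally show ?thesis .
qed

text \<open>The residual terms vanish because their coefficients are functions of X and the residual
  is centred in each control group. In the rest, replacing the indicator of group h by
  \<open>p h\<close> turns \<open>r h\<close> into \<open>p 1\<close>, the same for every h. Weights
  that sum to one then recombine to \<delta> times \<open>p 1\<close>, which cancels the
  contribution of group 1.\<close>

lemma centred_part_mean: "(\<integral>\<omega>. centred_part w \<rho> v \<delta> (G \<omega>) (X \<omega>) (E \<omega>) \<partial>P) = 0"
proof -
  let ?a = "\<lambda>h x. w h x * \<rho> h x - v h x * r h x"
  have \<delta>i: "integrable P (\<lambda>\<omega>. \<delta> (X \<omega>))"
    by (rule square_integrable_of_nn_integral_le(2)[OF _ \<delta>_L2]) measurable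
  have A: "integrable P (\<lambda>\<omega>. ?a h (X \<omega>) * of_bool (G \<omega> = h) * E \<omega>)"
    "(\<integral>\<omega>. ?a h (X \<omega>) * of_bool (G \<omega> = h) * E \<omega> \<partial>P) = 0" if h: "h \<in> {2..NG + 1}" for h
  proof -
    note [measurable] = w[OF h] \<rho>[OF h] v[OF h] r'[OF h]
    have "(\<integral>\<^sup>+\<omega>. ennreal ((?a h (X \<omega>) * of_bool (G \<omega> = h) * E \<omega>)\<^sup>2) \<partial>P)
      \<le> ennreal C * (\<integral>\<^sup>+\<omega>. ennreal ((?a h (X \<omega>))\<^sup>2) \<partial>P)"
      by (rule nn_integral_residual_le) (use h in auto)
    also have "\<dots> \<le> ennreal C * ennreal ((2 * K\<^sup>2 + 2 * C\<^sup>2) * \<epsilon>\<^sup>2)"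
      by (intro mult_left_mono coefficient_L2 h) auto
    finally have "(\<integral>\<^sup>+\<omega>. ennreal ((?a h (X \<omega>) * of_bool (G \<omega> = h) * E \<omega>)\<^sup>2) \<partial>P)
      \<le> ennreal (C * ((2 * K\<^sup>2 + 2 * C\<^sup>2) * \<epsilon>\<^sup>2))" using C_nonneg by (simp add: ennreal_mult)
    then show i: "integrable P (\<lambda>\<omega>. ?a h (X \<omega>) * of_bool (G \<omega> = h) * E \<omega>)"
      by (intro square_integrable_of_nn_integral_le(2)) measurable
    show "(\<integral>\<omega>. ?a h (X \<omega>) * of_bool (G \<omega> = h) * E \<omega> \<partial>P) = 0"
      by (rule integral_residual_eq_0[OF h _ i]) measurable
  qed
  have p1_m[measurable]: "p 1 \<in> borel_measurable borel" by (rule p_measurable) simp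
  have B: "integrable P (\<lambda>\<omega>. (w h (X \<omega>) * r h (X \<omega>) * \<delta> (X \<omega>)) * of_bool (G \<omega> = h))"
    "integrable P (\<lambda>\<omega>. w h (X \<omega>) * p 1 (X \<omega>) * \<delta> (X \<omega>))"
    "(\<integral>\<omega>. (w h (X \<omega>) * r h (X \<omega>) * \<delta> (X \<omega>)) * of_bool (G \<omega> = h) \<partial>P)
      = (\<integral>\<omega>. w h (X \<omega>) * p 1 (X \<omega>) * \<delta> (X \<omega>) \<partial>P)" if h: "h \<in> {2..NG + 1}" for h
  proof -
    have h': "h \<in> {1..NG + 1}" using h by auto
    note [measurable] = w[OF h] r'[OF h] p_measurable[OF h']
    \<comment> \<open>Having the true ratio next to \<delta> pays off here: w and r are bounded, so
      K C \<delta> dominates.\<close>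
    have i: "integrable P (\<lambda>\<omega>. w h (X \<omega>) * r h (X \<omega>) * \<delta> (X \<omega>))"
    proof (rule Bochner_Integration.integrable_bound)
      show "integrable P (\<lambda>\<omega>. K * C * \<delta> (X \<omega>))" using \<delta>i by simp
      show "AE \<omega> in P. norm (w h (X \<omega>) * r h (X \<omega>) * \<delta> (X \<omega>)) \<le> norm (K * C * \<delta> (X \<omega>))"
        using w_bound[OF h] propensity_ratio(1)[OF h']
        by eventually_elim (use K C_nonneg in \<open>auto simp: abs_mult intro!: mult_mono\<close>)
    qed measurable
    have f: "(\<lambda>x. w h x * r h x * \<delta> x) \<in> borel_measurable borel" by measurable
    note pi = propensity_integral[OF h' f i]
    have m1: "(\<lambda>\<omega>. (w h (X \<omega>) * r h (X \<omega>) * \<delta> (X \<omega>)) * p h (X \<omega>)) \<in> borel_measurable P" by measurable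
    have m2: "(\<lambda>\<omega>. w h (X \<omega>) * p 1 (X \<omega>) * \<delta> (X \<omega>)) \<in> borel_measurable P" by measurable
    have ae: "AE \<omega> in P. (w h (X \<omega>) * r h (X \<omega>) * \<delta> (X \<omega>)) * p h (X \<omega>) = w h (X \<omega>) * p 1 (X \<omega>) * \<delta> (X \<omega>)"
      using propensity_ratio(2)[OF h'] by eventually_elim (simp add: algebra_simps)
    show "integrable P (\<lambda>\<omega>. (w h (X \<omega>) * r h (X \<omega>) * \<delta> (X \<omega>)) * of_bool (G \<omega> = h))"
      by (rule pi(1))
    show "integrable P (\<lambda>\<omega>. w h (X \<omega>) * p 1 (X \<omega>) * \<delta> (X \<omega>))"
      by (rule integrable_cong_AE[OF m1 m2 ae, THEN iffD1]) (rule pi(2))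
    show "(\<integral>\<omega>. (w h (X \<omega>) * r h (X \<omega>) * \<delta> (X \<omega>)) * of_bool (G \<omega> = h) \<partial>P)
      = (\<integral>\<omega>. w h (X \<omega>) * p 1 (X \<omega>) * \<delta> (X \<omega>) \<partial>P)"
      by (rule trans[OF pi(3) integral_cong_AE[OF m1 m2 ae]])
  qed
  have 1: "1 \<in> {1..NG + 1}" by simp
  note p1 = propensity_integral[OF 1 \<delta> \<delta>i]
  have eq: "centred_part w \<rho> v \<delta> (G \<omega>) (X \<omega>) (E \<omega>)
    = - (\<Sum>h = 2..NG + 1. ?a h (X \<omega>) * of_bool (G \<omega> = h) * E \<omega>)
      - \<delta> (X \<omega>) * of_bool (G \<omega> = 1)
      + (\<Sum>h = 2..NG + 1. (w h (X \<omega>) * r h (X \<omega>) * \<delta> (X \<omega>)) * of_bool (G \<omega> = h))" for \<omega>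
    unfolding centred_part_def by (simp add: sum_distrib_right sum_distrib_left algebra_simps)
  have "(\<integral>\<omega>. centred_part w \<rho> v \<delta> (G \<omega>) (X \<omega>) (E \<omega>) \<partial>P)
    = - (\<integral>\<omega>. \<delta> (X \<omega>) * p 1 (X \<omega>) \<partial>P) + (\<Sum>h = 2..NG + 1. (\<integral>\<omega>. w h (X \<omega>) * p 1 (X \<omega>) * \<delta> (X \<omega>) \<partial>P))"
  proof -
    define SA where "SA \<omega> = (\<Sum>h = 2..NG + 1. ?a h (X \<omega>) * of_bool (G \<omega> = h) * E \<omega>)" for \<omega>
    define SB where "SB \<omega> = (\<Sum>h = 2..NG + 1. (w h (X \<omega>) * r h (X \<omega>) * \<delta> (X \<omega>)) * of_bool (G \<omega> = h))" for \<omega>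
    have iA: "integrable P SA" and A0: "(\<integral>\<omega>. SA \<omega> \<partial>P) = 0"
      unfolding SA_def[abs_def]
      by (auto intro!: Bochner_Integration.integrable_sum A(1) simp only: Bochner_Integration.integral_sum[OF A(1)] A(2) sum.neutral_const cong: sum.cong)
    have iB: "integrable P SB"
      unfolding SB_def[abs_def] by (rule Bochner_Integration.integrable_sum) (rule B(1))
    have B0: "(\<integral>\<omega>. SB \<omega> \<partial>P) = (\<Sum>h = 2..NG + 1. (\<integral>\<omega>. w h (X \<omega>) * p 1 (X \<omega>) * \<delta> (X \<omega>) \<partial>P))"
      unfolding SB_def by (subst Bochner_Integration.integral_sum[OF B(1)]) (simp_all only: B(3) cong: sum.cong)
    have "(\<integral>\<omega>. - SA \<omega> - \<delta> (X \<omega>) * of_bool (G \<omega> = 1) + SB \<omega> \<partial>P)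
      = - (\<integral>\<omega>. SA \<omega> \<partial>P) - (\<integral>\<omega>. \<delta> (X \<omega>) * of_bool (G \<omega> = 1) \<partial>P) + (\<integral>\<omega>. SB \<omega> \<partial>P)"
      using iA iB p1(1) by simp
    then show ?thesis unfolding eq SA_def[symmetric] SB_def[symmetric] A0 B0 p1(3) by simp
  qed
  also have "(\<Sum>h = 2..NG + 1. (\<integral>\<omega>. w h (X \<omega>) * p 1 (X \<omega>) * \<delta> (X \<omega>) \<partial>P))
    = (\<integral>\<omega>. (\<Sum>h = 2..NG + 1. w h (X \<omega>) * p 1 (X \<omega>) * \<delta> (X \<omega>)) \<partial>P)"
    using B(2) by (subst Bochner_Integration.integral_sum) auto
  also have "\<dots> = (\<integral>\<omega>. \<delta> (X \<omega>) * p 1 (X \<omega>) \<partial>P)"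
  proof (rule integral_cong_AE)
    show "AE \<omega> in P. (\<Sum>h = 2..NG + 1. w h (X \<omega>) * p 1 (X \<omega>) * \<delta> (X \<omega>)) = \<delta> (X \<omega>) * p 1 (X \<omega>)"
      using w_sum
    proof eventually_elim
      case (elim \<omega>)
      have "(\<Sum>h = 2..NG + 1. w h (X \<omega>) * p 1 (X \<omega>) * \<delta> (X \<omega>))
        = (\<Sum>h = 2..NG + 1. w h (X \<omega>)) * (\<delta> (X \<omega>) * p 1 (X \<omega>))"
        unfolding sum_distrib_right by (intro sum.cong refl) (simp only: mult_ac)
      then show ?case unfolding elim by (simp only: mult_1)
    qed
    show "(\<lambda>\<omega>. \<Sum>h = 2..NG + 1. w h (X \<omega>) * p 1 (X \<omega>) * \<delta> (X \<omega>)) \<in> borel_measurable P"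
      by (intro borel_measurable_sum borel_measurable_integrable B(2))
    show "(\<lambda>\<omega>. \<delta> (X \<omega>) * p 1 (X \<omega>)) \<in> borel_measurable P"
      by (rule borel_measurable_integrable) (rule p1(2))
  qed
  finally show ?thesis by simp
qed

end

section \<open>Mean and variance of the influence function\<close>

text \<open>Each unit lies in one group, so the square of \<xi> has no cross terms: the controls
  give the last sum, and the treated part E - \<theta> splits by
  \<open>regression_fn_second_moment\<close>. Subtracting \<theta> in group 1 alone centres \<xi>,
  as the control terms have mean zero already.\<close>

lemma influence_moments:
  fixes v :: "nat \<Rightarrow> 'x \<Rightarrow> real"
  assumes v: "\<And>h. h \<in> {2..NG + 1} \<Longrightarrow> v h \<in> borel_measurable borel"
    and v_bound: "\<And>h. h \<in> {2..NG + 1} \<Longrightarrow> AE \<omega> in P. \<bar>v h (X \<omega>)\<bar> \<le> B"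
    and k: "regression_fn (given P (\<lambda>\<omega>. G \<omega> = 1)) X E k"
  defines "\<theta> \<equiv> (\<integral>\<omega>. E \<omega> \<partial>given P (\<lambda>\<omega>. G \<omega> = 1))"
  defines "\<xi> \<equiv> \<lambda>\<omega>. (of_bool (G \<omega> = 1) - (\<Sum>h = 2..NG + 1. v h (X \<omega>) * r h (X \<omega>) * of_bool (G \<omega> = h))) * E \<omega>
    - \<theta> * of_bool (G \<omega> = 1)"
  shows influence_square_integrable: "integrable P (\<lambda>\<omega>. (\<xi> \<omega>)\<^sup>2)"
    and influence_mean: "(\<integral>\<omega>. \<xi> \<omega> \<partial>P) = 0"
    and influence_second_moment: "(\<integral>\<omega>. (\<xi> \<omega>)\<^sup>2 \<partial>P) = (\<integral>\<omega>. of_bool (G \<omega> = 1) * (E \<omega> - k (X \<omega>))\<^sup>2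
      + of_bool (G \<omega> = 1) * (k (X \<omega>) - \<theta>)\<^sup>2
      + (\<Sum>h = 2..NG + 1. (v h (X \<omega>))\<^sup>2 * of_bool (G \<omega> = h) * ((p 1 (X \<omega>))\<^sup>2 / (p h (X \<omega>))\<^sup>2) * (E \<omega>)\<^sup>2) \<partial>P)"
proof -
  have one: "1 \<in> {1..NG + 1}" by simp
  note pos = prob_group_pos[OF one]
  let ?Q = "given P (\<lambda>\<omega>. G \<omega> = 1)"
  interpret Q: prob_space ?Q by (rule prob_space_group[OF one])
  have Gm: "Measurable.pred P (\<lambda>\<omega>. G \<omega> = 1)" by measurable
  have k_m[measurable]: "k \<in> borel_measurable borel" and EQ: "integrable ?Q E"
    using k by (auto simp: regression_fn_def)
  note givenI = integrable_given_iff[OF Gm _ pos] and givenE = integral_given_eq[OF Gm _ pos]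
  define t where "t h \<omega> = v h (X \<omega>) * r h (X \<omega>) * of_bool (G \<omega> = h) * E \<omega>" for h \<omega>
  have t_m: "t h \<in> borel_measurable P" if h: "h \<in> {2..NG + 1}" for h
  proof -
    have [measurable]: "r h \<in> borel_measurable borel" by (rule r_measurable) (use h in auto)
    note [measurable] = v[OF h]
    show ?thesis unfolding t_def[abs_def] by measurable
  qed
  have t2: "integrable P (\<lambda>\<omega>. (t h \<omega>)\<^sup>2)" and t1: "integrable P (t h)" and t0: "(\<integral>\<omega>. t h \<omega> \<partial>P) = 0"
    if h: "h \<in> {2..NG + 1}" for h
  proof -
    have h': "h \<in> {1..NG + 1}" using h by auto
    note [measurable] = v[OF h] r_measurable[OF h']
    have f: "(\<lambda>x. v h x * r h x) \<in> borel_measurable borel" by measurable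
    have "AE \<omega> in P. (v h (X \<omega>) * r h (X \<omega>))\<^sup>2 \<le> (B * C)\<^sup>2"
      using v_bound[OF h] propensity_ratio(1)[OF h']
    proof eventually_elim
      case (elim \<omega>)
      then have "\<bar>v h (X \<omega>)\<bar> * \<bar>r h (X \<omega>)\<bar> \<le> B * C" by (intro mult_mono) auto
      then have "\<bar>v h (X \<omega>) * r h (X \<omega>)\<bar> \<le> \<bar>B * C\<bar>" unfolding abs_mult[symmetric] by linarith
      then show ?case by (rule abs_le_square_iff[THEN iffD1])
    qed
    then have "(\<integral>\<^sup>+\<omega>. ennreal ((v h (X \<omega>) * r h (X \<omega>))\<^sup>2) \<partial>P) \<le> (\<integral>\<^sup>+\<omega>. ennreal ((B * C)\<^sup>2) \<partial>P)"
      by (intro nn_integral_mono_AE) (auto elim!: eventually_mono intro: ennreal_leI)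
    also have "\<dots> = ennreal ((B * C)\<^sup>2)" by (simp add: emeasure_space_1)
    finally have "ennreal C * (\<integral>\<^sup>+\<omega>. ennreal ((v h (X \<omega>) * r h (X \<omega>))\<^sup>2) \<partial>P) \<le> ennreal C * ennreal ((B * C)\<^sup>2)"
      by (rule mult_left_mono) simp
    with nn_integral_residual_le[OF h' f]
    have "(\<integral>\<^sup>+\<omega>. ennreal ((t h \<omega>)\<^sup>2) \<partial>P) \<le> ennreal C * ennreal ((B * C)\<^sup>2)"
      unfolding t_def by (rule order_trans)
    then have le: "(\<integral>\<^sup>+\<omega>. ennreal ((t h \<omega>)\<^sup>2) \<partial>P) \<le> ennreal (C * (B * C)\<^sup>2)"
      using C_nonneg by (simp only: ennreal_mult zero_le_power2)
    show "integrable P (\<lambda>\<omega>. (t h \<omega>)\<^sup>2)" and i: "integrable P (t h)"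
      using square_integrable_of_nn_integral_le[OF t_m[OF h] le] by auto
    show "(\<integral>\<omega>. t h \<omega> \<partial>P) = 0"
      using integral_residual_eq_0[OF h f] i unfolding t_def by simp
  qed
  \<comment> \<open>The factor 1 is the constant function of X, matching the shape of
    \<open>nn_integral_residual_le\<close>.\<close>
  have "integrable P (\<lambda>\<omega>. (1 * of_bool (G \<omega> = 1) * E \<omega>)\<^sup>2)"
  proof (rule square_integrable_of_nn_integral_le(1))
    show "(\<integral>\<^sup>+\<omega>. ennreal ((1 * of_bool (G \<omega> = 1) * E \<omega>)\<^sup>2) \<partial>P) \<le> ennreal C"
      using nn_integral_residual_le[OF one, of "\<lambda>_. 1"] by (simp add: emeasure_space_1)
  qed measurable
  moreover have "(\<lambda>\<omega>. (1 * of_bool (G \<omega> = 1) * E \<omega>)\<^sup>2) = (\<lambda>\<omega>. of_bool (G \<omega> = 1) * (E \<omega>)\<^sup>2)"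
    by (auto simp: fun_eq_iff power_mult_distrib)
  ultimately have "integrable P (\<lambda>\<omega>. of_bool (G \<omega> = 1) * (E \<omega>)\<^sup>2)" by simp
  then have E2: "integrable ?Q (\<lambda>\<omega>. (E \<omega>)\<^sup>2)"
    by (subst givenI) auto
  note var = regression_fn_second_moment[OF Q.prob_space_axioms X_measurable_group k E2]
  define s where "s \<omega> = of_bool (G \<omega> = 1) * (E \<omega> - \<theta>)" for \<omega>
  have s_power: "(s \<omega>)\<^sup>2 = of_bool (G \<omega> = 1) * (E \<omega> - \<theta>)\<^sup>2" for \<omega>
    by (auto simp: s_def)
  have "integrable ?Q (\<lambda>\<omega>. (E \<omega> - \<theta>)\<^sup>2)"
    using E2 EQ by (simp add: power2_diff)
  then have s2: "integrable P (\<lambda>\<omega>. (s \<omega>)\<^sup>2)"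
    by (subst (asm) givenI) (auto simp: s_power)
  have "integrable ?Q (\<lambda>\<omega>. E \<omega> - \<theta>)" using EQ by simp
  then have s1: "integrable P s"
    by (subst (asm) givenI) (auto simp: s_def[abs_def])
  have "(\<integral>\<omega>. E \<omega> - \<theta> \<partial>?Q) = 0" using EQ by (simp add: \<theta>_def Q.prob_space[unfolded space_given])
  then have s0: "(\<integral>\<omega>. s \<omega> \<partial>P) = 0"
    using pos by (subst (asm) givenE) (auto simp: s_def[abs_def])
  have a: "integrable P (\<lambda>\<omega>. of_bool (G \<omega> = 1) * (E \<omega> - k (X \<omega>))\<^sup>2)"
    using var(1) by (subst (asm) givenI) auto
  have b: "integrable P (\<lambda>\<omega>. of_bool (G \<omega> = 1) * (k (X \<omega>) - \<theta>)\<^sup>2)"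
    using var(2)[of \<theta>] by (subst (asm) givenI) auto
  have "(\<integral>\<omega>. of_bool (G \<omega> = 1) * (E \<omega> - \<theta>)\<^sup>2 \<partial>P) = (\<integral>\<omega>. of_bool (G \<omega> = 1) * (E \<omega> - k (X \<omega>))\<^sup>2 \<partial>P)
      + (\<integral>\<omega>. of_bool (G \<omega> = 1) * (k (X \<omega>) - \<theta>)\<^sup>2 \<partial>P)"
    using var(3)[of \<theta>] pos by (subst (asm) (1 2 3) givenE) (auto simp: field_simps)
  then have s_sq: "(\<integral>\<omega>. (s \<omega>)\<^sup>2 \<partial>P) = (\<integral>\<omega>. of_bool (G \<omega> = 1) * (E \<omega> - k (X \<omega>))\<^sup>2 \<partial>P)
      + (\<integral>\<omega>. of_bool (G \<omega> = 1) * (k (X \<omega>) - \<theta>)\<^sup>2 \<partial>P)"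
    by (simp only: s_power)
  have \<xi>: "\<xi> \<omega> = s \<omega> - (\<Sum>h = 2..NG + 1. t h \<omega>)" for \<omega>
    unfolding \<xi>_def s_def t_def sum_distrib_right[symmetric] by (simp only: left_diff_distrib right_diff_distrib mult.commute)
  have \<xi>2: "(\<xi> \<omega>)\<^sup>2 = (s \<omega>)\<^sup>2 + (\<Sum>h = 2..NG + 1. (t h \<omega>)\<^sup>2)" if w: "\<omega> \<in> space P" for \<omega>
  proof -
    have c: "(\<Sum>h = 2..NG + 1. t h \<omega>) = (if G \<omega> = 1 then 0 else v (G \<omega>) (X \<omega>) * r (G \<omega>) (X \<omega>) * E \<omega>)"
      using sum_group[OF w, of "\<lambda>h. v h (X \<omega>) * r h (X \<omega>) * E \<omega>"] unfolding t_def
      by (simp only: mult_ac)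
    have "(\<Sum>h = 2..NG + 1. (t h \<omega>)\<^sup>2) = (\<Sum>h = 2..NG + 1. (v h (X \<omega>) * r h (X \<omega>) * E \<omega>)\<^sup>2 * of_bool (G \<omega> = h))"
      unfolding t_def by (intro sum.cong refl) (simp add: power_mult_distrib)
    then have d: "(\<Sum>h = 2..NG + 1. (t h \<omega>)\<^sup>2) = (if G \<omega> = 1 then 0 else (v (G \<omega>) (X \<omega>) * r (G \<omega>) (X \<omega>) * E \<omega>)\<^sup>2)"
      using sum_group[OF w, of "\<lambda>h. (v h (X \<omega>) * r h (X \<omega>) * E \<omega>)\<^sup>2"] by simp
    show ?thesis unfolding \<xi> c d s_def by simp
  qed
  have T2: "integrable P (\<lambda>\<omega>. \<Sum>h = 2..NG + 1. (t h \<omega>)\<^sup>2)"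
    by (intro Bochner_Integration.integrable_sum t2)
  have "integrable P (\<lambda>\<omega>. (s \<omega>)\<^sup>2 + (\<Sum>h = 2..NG + 1. (t h \<omega>)\<^sup>2))"
    using s2 T2 by (rule Bochner_Integration.integrable_add)
  then show "integrable P (\<lambda>\<omega>. (\<xi> \<omega>)\<^sup>2)"
    by (subst Bochner_Integration.integrable_cong[OF refl \<xi>2])
  have "(\<integral>\<omega>. \<xi> \<omega> \<partial>P) = (\<integral>\<omega>. s \<omega> \<partial>P) - (\<integral>\<omega>. (\<Sum>h = 2..NG + 1. t h \<omega>) \<partial>P)"
    unfolding \<xi> using s1 t1 by (intro Bochner_Integration.integral_diff Bochner_Integration.integrable_sum)
  also have "(\<integral>\<omega>. (\<Sum>h = 2..NG + 1. t h \<omega>) \<partial>P) = (\<Sum>h = 2..NG + 1. 0)"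
    by (subst Bochner_Integration.integral_sum[OF t1]) (simp_all only: t0 cong: sum.cong)
  finally show "(\<integral>\<omega>. \<xi> \<omega> \<partial>P) = 0" using s0 by simp
  have t_eq: "(t h \<omega>)\<^sup>2 = (v h (X \<omega>))\<^sup>2 * of_bool (G \<omega> = h) * ((p 1 (X \<omega>))\<^sup>2 / (p h (X \<omega>))\<^sup>2) * (E \<omega>)\<^sup>2" for h \<omega>
    unfolding t_def r_def by (simp add: power_mult_distrib power_divide)
  have "(\<integral>\<omega>. (\<xi> \<omega>)\<^sup>2 \<partial>P) = (\<integral>\<omega>. (s \<omega>)\<^sup>2 + (\<Sum>h = 2..NG + 1. (t h \<omega>)\<^sup>2) \<partial>P)"
    by (rule Bochner_Integration.integral_cong[OF refl \<xi>2])
  also have "\<dots> = (\<integral>\<omega>. (s \<omega>)\<^sup>2 \<partial>P) + (\<integral>\<omega>. (\<Sum>h = 2..NG + 1. (t h \<omega>)\<^sup>2) \<partial>P)"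
    using s2 T2 by (rule Bochner_Integration.integral_add)
  also have "\<dots> = (\<integral>\<omega>. of_bool (G \<omega> = 1) * (E \<omega> - k (X \<omega>))\<^sup>2 + of_bool (G \<omega> = 1) * (k (X \<omega>) - \<theta>)\<^sup>2
      + (\<Sum>h = 2..NG + 1. (t h \<omega>)\<^sup>2) \<partial>P)"
    unfolding s_sq using a b T2 by (simp only: Bochner_Integration.integral_add Bochner_Integration.integrable_add)
  finally show "(\<integral>\<omega>. (\<xi> \<omega>)\<^sup>2 \<partial>P) = (\<integral>\<omega>. of_bool (G \<omega> = 1) * (E \<omega> - k (X \<omega>))\<^sup>2
      + of_bool (G \<omega> = 1) * (k (X \<omega>) - \<theta>)\<^sup>2
      + (\<Sum>h = 2..NG + 1. (v h (X \<omega>))\<^sup>2 * of_bool (G \<omega> = h) * ((p 1 (X \<omega>))\<^sup>2 / (p h (X \<omega>))\<^sup>2) * (E \<omega>)\<^sup>2) \<partial>P)"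
    unfolding t_eq .
qed

end

section \<open>Identification under parallel trends\<close>

locale did_design = propensity_design P G X NG p C
  for P :: "'w measure" and G and X :: "'w \<Rightarrow> 'x::euclidean_space" and NG p C +
  fixes Y1 Y0 :: "nat \<Rightarrow> 'w \<Rightarrow> real" and T :: nat and \<mu>0 :: "nat \<Rightarrow> 'x \<Rightarrow> real" and mD m1D :: "'x \<Rightarrow> real"
  assumes T: "T \<ge> 2" and NG: "NG \<ge> 1"
    and Y1: "\<And>t. t \<in> {1..T} \<Longrightarrow> Y1 t \<in> borel_measurable P"
    and Y0: "\<And>t. t \<in> {1..T} \<Longrightarrow> Y0 t \<in> borel_measurable P"
    and no_anticipation: "\<And>t. t \<in> {1..T - 1} \<Longrightarrow> AE \<omega> in P. Y1 t \<omega> = Y0 t \<omega>"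
    and mD: "regression_fn (given P (\<lambda>\<omega>. G \<omega> \<noteq> 1)) X (Delta_Y T Y1 Y0 G) mD"
    and m1D: "regression_fn (given P (\<lambda>\<omega>. G \<omega> = 1)) X (Delta_Y T Y1 Y0 G) m1D"
    and \<mu>0: "\<And>g. g \<in> {1..NG + 1} \<Longrightarrow>
      regression_fn (given P (\<lambda>\<omega>. G \<omega> = g)) X (\<lambda>\<omega>. Y0 T \<omega> - Y0 (T - 1) \<omega>) (\<mu>0 g)"
    and parallel_trends: "\<And>g. g \<in> {2..NG + 1} \<Longrightarrow> AE \<omega> in P. \<mu>0 1 (X \<omega>) = \<mu>0 g (X \<omega>)"
begin

abbreviation D :: "'w \<Rightarrow> real" where "D \<equiv> Delta_Y T Y1 Y0 G"

abbreviation Q :: "nat \<Rightarrow> 'w measure" where "Q g \<equiv> given P (\<lambda>\<omega>. G \<omega> = g)"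

lemma Y_measurable[measurable]:
  "Y1 T \<in> borel_measurable P" "Y0 T \<in> borel_measurable P"
  "Y1 (T - 1) \<in> borel_measurable P" "Y0 (T - 1) \<in> borel_measurable P"
  using T by (auto intro!: Y1 Y0)

lemma D_measurable[measurable]: "D \<in> borel_measurable P"
  unfolding Delta_Y_def[abs_def] observed_outcome_def by measurable

lemma mD_measurable[measurable]: "mD \<in> borel_measurable borel"
  and m1D_measurable[measurable]: "m1D \<in> borel_measurable borel"
  and \<mu>0_measurable[measurable]: "\<mu>0 1 \<in> borel_measurable borel"
  using mD m1D \<mu>0[of 1] by (auto simp: regression_fn_def)

text \<open>Outcomes observed in a control group are untreated ones, so \<open>D\<close> is the
  untreated trend there, and parallel trends replace \<open>\<mu>0 g\<close> by
  \<open>\<mu>0 1\<close>.\<close>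

lemma regression_control:
  assumes g: "g \<in> {2..NG + 1}"
  shows "regression_fn (Q g) X D (\<mu>0 1)"
proof (rule regression_fn_AE_cong)
  have g': "g \<in> {1..NG + 1}" using g by auto
  have A: "Measurable.pred P (\<lambda>\<omega>. G \<omega> = g)" by measurable
  note ae = AE_given_iff[OF A prob_group_pos[OF g']]
  show "regression_fn (Q g) X D (\<mu>0 g)"
  proof (rule regression_fn_cong_AE[OF \<mu>0[OF g']])
    show "AE \<omega> in Q g. Y0 T \<omega> - Y0 (T - 1) \<omega> = D \<omega>"
      unfolding ae using g by (auto simp: Delta_Y_def observed_outcome_def)
  qed (use prob_space_group[OF g'] in auto)
  have "AE \<omega> in P. G \<omega> = g \<longrightarrow> \<mu>0 g (X \<omega>) = \<mu>0 1 (X \<omega>)"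
    using parallel_trends[OF g] by eventually_elim simp
  then show "AE \<omega> in Q g. \<mu>0 g (X \<omega>) = \<mu>0 1 (X \<omega>)" unfolding ae .
qed measurable

lemma prob_controls_pos: "prob {\<omega>\<in>space P. G \<omega> \<noteq> 1} > 0"
proof -
  have "0 < prob {\<omega>\<in>space P. G \<omega> = 2}" using NG by (intro prob_group_pos) auto
  also have "\<dots> \<le> prob {\<omega>\<in>space P. G \<omega> \<noteq> 1}" by (intro finite_measure_mono) auto
  finally show ?thesis .
qed

lemma of_bool_controls:
  assumes "\<omega> \<in> space P"
  shows "of_bool (G \<omega> \<noteq> 1) * c = (\<Sum>g = 2..NG + 1. of_bool (G \<omega> = g) * c :: real)"
  using sum_group[OF assms, of "\<lambda>_. c"] by (simp add: mult.commute)

text \<open>Pooling the control groups, whose trends all coincide with that of the treated group,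
  identifies the regression function of the pooled group; overlap extends this from the
  controls to all of the covariate distribution.\<close>

lemma mD_eq_trend: "AE \<omega> in P. mD (X \<omega>) = \<mu>0 1 (X \<omega>)"
proof -
  let ?Q = "given P (\<lambda>\<omega>. G \<omega> \<noteq> 1)"
  have A: "Measurable.pred P (\<lambda>\<omega>. G \<omega> \<noteq> 1)" by measurable
  have Ag: "Measurable.pred P (\<lambda>\<omega>. G \<omega> = g)" for g by measurable
  interpret Q: prob_space ?Q by (rule prob_space_given[OF prob_controls_pos])
  have D_int: "integrable ?Q D" using mD by (simp add: regression_fn_def)
  note int_g = integrable_given_iff[OF Ag _ prob_group_pos]
  note eq_g = integral_given_eq[OF Ag _ prob_group_pos]
  have \<mu>_g: "integrable P (\<lambda>\<omega>. of_bool (G \<omega> = g) * \<mu>0 1 (X \<omega>))" 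
    and D_g: "integrable P (\<lambda>\<omega>. of_bool (G \<omega> = g) * D \<omega>)"
    and B_g: "B \<in> sets borel \<Longrightarrow> (\<integral>\<omega>. of_bool (G \<omega> = g) * (indicator B (X \<omega>) * D \<omega>) \<partial>P)
      = (\<integral>\<omega>. of_bool (G \<omega> = g) * (indicator B (X \<omega>) * \<mu>0 1 (X \<omega>)) \<partial>P)"
    if g: "g \<in> {2..NG + 1}" for g B
  proof -
    have g': "g \<in> {1..NG + 1}" using g by auto
    note reg = regression_control[OF g]
    have i: "integrable (Q g) D" using reg by (simp add: regression_fn_def)
    then show "integrable P (\<lambda>\<omega>. of_bool (G \<omega> = g) * D \<omega>)"
      by (subst (asm) int_g[OF _ g']) auto
    have "integrable (Q g) (\<lambda>\<omega>. \<mu>0 1 (X \<omega>))"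
      by (rule regression_fn_integrable(1)[OF prob_space_group[OF g'] _ reg]) measurable
    then show "integrable P (\<lambda>\<omega>. of_bool (G \<omega> = g) * \<mu>0 1 (X \<omega>))"
      by (subst (asm) int_g[OF _ g']) auto
    assume B[measurable]: "B \<in> sets borel"
    have iB: "integrable (Q g) (\<lambda>\<omega>. indicator B (X \<omega>) * D \<omega>)"
      by (rule Bochner_Integration.integrable_bound[OF i]) (auto simp: indicator_def)
    have "(\<integral>\<omega>. indicator B (X \<omega>) * \<mu>0 1 (X \<omega>) \<partial>Q g) = (\<integral>\<omega>. indicator B (X \<omega>) * D \<omega> \<partial>Q g)"
      by (rule regression_fn_integral(2)[OF prob_space_group[OF g'] _ reg _ iB]) measurable
    then show "(\<integral>\<omega>. of_bool (G \<omega> = g) * (indicator B (X \<omega>) * D \<omega>) \<partial>P)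
      = (\<integral>\<omega>. of_bool (G \<omega> = g) * (indicator B (X \<omega>) * \<mu>0 1 (X \<omega>)) \<partial>P)"
      using prob_group_pos[OF g'] by (subst (asm) (1 2) eq_g[OF _ g']) auto
  qed
  have "integrable P (\<lambda>\<omega>. \<Sum>g = 2..NG + 1. of_bool (G \<omega> = g) * \<mu>0 1 (X \<omega>))"
    by (intro Bochner_Integration.integrable_sum \<mu>_g)
  then have "integrable P (\<lambda>\<omega>. of_bool (G \<omega> \<noteq> 1) * \<mu>0 1 (X \<omega>))"
    by (subst Bochner_Integration.integrable_cong[OF refl of_bool_controls])
  then have \<mu>_int: "integrable ?Q (\<lambda>\<omega>. \<mu>0 1 (X \<omega>))"
    by (subst integrable_given_iff[OF A _ prob_controls_pos]) auto
  have "regression_fn ?Q X D (\<mu>0 1)"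
  proof (rule regression_fnI[OF Q.prob_space_axioms X_measurable_group D_int \<mu>0_measurable \<mu>_int])
    fix B :: "'x set" assume B[measurable]: "B \<in> sets borel"
    have i: "integrable P (\<lambda>\<omega>. of_bool (G \<omega> = g) * (indicator B (X \<omega>) * Z \<omega>))"
      if Z: "integrable P (\<lambda>\<omega>. of_bool (G \<omega> = g) * Z \<omega>)" "Z \<in> borel_measurable P" for g and Z :: "'w \<Rightarrow> real"
    proof (rule Bochner_Integration.integrable_bound[OF Z(1)])
      note [measurable] = Z(2)
      show "(\<lambda>\<omega>. of_bool (G \<omega> = g) * (indicator B (X \<omega>) * Z \<omega>)) \<in> borel_measurable P" by measurable
    qed (auto simp: indicator_def)
    note i_D = i[OF D_g D_measurable] and i_\<mu> = i[OF \<mu>_g measurable_compose[OF X \<mu>0_measurable]]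
    have "(\<integral>\<omega>. of_bool (G \<omega> \<noteq> 1) * (indicator B (X \<omega>) * D \<omega>) \<partial>P)
      = (\<integral>\<omega>. (\<Sum>g = 2..NG + 1. of_bool (G \<omega> = g) * (indicator B (X \<omega>) * D \<omega>)) \<partial>P)"
      by (rule Bochner_Integration.integral_cong[OF refl of_bool_controls])
    also have "\<dots> = (\<Sum>g = 2..NG + 1. \<integral>\<omega>. of_bool (G \<omega> = g) * (indicator B (X \<omega>) * D \<omega>) \<partial>P)"
      by (rule Bochner_Integration.integral_sum) (rule i_D)
    also have "\<dots> = (\<Sum>g = 2..NG + 1. \<integral>\<omega>. of_bool (G \<omega> = g) * (indicator B (X \<omega>) * \<mu>0 1 (X \<omega>)) \<partial>P)"
      by (intro sum.cong refl B_g B)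
    also have "\<dots> = (\<integral>\<omega>. (\<Sum>g = 2..NG + 1. of_bool (G \<omega> = g) * (indicator B (X \<omega>) * \<mu>0 1 (X \<omega>))) \<partial>P)"
      by (rule Bochner_Integration.integral_sum[symmetric]) (rule i_\<mu>)
    also have "\<dots> = (\<integral>\<omega>. of_bool (G \<omega> \<noteq> 1) * (indicator B (X \<omega>) * \<mu>0 1 (X \<omega>)) \<partial>P)"
      by (rule Bochner_Integration.integral_cong[OF refl of_bool_controls, symmetric])
    finally show "(\<integral>\<omega>. indicator B (X \<omega>) * D \<omega> \<partial>?Q) = (\<integral>\<omega>. indicator B (X \<omega>) * \<mu>0 1 (X \<omega>) \<partial>?Q)"
      by (subst (1 2) integral_given_eq[OF A _ prob_controls_pos]) auto
  qed measurable
  from regression_fn_unique[OF mD this]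
  have ae: "AE \<omega> in P. G \<omega> \<noteq> 1 \<longrightarrow> mD (X \<omega>) = \<mu>0 1 (X \<omega>)"
    by (subst (asm) AE_given_iff[OF A prob_controls_pos])
  \<comment> \<open>The set where the two functions differ has no mass within group 2, so its
    indicator times \<open>p 2\<close> integrates to zero. As \<open>p 2\<close> is almost surely
    positive, the set is null for the whole law of X.\<close>
  define N where "N = {x. mD x \<noteq> \<mu>0 1 x}"
  have [measurable]: "N \<in> sets borel" unfolding N_def by measurable
  have 2: "2 \<in> {1..NG + 1}" using NG by auto
  have N_int: "integrable P (\<lambda>\<omega>. indicator N (X \<omega>) :: real)"
    by (rule integrable_const_bound[where B=1]) (auto simp: indicator_def)
  note pi = propensity_integral[OF 2 _ N_int]
  have "(\<integral>\<omega>. indicator N (X \<omega>) * of_bool (G \<omega> = 2) \<partial>P) = (0::real)"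
    using ae by (intro integral_eq_zero_AE) (auto elim!: eventually_mono simp: N_def)
  then have z: "(\<integral>\<omega>. indicator N (X \<omega>) * p 2 (X \<omega>) \<partial>P) = 0" using pi(3) by simp
  have nn: "AE \<omega> in P. 0 \<le> indicator N (X \<omega>) * p 2 (X \<omega>)"
    using propensity_pos[OF 2] by eventually_elim simp
  have "AE \<omega> in P. indicator N (X \<omega>) * p 2 (X \<omega>) = 0"
    using integral_nonneg_eq_0_iff_AE[OF pi(2) nn] z by simp
  with propensity_pos[OF 2] show ?thesis
    by eventually_elim (auto simp: N_def indicator_def split: if_splits)
qed

lemma mD_eq_trend_group:
  "g \<in> {1..NG + 1} \<Longrightarrow> AE \<omega> in Q g. \<mu>0 1 (X \<omega>) = mD (X \<omega>)"
  using mD_eq_trend by (subst AE_given_iff) (auto intro: prob_group_pos elim!: eventually_mono)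

text \<open>By definition \<open>mD\<close> is a regression function for the pooled controls only.
  In a single group integrability is inherited from \<open>\<mu>0 1\<close>, which agrees with it
  almost surely and is a regression function there: of the untreated trend in group 1, of
  \<open>D\<close> in a control group.\<close>

lemma integrable_mD_group:
  assumes g: "g \<in> {1..NG + 1}"
  shows "integrable (Q g) (\<lambda>\<omega>. mD (X \<omega>))"
proof -
  have "\<exists>Z. regression_fn (Q g) X Z (\<mu>0 1)"
    using g \<mu>0[of g] regression_control[of g] by (cases "g = 1") auto
  then obtain Z where "regression_fn (Q g) X Z (\<mu>0 1)" ..
  from regression_fn_integrable(1)[OF prob_space_group[OF g] X_measurable_group this]
  show ?thesis
    using mD_eq_trend_group[OF g] by (subst integrable_cong_AE[symmetric, where f="\<lambda>\<omega>. \<mu>0 1 (X \<omega>)"]) auto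
qed

lemma residual_control:
  assumes g: "g \<in> {2..NG + 1}"
  shows "regression_fn (Q g) X (\<lambda>\<omega>. D \<omega> - mD (X \<omega>)) (\<lambda>_. 0)"
proof -
  have g': "g \<in> {1..NG + 1}" using g by auto
  have "regression_fn (Q g) X D mD"
    by (rule regression_fn_AE_cong[OF regression_control[OF g] mD_eq_trend_group[OF g']]) measurable
  from regression_fn_minus[OF prob_space_group[OF g'] X_measurable_group this mD_measurable integrable_mD_group[OF g']]
  show ?thesis by simp
qed

lemma residual_treated:
  "regression_fn (Q 1) X (\<lambda>\<omega>. D \<omega> - mD (X \<omega>)) (\<lambda>x. m1D x - mD x)"
  by (rule regression_fn_minus[OF prob_space_group X_measurable_group m1D mD_measurable integrable_mD_group]) auto

text \<open>Among the treated \<open>mD\<close> averages to the untreated trend. What is left is the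
  effect in the final period plus \<open>Y0 (T - 1) - Y1 (T - 1)\<close>, which no anticipation
  removes.\<close>

lemma integral_residual_treated: "(\<integral>\<omega>. D \<omega> - mD (X \<omega>) \<partial>Q 1) = ATT P T Y1 Y0 G"
proof -
  have one: "1 \<in> {1..NG + 1}" by simp
  have A: "Measurable.pred P (\<lambda>\<omega>. G \<omega> = 1)" by measurable
  have D_int: "integrable (Q 1) D" using m1D by (simp add: regression_fn_def)
  have Y0_int: "integrable (Q 1) (\<lambda>\<omega>. Y0 T \<omega> - Y0 (T - 1) \<omega>)" using \<mu>0[OF one] by (simp add: regression_fn_def)
  have "(\<integral>\<omega>. mD (X \<omega>) \<partial>Q 1) = (\<integral>\<omega>. \<mu>0 1 (X \<omega>) \<partial>Q 1)"
    using mD_eq_trend_group[OF one] by (intro integral_cong_AE) auto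
  also have "\<dots> = (\<integral>\<omega>. Y0 T \<omega> - Y0 (T - 1) \<omega> \<partial>Q 1)"
    by (rule regression_fn_integrable(2)[OF prob_space_group[OF one] X_measurable_group \<mu>0[OF one]])
  finally have "(\<integral>\<omega>. D \<omega> - mD (X \<omega>) \<partial>Q 1) = (\<integral>\<omega>. D \<omega> - (Y0 T \<omega> - Y0 (T - 1) \<omega>) \<partial>Q 1)"
    using D_int Y0_int integrable_mD_group[OF one] by simp
  also have "\<dots> = (\<integral>\<omega>. Y1 T \<omega> - Y0 T \<omega> \<partial>Q 1)"
  proof (rule integral_cong_AE)
    have "T - 1 \<in> {1..T - 1}" using T by auto
    from no_anticipation[OF this]
    have "AE \<omega> in P. G \<omega> = 1 \<longrightarrow> D \<omega> - (Y0 T \<omega> - Y0 (T - 1) \<omega>) = Y1 T \<omega> - Y0 T \<omega>"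
      by eventually_elim (simp add: Delta_Y_def observed_outcome_def)
    then show "AE \<omega> in Q 1. D \<omega> - (Y0 T \<omega> - Y0 (T - 1) \<omega>) = Y1 T \<omega> - Y0 T \<omega>"
      by (subst AE_given_iff[OF A prob_group_pos[OF one]])
  qed measurable
  finally show ?thesis unfolding ATT_def .
qed

end

section \<open>The cross-fitted estimator\<close>

lemma measurable_grp[measurable]: "grp \<in> obs_space T \<rightarrow>\<^sub>M count_space UNIV"
  unfolding grp_def[abs_def] obs_space_def by measurable

lemma measurable_cov[measurable]: "cov \<in> borel_measurable (obs_space T)"
  unfolding cov_def[abs_def] obs_space_def by measurable

lemma measurable_last_diff[measurable]:
  assumes "T \<ge> 2"
  shows "last_diff T \<in> borel_measurable (obs_space T)"
proof -
  have T: "T \<in> {1..T}" "T - 1 \<in> {1..T}" using assms by auto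
  have "(\<lambda>s. fst s t) \<in> borel_measurable (obs_space T)" if t: "t \<in> {1..T}" for t
    unfolding obs_space_def using t by measurable
  from this[OF T(1)] this[OF T(2)] show ?thesis
    unfolding last_diff_def[abs_def] by (rule borel_measurable_diff)
qed

locale crossfit_did = did_design P G X NG p C Y1 Y0 T \<mu>0 mD m1D + M: prob_space M
  for P :: "'w measure" and G and X :: "'w \<Rightarrow> 'x::euclidean_space" and NG p C Y1 Y0 T \<mu>0 mD m1D
    and M :: "'v measure" +
  fixes S :: "nat \<Rightarrow> 'v \<Rightarrow> 'x obs" and \<omega>t :: "nat \<Rightarrow> 'x \<Rightarrow> real" and L :: nat and I :: "nat \<Rightarrow> nat \<Rightarrow> nat set"
    and mhat :: "nat \<Rightarrow> nat \<Rightarrow> (nat \<Rightarrow> 'x obs) \<Rightarrow> 'x \<Rightarrow> real"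
    and phat what :: "nat \<Rightarrow> nat \<Rightarrow> (nat \<Rightarrow> 'x obs) \<Rightarrow> nat \<Rightarrow> 'x \<Rightarrow> real"
  assumes sampling: "iid_sample M (obs_space T) S (distr P (obs_space T) (observation T Y1 Y0 G X))"
    and second_moment: "\<And>g. g \<in> {1..NG + 1} \<Longrightarrow> AE \<omega> in given P (\<lambda>\<omega>. G \<omega> = g).
      nn_cond_exp (given P (\<lambda>\<omega>. G \<omega> = g)) (vimage_algebra (space P) X borel)
        (\<lambda>\<omega>. ennreal ((Delta_Y T Y1 Y0 G \<omega> - mD (X \<omega>))\<^sup>2)) \<omega> \<le> ennreal C"
    and weight_measurable: "\<And>g. g \<in> {2..NG + 1} \<Longrightarrow> \<omega>t g \<in> borel_measurable borel"
    and weight_bound: "\<And>g. g \<in> {2..NG + 1} \<Longrightarrow> AE \<omega> in P. \<bar>\<omega>t g (X \<omega>)\<bar> \<le> C"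
    and L: "L \<ge> 1"
    and folds: "\<And>n. L dvd n \<Longrightarrow> equal_folds n L (I n)"
    and mhat_measurable: "\<And>n l. L dvd n \<Longrightarrow> l \<in> {1..L} \<Longrightarrow>
      (\<lambda>(d, x). mhat n l d x)
        \<in> borel_measurable ((\<Pi>\<^sub>M i\<in>fold_compl L (I n) l. obs_space T) \<Otimes>\<^sub>M borel)"
    and phat_measurable: "\<And>n l g. L dvd n \<Longrightarrow> l \<in> {1..L} \<Longrightarrow> g \<in> {1..NG + 1} \<Longrightarrow>
      (\<lambda>(d, x). phat n l d g x)
        \<in> borel_measurable ((\<Pi>\<^sub>M i\<in>fold_compl L (I n) l. obs_space T) \<Otimes>\<^sub>M borel)"
    and what_measurable: "\<And>n l g. L dvd n \<Longrightarrow> l \<in> {1..L} \<Longrightarrow> g \<in> {1..NG + 1} \<Longrightarrow>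
      (\<lambda>(d, x). what n l d g x)
        \<in> borel_measurable ((\<Pi>\<^sub>M i\<in>fold_compl L (I n) l. obs_space T) \<Otimes>\<^sub>M borel)"
    and what_sum: "\<And>k l. l \<in> {1..L} \<Longrightarrow> AE \<omega> in M. \<forall>x\<in>support (distr P borel X).
      (\<Sum>g = 2..NG + 1. what (L * k) l (training L (I (L * k)) l (\<lambda>i. S i \<omega>)) g x) = 1"
    and what_bounded: "\<And>l g. l \<in> {1..L} \<Longrightarrow> g \<in> {1..NG + 1} \<Longrightarrow>
      O_p M (\<lambda>k \<omega>. sup_norm_on (support (distr P borel X)) (what (L * k) l (training L (I (L * k)) l (\<lambda>i. S i \<omega>)) g))"
    and mhat_rate: "\<And>l. l \<in> {1..L} \<Longrightarrow> o_p M (\<lambda>k. 1) (\<lambda>k \<omega>. L2_norm (distr P borel X)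
      (\<lambda>x. mhat (L * k) l (training L (I (L * k)) l (\<lambda>i. S i \<omega>)) x - mD x))"
    and phat_rate: "\<And>l g. l \<in> {1..L} \<Longrightarrow> g \<in> {2..NG + 1} \<Longrightarrow> o_p M (\<lambda>k. 1) (\<lambda>k \<omega>. L2_norm (distr P borel X)
      (\<lambda>x. phat (L * k) l (training L (I (L * k)) l (\<lambda>i. S i \<omega>)) 1 x
         / phat (L * k) l (training L (I (L * k)) l (\<lambda>i. S i \<omega>)) g x - p 1 x / p g x))"
    and what_rate: "\<And>l g. l \<in> {1..L} \<Longrightarrow> g \<in> {2..NG + 1} \<Longrightarrow> o_p M (\<lambda>k. 1) (\<lambda>k \<omega>. L2_norm (distr P borel X)
      (\<lambda>x. what (L * k) l (training L (I (L * k)) l (\<lambda>i. S i \<omega>)) g x - \<omega>t g x))"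
    and product_rate: "\<And>l g. l \<in> {1..L} \<Longrightarrow> g \<in> {2..NG + 1} \<Longrightarrow> o_p M (\<lambda>k. 1 / sqrt (real (L * k)))
      (\<lambda>k \<omega>. L2_norm (distr P borel X) (\<lambda>x. phat (L * k) l (training L (I (L * k)) l (\<lambda>i. S i \<omega>)) 1 x
         / phat (L * k) l (training L (I (L * k)) l (\<lambda>i. S i \<omega>)) g x - p 1 x / p g x)
       * L2_norm (distr P borel X) (\<lambda>x. mhat (L * k) l (training L (I (L * k)) l (\<lambda>i. S i \<omega>)) x - mD x))"
begin

abbreviation FX :: "'x measure" where "FX \<equiv> distr P borel X"

abbreviation N :: "'x obs measure" where "N \<equiv> obs_space T"

abbreviation \<mu> :: "'x obs measure" where "\<mu> \<equiv> distr P N (observation T Y1 Y0 G X)"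

abbreviation \<theta> :: real where "\<theta> \<equiv> ATT P T Y1 Y0 G"

abbreviation \<pi>1 :: real where "\<pi>1 \<equiv> prob {\<omega>\<in>space P. G \<omega> = 1}"

abbreviation training_set :: "nat \<Rightarrow> nat \<Rightarrow> nat set" where "training_set k l \<equiv> fold_compl L (I (L * k)) l"

abbreviation train :: "nat \<Rightarrow> nat \<Rightarrow> 'v \<Rightarrow> nat \<Rightarrow> 'x obs" where
  "train k l \<omega> \<equiv> training L (I (L * k)) l (\<lambda>i. S i \<omega>)"

abbreviation \<rho>hat :: "nat \<Rightarrow> nat \<Rightarrow> (nat \<Rightarrow> 'x obs) \<Rightarrow> nat \<Rightarrow> 'x \<Rightarrow> real" where
  "\<rho>hat k l d g x \<equiv> phat (L * k) l d 1 x / phat (L * k) l d g x"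

sublocale residual_design P G X NG p C "\<lambda>\<omega>. D \<omega> - mD (X \<omega>)"
  by unfold_locales (use residual_control second_moment in auto)

lemma observation_measurable[measurable]: "observation T Y1 Y0 G X \<in> P \<rightarrow>\<^sub>M N"
proof -
  have "(\<lambda>\<omega>. restrict (\<lambda>t. observed_outcome Y1 Y0 G t \<omega>) {1..T}) \<in> P \<rightarrow>\<^sub>M (\<Pi>\<^sub>M t\<in>{1..T}. borel)"
  proof (rule measurable_restrict)
    fix t assume t: "t \<in> {1..T}"
    note [measurable] = Y1[OF t] Y0[OF t]
    show "(\<lambda>\<omega>. observed_outcome Y1 Y0 G t \<omega>) \<in> borel_measurable P"
      unfolding observed_outcome_def by measurable
  qed
  then show ?thesis unfolding observation_def[abs_def] obs_space_def by measurable
qed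

lemma observation_simps[simp]:
  "grp (observation T Y1 Y0 G X \<omega>) = G \<omega>"
  "cov (observation T Y1 Y0 G X \<omega>) = X \<omega>"
  "last_diff T (observation T Y1 Y0 G X \<omega>) = D \<omega>"
  using T by (auto simp: observation_def grp_def cov_def last_diff_def Delta_Y_def)

lemmas last_diff_measurable[measurable] = measurable_last_diff[OF T]

lemma S_indep: "M.indep_vars (\<lambda>_. N) S {1..}" and S_law: "i \<ge> 1 \<Longrightarrow> distr M N (S i) = \<mu>"
  using sampling by (auto simp: iid_sample_def)

lemma S_measurable: "i \<ge> 1 \<Longrightarrow> S i \<in> M \<rightarrow>\<^sub>M N"
  using S_indep unfolding M.indep_vars_def2 by auto

lemma fold_facts:
  assumes l: "l \<in> {1..L}"
  shows "training_set k l \<inter> I (L * k) l = {}" "training_set k l \<subseteq> {1..}" "I (L * k) l \<subseteq> {1..}"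
    "finite (I (L * k) l)" "card (I (L * k) l) = k"
proof -
  have eq: "equal_folds (L * k) L (I (L * k))" by (rule folds) simp
  have sub: "I (L * k) l' \<subseteq> {1..L * k}" if "l' \<in> {1..L}" for l'
    using eq that unfolding equal_folds_def by blast
  show "training_set k l \<inter> I (L * k) l = {}"
    using eq l unfolding equal_folds_def fold_compl_def disjoint_family_on_def by blast
  show "training_set k l \<subseteq> {1..}" using sub unfolding fold_compl_def by fastforce
  show "I (L * k) l \<subseteq> {1..}" using sub[OF l] by auto
  show "finite (I (L * k) l)" using sub[OF l] finite_subset by blast
  show "card (I (L * k) l) = k" using eq l L unfolding equal_folds_def by simp
qed

lemma sum_over_folds: "(\<Sum>l = 1..L. \<Sum>i\<in>I (L * k) l. f i) = (\<Sum>i = 1..L * k. f i :: real)"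
proof -
  have eq: "equal_folds (L * k) L (I (L * k))" by (rule folds) simp
  have "sum f (\<Union>l\<in>{1..L}. I (L * k) l) = (\<Sum>l = 1..L. sum f (I (L * k) l))"
    by (rule sum.UNION_disjoint)
      (use eq fold_facts(4) in \<open>auto simp: equal_folds_def disjoint_family_on_def\<close>)
  then show ?thesis using eq by (simp add: equal_folds_def)
qed

lemma train_in_space:
  assumes "l \<in> {1..L}" "\<omega> \<in> space M"
  shows "train k l \<omega> \<in> space (\<Pi>\<^sub>M i\<in>training_set k l. N)"
  using fold_facts(2)[OF assms(1), of k] measurable_space[OF S_measurable assms(2)]
  by (auto simp: training_def space_PiM)

text \<open>The summand of the estimator without the factor 1 / \<open>\<pi>1\<close>. It takes
  ratios instead of propensities, so that the estimate and its limit \<open>r\<close> are treated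
  alike.\<close>

definition score :: "('x \<Rightarrow> real) \<Rightarrow> (nat \<Rightarrow> 'x \<Rightarrow> real) \<Rightarrow> (nat \<Rightarrow> 'x \<Rightarrow> real) \<Rightarrow> 'x obs \<Rightarrow> real" where
  "score m \<rho> w s = (of_bool (grp s = 1) - (\<Sum>g = 2..NG + 1. w g (cov s) * \<rho> g (cov s) * of_bool (grp s = g)))
     * (last_diff T s - m (cov s))"

lemma phi_eq_score: "phi T NG m q w \<pi> s = 1 / \<pi> * score m (\<lambda>g x. q 1 x / q g x) w s"
  by (simp add: phi_def score_def)

definition score_hat :: "nat \<Rightarrow> nat \<Rightarrow> (nat \<Rightarrow> 'x obs) \<Rightarrow> 'x obs \<Rightarrow> real" where
  "score_hat k l d = score (mhat (L * k) l d) (\<rho>hat k l d) (what (L * k) l d)"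

definition score_error :: "nat \<Rightarrow> nat \<Rightarrow> (nat \<Rightarrow> 'x obs) \<Rightarrow> 'x obs \<Rightarrow> real" where
  "score_error k l d s = score_hat k l d s - score mD r \<omega>t s"

text \<open>Subtracting \<theta> on the treated units only absorbs the estimation of
  \<open>\<pi>1\<close>, because the treatment indicators add up to exactly n times its
  estimate.\<close>

definition influence :: "'x obs \<Rightarrow> real" where
  "influence s = score mD r \<omega>t s - \<theta> * of_bool (grp s = 1)"

lemma score_limit_measurable[measurable]: "score mD r \<omega>t \<in> borel_measurable N"
proof -
  have g: "(\<lambda>s. of_bool (grp s = g) :: real) \<in> borel_measurable N" for g by measurable
  have "(\<lambda>s. \<omega>t g (cov s)) \<in> borel_measurable N" "(\<lambda>s. r g (cov s)) \<in> borel_measurable N" if "g \<in> {2..NG + 1}" for g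
    using that by (auto intro!: measurable_compose[OF measurable_cov] weight_measurable r_measurable)
  then show ?thesis unfolding score_def[abs_def]
    by (intro borel_measurable_times borel_measurable_diff borel_measurable_sum g last_diff_measurable
        measurable_compose[OF measurable_cov mD_measurable])
qed

lemma influence_measurable[measurable]: "influence \<in> borel_measurable N"
  unfolding influence_def[abs_def] by measurable

lemma score_hat_measurable:
  assumes l: "l \<in> {1..L}"
  shows "(\<lambda>(d, s). score_hat k l d s) \<in> borel_measurable ((\<Pi>\<^sub>M i\<in>training_set k l. N) \<Otimes>\<^sub>M N)"
proof -
  let ?TN = "(\<Pi>\<^sub>M i\<in>training_set k l. N) \<Otimes>\<^sub>M N"
  have n: "L dvd L * k" by simp
  have c: "(\<lambda>x. (fst x, cov (snd x))) \<in> ?TN \<rightarrow>\<^sub>M (\<Pi>\<^sub>M i\<in>training_set k l. N) \<Otimes>\<^sub>M borel" by measurable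
  have m: "(\<lambda>x. mhat (L * k) l (fst x) (cov (snd x))) \<in> borel_measurable ?TN"
    using measurable_compose[OF c mhat_measurable[OF n l]] by simp
  have q: "(\<lambda>x. phat (L * k) l (fst x) g (cov (snd x))) \<in> borel_measurable ?TN" if "g \<in> {1..NG + 1}" for g
    using measurable_compose[OF c phat_measurable[OF n l that]] by simp
  have w: "(\<lambda>x. what (L * k) l (fst x) g (cov (snd x))) \<in> borel_measurable ?TN" if "g \<in> {1..NG + 1}" for g
    using measurable_compose[OF c what_measurable[OF n l that]] by simp
  have g: "(\<lambda>x. of_bool (grp (snd x) = g) :: real) \<in> borel_measurable ?TN" for g by measurable
  have d: "(\<lambda>x. last_diff T (snd x)) \<in> borel_measurable ?TN" by measurable
  show ?thesis unfolding score_hat_def score_def split_beta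
    by (intro borel_measurable_times borel_measurable_diff borel_measurable_divide borel_measurable_sum g d m w q) auto
qed

lemma score_error_measurable:
  assumes l: "l \<in> {1..L}"
  shows "(\<lambda>(d, s). score_error k l d s) \<in> borel_measurable ((\<Pi>\<^sub>M i\<in>training_set k l. N) \<Otimes>\<^sub>M N)"
proof -
  have "(\<lambda>x. score mD r \<omega>t (snd x)) \<in> borel_measurable ((\<Pi>\<^sub>M i\<in>training_set k l. N) \<Otimes>\<^sub>M N)" by measurable
  with score_hat_measurable[OF l, of k] show ?thesis
    unfolding score_error_def split_beta by (rule borel_measurable_diff)
qed

lemma train_measurable:
  assumes l: "l \<in> {1..L}"
  shows "train k l \<in> M \<rightarrow>\<^sub>M (\<Pi>\<^sub>M i\<in>training_set k l. N)"
  unfolding training_def[abs_def]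
  by (rule measurable_restrict) (use fold_facts(2)[OF l, of k] in \<open>auto intro: S_measurable\<close>)

lemma score_error_train_measurable:
  assumes l: "l \<in> {1..L}" and i: "i \<ge> 1"
  shows "(\<lambda>\<omega>. score_error k l (train k l \<omega>) (S i \<omega>)) \<in> borel_measurable M"
  using measurable_compose[OF measurable_Pair[OF train_measurable[OF l] S_measurable[OF i]] score_error_measurable[OF l]]
  by simp

text \<open>A property of the training data alone, so that it can be assumed while they are frozen.
  Single errors are measured on the scale \<epsilon>, their product on the scale \<epsilon> / sqrt
  n.\<close>

definition good_training :: "nat \<Rightarrow> nat \<Rightarrow> real \<Rightarrow> real \<Rightarrow> (nat \<Rightarrow> 'x obs) \<Rightarrow> bool" where
  "good_training k l K \<epsilon> d \<longleftrightarrow>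
     (\<forall>x\<in>support FX. (\<Sum>g = 2..NG + 1. what (L * k) l d g x) = 1) \<and>
     L2_norm FX (\<lambda>x. mhat (L * k) l d x - mD x) \<le> ennreal \<epsilon> \<and>
     (\<forall>g\<in>{2..NG + 1}. sup_norm_on (support FX) (what (L * k) l d g) \<le> ennreal K \<and>
       L2_norm FX (\<lambda>x. \<rho>hat k l d g x - p 1 x / p g x) \<le> ennreal \<epsilon> \<and>
       L2_norm FX (\<lambda>x. what (L * k) l d g x - \<omega>t g x) \<le> ennreal \<epsilon> \<and>
       L2_norm FX (\<lambda>x. \<rho>hat k l d g x - p 1 x / p g x) * L2_norm FX (\<lambda>x. mhat (L * k) l d x - mD x)
         \<le> ennreal (\<epsilon> * (1 / sqrt (real (L * k)))))"

text \<open>For fixed \<open>d\<close> the score error is an ordinary function of one observation,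
  so \<open>prob_iid_sum_le\<close> applies with the centred part as \<open>u\<close> and the
  product part as \<open>v\<close>.\<close>

lemma prob_score_error_le:
  assumes l: "l \<in> {1..L}" and d: "d \<in> space (\<Pi>\<^sub>M i\<in>training_set k l. N)"
    and good: "good_training k l K \<epsilon> d" and K: "K \<ge> 0" and \<epsilon>: "\<epsilon> \<ge> 0" and \<eta>: "\<eta> > 0"
  shows "M.prob {\<omega>\<in>space M. \<bar>\<Sum>i\<in>I (L * k) l. score_error k l d (S i \<omega>)\<bar> > \<eta>}
    \<le> 4 * k * centred_bound K \<epsilon> / \<eta>\<^sup>2 + 2 * k * (real NG * (K * (\<epsilon> * (1 / sqrt (real (L * k)))))) / \<eta>"
proof -
  have n: "L dvd L * k" by simp
  let ?w = "what (L * k) l d" and ?\<rho> = "\<rho>hat k l d" and ?\<delta> = "\<lambda>x. mhat (L * k) l d x - mD x"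
  let ?\<kappa> = "\<epsilon> * (1 / sqrt (real (L * k)))"
  have pair: "Pair d \<in> borel \<rightarrow>\<^sub>M (\<Pi>\<^sub>M i\<in>training_set k l. N) \<Otimes>\<^sub>M borel"
    by (rule measurable_Pair1') (rule d)
  have q: "phat (L * k) l d g \<in> borel_measurable borel" if "g \<in> {1..NG + 1}" for g
    using measurable_compose[OF pair phat_measurable[OF n l that]] by simp
  have w: "?w g \<in> borel_measurable borel" if "g \<in> {2..NG + 1}" for g
  proof -
    have "g \<in> {1..NG + 1}" using that by auto
    from measurable_compose[OF pair what_measurable[OF n l this]] show ?thesis by simp
  qed
  have \<rho>: "?\<rho> g \<in> borel_measurable borel" if "g \<in> {2..NG + 1}" for g
    using that by (intro borel_measurable_divide q) auto
  have \<delta>: "?\<delta> \<in> borel_measurable borel"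
    using measurable_compose[OF pair mhat_measurable[OF n l]] by simp
  have to_P: "(\<integral>\<^sup>+\<omega>. ennreal ((f (X \<omega>))\<^sup>2) \<partial>P) = (\<integral>\<^sup>+x. ennreal ((f x)\<^sup>2) \<partial>FX)"
    if [measurable]: "f \<in> borel_measurable borel" for f
    by (subst nn_integral_distr) auto
  have supp: "AE \<omega> in P. X \<omega> \<in> support FX"
    by (rule AE_distrD[OF X]) (rule AE_in_support, simp)
  have w_bound: "AE \<omega> in P. \<bar>?w h (X \<omega>)\<bar> \<le> K" if h: "h \<in> {2..NG + 1}" for h
    using supp
  proof eventually_elim
    case (elim \<omega>)
    have "ennreal \<bar>?w h (X \<omega>)\<bar> \<le> sup_norm_on (support FX) (?w h)"
      unfolding sup_norm_on_def using elim by (rule SUP_upper)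
    also have "\<dots> \<le> ennreal K" using good h unfolding good_training_def by blast
    finally show ?case using K by simp
  qed
  have w_sum: "AE \<omega> in P. (\<Sum>h = 2..NG + 1. ?w h (X \<omega>)) = 1"
    using supp good unfolding good_training_def by (auto elim!: eventually_mono)
  have r_eq: "r g = (\<lambda>x. p 1 x / p g x)" for g by (simp add: r_def fun_eq_iff)
  have \<rho>r: "(\<lambda>x. ?\<rho> h x - r h x) \<in> borel_measurable borel" if "h \<in> {2..NG + 1}" for h
    using that \<rho> r_measurable by (intro borel_measurable_diff) auto
  have wv: "(\<lambda>x. ?w h x - \<omega>t h x) \<in> borel_measurable borel" if "h \<in> {2..NG + 1}" for h
    using that w weight_measurable by (intro borel_measurable_diff) auto
  have \<kappa>: "?\<kappa> \<ge> 0" using \<epsilon> by simp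
  have \<delta>_L2: "(\<integral>\<^sup>+\<omega>. ennreal ((?\<delta> (X \<omega>))\<^sup>2) \<partial>P) \<le> ennreal (\<epsilon>\<^sup>2)"
    unfolding to_P[OF \<delta>] by (rule nn_integral_le_of_L2_norm_le[OF _ \<epsilon>]) (use good in \<open>simp add: good_training_def\<close>)
  have \<rho>_L2: "(\<integral>\<^sup>+\<omega>. ennreal ((?\<rho> h (X \<omega>) - r h (X \<omega>))\<^sup>2) \<partial>P) \<le> ennreal (\<epsilon>\<^sup>2)" if h: "h \<in> {2..NG + 1}" for h
    unfolding to_P[OF \<rho>r[OF h]] unfolding r_eq by (rule nn_integral_le_of_L2_norm_le[OF _ \<epsilon>]) (use good h in \<open>simp add: good_training_def\<close>)
  have w_L2: "(\<integral>\<^sup>+\<omega>. ennreal ((?w h (X \<omega>) - \<omega>t h (X \<omega>))\<^sup>2) \<partial>P) \<le> ennreal (\<epsilon>\<^sup>2)" if h: "h \<in> {2..NG + 1}" for h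
    unfolding to_P[OF wv[OF h]] by (rule nn_integral_le_of_L2_norm_le[OF _ \<epsilon>]) (use good h in \<open>simp add: good_training_def\<close>)
  have prod: "(\<integral>\<^sup>+\<omega>. ennreal ((?\<rho> h (X \<omega>) - r h (X \<omega>))\<^sup>2) \<partial>P) * (\<integral>\<^sup>+\<omega>. ennreal ((?\<delta> (X \<omega>))\<^sup>2) \<partial>P) \<le> ennreal (?\<kappa>\<^sup>2)"
    if h: "h \<in> {2..NG + 1}" for h
    unfolding to_P[OF \<rho>r[OF h]] to_P[OF \<delta>] unfolding r_eq
    by (rule nn_integral_mult_le_of_L2_norm_le[OF _ \<kappa>, where a=\<epsilon> and b=\<epsilon>]) (use good h in \<open>auto simp: good_training_def\<close>)
  note hyps = w \<rho> weight_measurable \<delta> w_bound w_sum \<delta>_L2 \<rho>_L2 w_L2 prod K \<kappa>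
  define u where "u s = centred_part ?w ?\<rho> \<omega>t ?\<delta> (grp s) (cov s) (last_diff T s - mD (cov s))" for s
  define v where "v s = product_part ?w ?\<rho> ?\<delta> (grp s) (cov s)" for s
  have e: "(\<lambda>s. last_diff T s - mD (cov s)) \<in> borel_measurable N" by measurable
  have u_m[measurable]: "u \<in> borel_measurable N"
    unfolding u_def[abs_def] by (rule centred_part_measurable[OF hyps measurable_grp measurable_cov e])
  have v_m[measurable]: "v \<in> borel_measurable N"
    unfolding v_def[abs_def] by (rule product_part_measurable[OF hyps measurable_grp measurable_cov])
  have uv: "score_error k l d s = u s + v s" for s
    unfolding score_error_def score_hat_def score_def u_def v_def score_difference[symmetric] by simp
  let ?o = "observation T Y1 Y0 G X"
  have u2: "(\<integral>\<^sup>+\<omega>. ennreal ((u (?o \<omega>))\<^sup>2) \<partial>P) \<le> ennreal (centred_bound K \<epsilon>)"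
    unfolding u_def observation_simps by (rule centred_part_square[OF hyps])
  have cb: "centred_bound K \<epsilon> \<ge> 0" unfolding centred_bound_def using C_nonneg by simp
  have u2_int: "integrable P (\<lambda>\<omega>. (u (?o \<omega>))\<^sup>2)"
    by (rule square_integrable_of_nn_integral_le(1)[OF _ u2]) measurable
  have "integrable \<mu> (\<lambda>s. (u s)\<^sup>2)" using u2_int by (subst integrable_distr_eq) auto
  moreover have "(\<integral>s. u s \<partial>\<mu>) = 0"
    using centred_part_mean[OF hyps] by (subst integral_distr) (auto simp: u_def)
  moreover have "(\<integral>s. (u s)\<^sup>2 \<partial>\<mu>) \<le> centred_bound K \<epsilon>"
  proof -
    have "ennreal (\<integral>\<omega>. (u (?o \<omega>))\<^sup>2 \<partial>P) \<le> ennreal (centred_bound K \<epsilon>)"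
      using u2 by (subst nn_integral_eq_integral[OF u2_int, symmetric]) auto
    then show ?thesis using cb by (subst integral_distr) auto
  qed
  moreover have v1: "(\<integral>\<^sup>+\<omega>. ennreal \<bar>v (?o \<omega>)\<bar> \<partial>P) \<le> ennreal (real NG * (K * ?\<kappa>))"
    unfolding v_def observation_simps by (rule product_part_abs[OF hyps])
  have v_int: "integrable P (\<lambda>\<omega>. v (?o \<omega>))"
    by (rule integrableI_bounded) (measurable, use v1 in \<open>auto simp: le_less_trans[OF v1]\<close>)
  have "integrable \<mu> v" using v_int by (subst integrable_distr_eq) auto
  moreover have "(\<integral>s. \<bar>v s\<bar> \<partial>\<mu>) \<le> real NG * (K * ?\<kappa>)"
  proof -
    have "ennreal (\<integral>\<omega>. \<bar>v (?o \<omega>)\<bar> \<partial>P) \<le> ennreal (real NG * (K * ?\<kappa>))"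
      using v1 v_int by (subst nn_integral_eq_integral[symmetric]) auto
    then have "(\<integral>\<omega>. \<bar>v (?o \<omega>)\<bar> \<partial>P) \<le> real NG * (K * ?\<kappa>)"
      by (subst (asm) ennreal_le_iff) (intro mult_nonneg_nonneg K \<kappa> of_nat_0_le_iff)
    then show ?thesis by (subst integral_distr) auto
  qed
  moreover have "M.indep_vars (\<lambda>_. N) S (I (L * k) l)"
    by (rule M.indep_vars_subset[OF S_indep fold_facts(3)[OF l]])
  moreover have "distr M N (S i) = \<mu>" if "i \<in> I (L * k) l" for i
    using S_law fold_facts(3)[OF l, of k] that by auto
  ultimately show ?thesis
    unfolding uv using M.prob_iid_sum_le[of N S "I (L * k) l" \<mu> u "centred_bound K \<epsilon>" v "real NG * (K * ?\<kappa>)" \<eta>]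
      fold_facts(4,5)[OF l, of k] \<eta> u_m v_m by simp
qed

abbreviation V :: real where "V \<equiv> V_PT P T NG Y1 Y0 G X p mD m1D \<omega>t"

lemma \<pi>1_pos: "\<pi>1 > 0"
  by (rule prob_group_pos) simp

lemma influence_observation:
  "influence (observation T Y1 Y0 G X \<omega>) =
    (of_bool (G \<omega> = 1) - (\<Sum>h = 2..NG + 1. \<omega>t h (X \<omega>) * r h (X \<omega>) * of_bool (G \<omega> = h))) * (D \<omega> - mD (X \<omega>))
    - \<theta> * of_bool (G \<omega> = 1)"
  by (simp add: influence_def score_def)

lemma influence_law:
  shows "integrable \<mu> (\<lambda>s. (influence s)\<^sup>2)" "(\<integral>s. influence s \<partial>\<mu>) = 0"
    "(\<integral>s. (influence s)\<^sup>2 \<partial>\<mu>) = \<pi>1\<^sup>2 * V"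
proof -
  note mom = influence_moments[where v=\<omega>t, OF weight_measurable weight_bound residual_treated, unfolded integral_residual_treated,
      folded influence_observation]
  show "integrable \<mu> (\<lambda>s. (influence s)\<^sup>2)"
    using mom(1) by (subst integrable_distr_eq) auto
  show "(\<integral>s. influence s \<partial>\<mu>) = 0"
    using mom(2) by (subst integral_distr) auto
  have "(\<integral>s. (influence s)\<^sup>2 \<partial>\<mu>) = (\<integral>\<omega>. (influence (observation T Y1 Y0 G X \<omega>))\<^sup>2 \<partial>P)"
    by (subst integral_distr) auto
  also have "\<dots> = \<pi>1\<^sup>2 * V"
  proof -
    \<comment> \<open>Subtracting from the residual its own regression function among the treated
      cancels \<open>mD\<close>, which gives the first summand of \<open>V_PT\<close>.\<close>
    have "D \<omega> - mD (X \<omega>) - (m1D (X \<omega>) - mD (X \<omega>)) = D \<omega> - m1D (X \<omega>)" for \<omega> by simp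
    from mom(3)[unfolded this] show ?thesis unfolding V_PT_def using \<pi>1_pos by simp
  qed
  finally show "(\<integral>s. (influence s)\<^sup>2 \<partial>\<mu>) = \<pi>1\<^sup>2 * V" .
qed

text \<open>K comes from boundedness in probability and depends on \<delta> only. It is fixed before
  \<epsilon>, which can then be chosen small relative to K.\<close>

lemma good_training_holds:
  assumes l: "l \<in> {1..L}" and \<delta>: "\<delta> > 0"
  obtains K where "K \<ge> 0"
    "\<And>\<epsilon>. \<epsilon> > 0 \<Longrightarrow> \<forall>\<^sub>F k in sequentially. holds_outside M \<delta> (\<lambda>\<omega>. good_training k l K \<epsilon> (train k l \<omega>))"
proof -
  let ?H = "{2..NG + 1}"
  \<comment> \<open>One share for \<open>mhat\<close> and four for each of the NG control groups
    (supremum norm, ratio, weight, product). The sum condition on the weights holds almost surely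
    and costs nothing.\<close>
  define \<delta>' where "\<delta>' = \<delta> / (1 + 4 * real NG)"
  have \<delta>': "\<delta>' > 0" using \<delta> by (simp add: \<delta>'_def add_pos_nonneg)
  define bounds where "bounds g K \<longleftrightarrow> K \<ge> 0 \<and> (\<forall>\<^sub>F k in sequentially. holds_outside M \<delta>'
      (\<lambda>\<omega>. sup_norm_on (support FX) (what (L * k) l (train k l \<omega>) g) \<le> ennreal K))" for g K
  have "\<exists>K. bounds g K" if g: "g \<in> ?H" for g
  proof -
    have g': "g \<in> {1..NG + 1}" using g by auto
    show ?thesis unfolding bounds_def by (rule M.O_p_holds_outside[OF what_bounded[OF l g'] \<delta>']) blast
  qed
  then obtain Kf where "\<And>g. g \<in> ?H \<Longrightarrow> bounds g (Kf g)" by metis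
  then have Kf: "\<And>g. g \<in> ?H \<Longrightarrow> Kf g \<ge> 0" "\<And>g. g \<in> ?H \<Longrightarrow> \<forall>\<^sub>F k in sequentially. holds_outside M \<delta>'
      (\<lambda>\<omega>. sup_norm_on (support FX) (what (L * k) l (train k l \<omega>) g) \<le> ennreal (Kf g))"
    unfolding bounds_def by (simp_all only:)
  \<comment> \<open>A sum of nonnegative bounds serves all groups at once.\<close>
  define K where "K = sum Kf ?H"
  have "K \<ge> 0" unfolding K_def by (rule sum_nonneg) (rule Kf(1))
  have Kf_le: "Kf g \<le> K" if "g \<in> ?H" for g
    unfolding K_def by (rule member_le_sum[OF that]) (use Kf(1) in auto)
  show thesis
  proof (rule that[OF \<open>K \<ge> 0\<close>])
    fix \<epsilon> :: real assume \<epsilon>: "\<epsilon> > 0"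
    have m: "\<forall>\<^sub>F k in sequentially. holds_outside M \<delta>'
        (\<lambda>\<omega>. L2_norm FX (\<lambda>x. mhat (L * k) l (train k l \<omega>) x - mD x) \<le> ennreal \<epsilon>)"
      using M.o_p_holds_outside[OF mhat_rate[OF l] \<delta>' \<epsilon>] by simp
    have g: "\<forall>\<^sub>F k in sequentially. holds_outside M (4 * \<delta>') (\<lambda>\<omega>.
        sup_norm_on (support FX) (what (L * k) l (train k l \<omega>) g) \<le> ennreal K \<and>
        L2_norm FX (\<lambda>x. \<rho>hat k l (train k l \<omega>) g x - p 1 x / p g x) \<le> ennreal \<epsilon> \<and>
        L2_norm FX (\<lambda>x. what (L * k) l (train k l \<omega>) g x - \<omega>t g x) \<le> ennreal \<epsilon> \<and>
        L2_norm FX (\<lambda>x. \<rho>hat k l (train k l \<omega>) g x - p 1 x / p g x) *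
          L2_norm FX (\<lambda>x. mhat (L * k) l (train k l \<omega>) x - mD x) \<le> ennreal (\<epsilon> * (1 / sqrt (real (L * k)))))"
      if g: "g \<in> ?H" for g
      using Kf(2)[OF g] M.o_p_holds_outside[OF phat_rate[OF l g] \<delta>' \<epsilon>] M.o_p_holds_outside[OF what_rate[OF l g] \<delta>' \<epsilon>]
        M.o_p_holds_outside[OF product_rate[OF l g] \<delta>' \<epsilon>]
    proof eventually_elim
      case (elim k)
      have "holds_outside M \<delta>' (\<lambda>\<omega>. sup_norm_on (support FX) (what (L * k) l (train k l \<omega>) g) \<le> ennreal K)"
        by (rule holds_outside_mono[OF elim(1)]) (use Kf_le[OF g] in \<open>auto intro: order_trans ennreal_leI\<close>)
      from M.holds_outside_conj[OF this M.holds_outside_conj[OF elim(2) M.holds_outside_conj[OF elim(3,4)]]]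
      show ?case by (rule holds_outside_mono) auto
    qed
    have "\<forall>\<^sub>F k in sequentially. \<forall>g\<in>?H. holds_outside M (4 * \<delta>') (\<lambda>\<omega>.
        sup_norm_on (support FX) (what (L * k) l (train k l \<omega>) g) \<le> ennreal K \<and>
        L2_norm FX (\<lambda>x. \<rho>hat k l (train k l \<omega>) g x - p 1 x / p g x) \<le> ennreal \<epsilon> \<and>
        L2_norm FX (\<lambda>x. what (L * k) l (train k l \<omega>) g x - \<omega>t g x) \<le> ennreal \<epsilon> \<and>
        L2_norm FX (\<lambda>x. \<rho>hat k l (train k l \<omega>) g x - p 1 x / p g x) *
          L2_norm FX (\<lambda>x. mhat (L * k) l (train k l \<omega>) x - mD x) \<le> ennreal (\<epsilon> * (1 / sqrt (real (L * k)))))"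
      by (rule eventually_ball_finite) (use g in auto)
    with m show "\<forall>\<^sub>F k in sequentially. holds_outside M \<delta> (\<lambda>\<omega>. good_training k l K \<epsilon> (train k l \<omega>))"
    proof eventually_elim
      case (elim k)
      note b = M.holds_outside_ball[OF finite_atLeastAtMost elim(2)[rule_format]]
      note c = M.holds_outside_conj[OF M.holds_outside_AE[OF what_sum[OF l, of k]] M.holds_outside_conj[OF elim(1) b]]
      have "0 + (\<delta>' + real (card ?H) * (4 * \<delta>')) = \<delta>' * (1 + 4 * real NG)" by (simp add: algebra_simps)
      also have "\<dots> = \<delta>" by (simp add: \<delta>'_def add_nonneg_eq_0_iff)
      finally show ?case
        by (intro holds_outside_mono[OF c]) (auto simp: good_training_def)
    qed
  qed
qed

text \<open>Half of \<delta> pays for bad training data, the other half for a large error given good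
  training data.\<close>

lemma score_error_vanishes:
  assumes l: "l \<in> {1..L}" and \<tau>: "\<tau> > 0" and \<delta>: "\<delta> > 0"
  shows "\<forall>\<^sub>F k in sequentially. holds_outside M \<delta>
    (\<lambda>\<omega>. \<bar>\<Sum>i\<in>I (L * k) l. score_error k l (train k l \<omega>) (S i \<omega>)\<bar> \<le> \<tau> * sqrt (real (L * k)))"
proof -
  obtain K where K: "K \<ge> 0" and good: "\<And>\<epsilon>. \<epsilon> > 0 \<Longrightarrow>
      \<forall>\<^sub>F k in sequentially. holds_outside M (\<delta> / 2) (\<lambda>\<omega>. good_training k l K \<epsilon> (train k l \<omega>))"
    by (rule good_training_holds[OF l half_gt_zero[OF \<delta>]]) blast
  \<comment> \<open>The bound of \<open>prob_score_error_le\<close> at the level \<tau> sqrt (L k),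
    up to a factor 1 / L. The fold size k cancels, in the second summand thanks to the factor 1 /
    sqrt (L k) of the product rate. What remains depends on \<epsilon> alone and tends to 0 with
    it.\<close>
  let ?f = "\<lambda>\<epsilon>. 4 * centred_bound K \<epsilon> / \<tau>\<^sup>2 + 2 * (real NG * (K * \<epsilon>)) / \<tau>"
  have "(?f \<longlongrightarrow> ?f 0) (at_right 0)"
    unfolding centred_bound_def by (intro tendsto_intros) (use \<tau> in auto)
  then have "(?f \<longlongrightarrow> 0) (at_right 0)" by (simp add: centred_bound_def)
  then have "\<forall>\<^sub>F \<epsilon> in at_right 0. ?f \<epsilon> < \<delta> / 2"
    using \<delta> by (intro order_tendstoD) auto
  moreover have "\<forall>\<^sub>F \<epsilon> in at_right (0::real). \<epsilon> > 0" by (rule eventually_at_right_less)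
  ultimately have "\<exists>\<epsilon>. ?f \<epsilon> < \<delta> / 2 \<and> \<epsilon> > 0"
    by (intro eventually_happens'[of "at_right 0"] eventually_conj) auto
  then obtain \<epsilon> where \<epsilon>: "\<epsilon> > 0" and f: "?f \<epsilon> < \<delta> / 2" by blast
  have f_nn: "?f \<epsilon> \<ge> 0" unfolding centred_bound_def using K \<epsilon> \<tau> C_nonneg by simp
  from good[OF \<epsilon>] eventually_gt_at_top[of 0] show ?thesis
  proof eventually_elim
    case (elim k)
    have n: "real (L * k) > 0" using elim(2) L by simp
    let ?\<eta> = "\<tau> * sqrt (real (L * k))"
    let ?b = "4 * real k * centred_bound K \<epsilon> / ?\<eta>\<^sup>2 + 2 * real k * (real NG * (K * (\<epsilon> * (1 / sqrt (real (L * k)))))) / ?\<eta>"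
    have \<eta>: "?\<eta> > 0" using \<tau> n by simp
    have "?b = ?f \<epsilon> / real L"
    proof -
      have k: "real k > 0" using elim(2) by simp
      have L0: "real L > 0" using L by simp
      have "?\<eta>\<^sup>2 = \<tau>\<^sup>2 * (real L * real k)" by (simp add: power_mult_distrib)
      moreover have "2 * real k * (real NG * (K * (\<epsilon> * (1 / sqrt (real (L * k)))))) / ?\<eta>
        = 2 * real k * (real NG * (K * \<epsilon>)) / (\<tau> * (sqrt (real (L * k)) * sqrt (real (L * k))))" by (simp add: field_simps)
      moreover have "sqrt (real (L * k)) * sqrt (real (L * k)) = real L * real k" by (simp flip: of_nat_mult)
      ultimately show ?thesis using k L0 \<tau> by (simp only:) (simp add: field_simps)
    qed
    also have "\<dots> \<le> ?f \<epsilon> / 1" using f_nn L by (intro divide_left_mono) auto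
    finally have b: "?b \<le> \<delta> / 2" using f by simp
    obtain B where B: "B \<in> M.events" "M.prob B \<le> \<delta> / 2" "\<And>\<omega>. \<omega> \<in> space M - B \<Longrightarrow> good_training k l K \<epsilon> (train k l \<omega>)"
      using elim(1) unfolding holds_outside_def by auto
    have "M.prob {\<omega>\<in>space M. \<bar>\<Sum>i\<in>I (L * k) l. score_error k l (restrict (\<lambda>i. S i \<omega>) (training_set k l)) (S i \<omega>)\<bar> > ?\<eta>}
      \<le> M.prob B + \<delta> / 2"
    proof (rule M.prob_crossfit_le[OF S_indep fold_facts(1-4)[OF l] score_error_measurable[OF l] B(1)])
      fix \<omega> assume \<omega>: "\<omega> \<in> space M - B"
      have "M.prob {\<omega>'\<in>space M. \<bar>\<Sum>i\<in>I (L * k) l. score_error k l (train k l \<omega>) (S i \<omega>')\<bar> > ?\<eta>} \<le> ?b"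
        by (rule prob_score_error_le[OF l train_in_space[OF l] B(3)[OF \<omega>] K less_imp_le[OF \<epsilon>] \<eta>]) (use \<omega> in auto)
      with b show "M.prob {\<omega>'\<in>space M. \<bar>\<Sum>i\<in>I (L * k) l. score_error k l (restrict (\<lambda>i. S i \<omega>) (training_set k l)) (S i \<omega>')\<bar> > ?\<eta>} \<le> \<delta> / 2"
        unfolding training_def by linarith
    qed (use \<delta> in simp)
    then have le: "M.prob {\<omega>\<in>space M. \<bar>\<Sum>i\<in>I (L * k) l. score_error k l (train k l \<omega>) (S i \<omega>)\<bar> > ?\<eta>} \<le> \<delta>"
      unfolding training_def using B(2) by linarith
    have "(\<lambda>\<omega>. \<Sum>i\<in>I (L * k) l. score_error k l (train k l \<omega>) (S i \<omega>)) \<in> borel_measurable M"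
      by (intro borel_measurable_sum score_error_train_measurable[OF l]) (use fold_facts(3)[OF l, of k] in auto)
    from holds_outside_mono[OF M.holds_outside_prob[OF this] le] show ?case by simp
  qed
qed

section \<open>Expansion of the estimator and its limit law\<close>

definition W :: "nat \<Rightarrow> 'v \<Rightarrow> real" where
  "W k \<omega> = (\<Sum>i = 1..L * k. influence (S i \<omega>)) / sqrt (real (L * k))"

definition R :: "nat \<Rightarrow> 'v \<Rightarrow> real" where
  "R k \<omega> = (\<Sum>l = 1..L. \<Sum>i\<in>I (L * k) l. score_error k l (train k l \<omega>) (S i \<omega>)) / sqrt (real (L * k))"

definition pi_hat :: "nat \<Rightarrow> 'v \<Rightarrow> real" where
  "pi_hat k \<omega> = pi1_hat (L * k) (\<lambda>i. S i \<omega>)"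

definition Z :: "nat \<Rightarrow> 'v \<Rightarrow> real" where
  "Z k \<omega> = sqrt (real (L * k)) *
     (theta_hat T NG L (L * k) (I (L * k)) (mhat (L * k)) (phat (L * k)) (what (L * k)) (\<lambda>i. S i \<omega>) - \<theta>)"

lemma theta_hat_eq:
  "theta_hat T NG L (L * k) (I (L * k)) (mhat (L * k)) (phat (L * k)) (what (L * k)) (\<lambda>i. S i \<omega>)
    = 1 / real (L * k) * (1 / pi_hat k \<omega> * (\<Sum>l = 1..L. \<Sum>i\<in>I (L * k) l. score_hat k l (train k l \<omega>) (S i \<omega>)))"
  unfolding theta_hat_def phi_eq_score score_hat_def pi_hat_def by (simp only: sum_distrib_left)

text \<open>An exact identity: the scores add up to the score errors, the influence terms and
  \<theta> n times \<open>pi_hat\<close>; after division by \<open>pi_hat\<close> the last of these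
  is cancelled by \<theta>. Where \<open>pi_hat\<close> is 0 the quotients are 0 by convention and
  the cancellation breaks down.\<close>

lemma Z_expansion:
  assumes k: "k > 0" and \<pi>: "pi_hat k \<omega> \<noteq> 0"
  shows "Z k \<omega> = (W k \<omega> + R k \<omega>) / pi_hat k \<omega>"
proof -
  let ?n = "real (L * k)"
  let ?s = "\<Sum>l = 1..L. \<Sum>i\<in>I (L * k) l. score_hat k l (train k l \<omega>) (S i \<omega>)"
  let ?e = "\<Sum>l = 1..L. \<Sum>i\<in>I (L * k) l. score_error k l (train k l \<omega>) (S i \<omega>)"
  have n: "?n > 0" using k L by simp
  have \<pi>n: "(\<Sum>i = 1..L * k. of_bool (grp (S i \<omega>) = 1)) = pi_hat k \<omega> * ?n"
    using n by (simp add: pi_hat_def pi1_hat_def)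
  have "?s = (\<Sum>l = 1..L. \<Sum>i\<in>I (L * k) l. score_error k l (train k l \<omega>) (S i \<omega>) + score mD r \<omega>t (S i \<omega>))"
    by (simp add: score_error_def)
  also have "\<dots> = ?e + (\<Sum>i = 1..L * k. score mD r \<omega>t (S i \<omega>))"
    by (simp only: sum.distrib sum_over_folds)
  also have "(\<Sum>i = 1..L * k. score mD r \<omega>t (S i \<omega>)) = (\<Sum>i = 1..L * k. influence (S i \<omega>) + \<theta> * of_bool (grp (S i \<omega>) = 1))"
    by (simp add: influence_def)
  also have "\<dots> = (\<Sum>i = 1..L * k. influence (S i \<omega>)) + \<theta> * (pi_hat k \<omega> * ?n)"
    by (simp only: sum.distrib sum_distrib_left[symmetric] \<pi>n)
  finally have s: "?s = ?e + ((\<Sum>i = 1..L * k. influence (S i \<omega>)) + \<theta> * (pi_hat k \<omega> * ?n))" .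
  define q where "q = sqrt ?n"
  have q: "q > 0" "?n = q * q" using n by (auto simp: q_def simp flip: real_sqrt_mult)
  show ?thesis
    unfolding Z_def W_def R_def theta_hat_eq s q_def[symmetric] q(2) using q(1) \<pi> by (simp add: field_simps)
qed

lemma fold_index_pos: "l \<in> {1..L} \<Longrightarrow> i \<in> I (L * k) l \<Longrightarrow> i \<ge> 1"
  using fold_facts(3)[of l k] by auto

lemma W_measurable[measurable]: "W k \<in> borel_measurable M"
  unfolding W_def[abs_def]
  by (intro borel_measurable_divide borel_measurable_sum measurable_compose[OF S_measurable influence_measurable]) auto

lemma pi_hat_measurable[measurable]: "pi_hat k \<in> borel_measurable M"
proof -
  have "(\<lambda>s. of_bool (grp s = 1) :: real) \<in> borel_measurable N" by measurable
  then show ?thesis unfolding pi_hat_def[abs_def] pi1_hat_def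
    by (intro borel_measurable_divide borel_measurable_sum measurable_compose[OF S_measurable]) auto
qed

lemma Z_measurable[measurable]: "Z k \<in> borel_measurable M"
proof -
  have "(\<lambda>\<omega>. score_hat k l (train k l \<omega>) (S i \<omega>)) \<in> borel_measurable M" if "l \<in> {1..L}" "i \<in> I (L * k) l" for l i
    using measurable_compose[OF measurable_Pair[OF train_measurable[OF that(1)] S_measurable[OF fold_index_pos[OF that]]]
        score_hat_measurable[OF that(1)]] by simp
  then show ?thesis unfolding Z_def[abs_def] theta_hat_eq
    by (intro borel_measurable_times borel_measurable_diff borel_measurable_divide borel_measurable_sum) auto
qed

lemma R_vanishes:
  assumes \<tau>: "\<tau> > 0" and \<delta>: "\<delta> > 0"
  shows "\<forall>\<^sub>F k in sequentially. holds_outside M \<delta> (\<lambda>\<omega>. \<bar>R k \<omega>\<bar> \<le> \<tau>)"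
proof -
  have L0: "real L > 0" using L by simp
  have "\<forall>\<^sub>F k in sequentially. \<forall>l\<in>{1..L}. holds_outside M (\<delta> / L)
    (\<lambda>\<omega>. \<bar>\<Sum>i\<in>I (L * k) l. score_error k l (train k l \<omega>) (S i \<omega>)\<bar> \<le> \<tau> / L * sqrt (real (L * k)))"
    by (intro eventually_ball_finite ballI score_error_vanishes) (use \<tau> \<delta> L0 in auto)
  with eventually_gt_at_top[of 0] show ?thesis
  proof eventually_elim
    case (elim k)
    have n: "sqrt (real (L * k)) > 0" using elim(1) L by simp
    have "real (card {1..L}) * (\<delta> / L) = \<delta>" using L0 by simp
    then show ?case
    proof (intro holds_outside_mono[OF M.holds_outside_ball[OF finite_atLeastAtMost elim(2)[rule_format]]])
      fix \<omega>
      let ?e = "\<lambda>l. \<Sum>i\<in>I (L * k) l. score_error k l (train k l \<omega>) (S i \<omega>)"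
      assume e: "\<forall>l\<in>{1..L}. \<bar>?e l\<bar> \<le> \<tau> / L * sqrt (real (L * k))"
      have "\<bar>\<Sum>l = 1..L. ?e l\<bar> \<le> (\<Sum>l = 1..L. \<bar>?e l\<bar>)" by (rule sum_abs)
      also have "\<dots> \<le> (\<Sum>l = 1..L. \<tau> / L * sqrt (real (L * k)))"
        by (rule sum_mono) (use e in blast)
      also have "\<dots> = \<tau> * sqrt (real (L * k))" using L0 by simp
      finally show "\<bar>R k \<omega>\<bar> \<le> \<tau>"
        unfolding R_def abs_divide using n by (simp add: divide_le_eq)
    qed auto
  qed
qed

lemma indep_initial: "M.indep_vars (\<lambda>_. N) S {1..n}"
  by (rule M.indep_vars_subset[OF S_indep]) auto

lemma pi_hat_consistent:
  assumes \<tau>: "\<tau> > 0" and \<delta>: "\<delta> > 0"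
  shows "\<forall>\<^sub>F k in sequentially. holds_outside M \<delta> (\<lambda>\<omega>. \<bar>pi_hat k \<omega> - \<pi>1\<bar> \<le> \<tau>)"
proof -
  interpret law: prob_space \<mu> by (rule prob_space_distr) measurable
  have "(\<lambda>k. 4 / \<tau>\<^sup>2 * inverse (real k)) \<longlonglongrightarrow> 4 / \<tau>\<^sup>2 * 0"
    by (intro tendsto_mult tendsto_const lim_inverse_n)
  then have "(\<lambda>k. 4 / (real k * \<tau>\<^sup>2)) \<longlonglongrightarrow> 0"
    by (simp add: field_simps)
  then have "\<forall>\<^sub>F k in sequentially. 4 / (real k * \<tau>\<^sup>2) < \<delta>"
    using \<delta> by (intro order_tendstoD) auto
  with eventually_gt_at_top[of 0] show ?thesis
  proof eventually_elim
    case (elim k)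
    let ?n = "L * k"
    have n: "real ?n > 0" using elim(1) L by simp
    \<comment> \<open>With n inside the summand the sum is \<open>pi_hat k \<omega> - \<pi>1\<close>
      itself, and the second moment is at most 1 / n^2.\<close>
    define u where "u s = (of_bool (grp s = 1) - \<pi>1) / real ?n" for s :: "'x obs"
    have u_m[measurable]: "u \<in> borel_measurable N" unfolding u_def[abs_def] by measurable
    have "\<bar>of_bool b - \<pi>1\<bar> \<le> 1" for b :: bool using prob_le_1[of "{\<omega>\<in>space P. G \<omega> = 1}"] \<pi>1_pos by (cases b) auto
    then have "(of_bool b - \<pi>1)\<^sup>2 \<le> 1" for b :: bool by (simp only: abs_square_le_1)
    then have u_le: "(u s)\<^sup>2 \<le> 1 / (real ?n)\<^sup>2" for s
      unfolding u_def power_divide by (intro divide_right_mono) simp_all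
    have u2: "integrable \<mu> (\<lambda>s. (u s)\<^sup>2)"
      by (rule law.integrable_const_bound[where B="1 / (real ?n)\<^sup>2"]) (use u_le in auto)
    have "(\<integral>\<omega>. of_bool (G \<omega> = 1) \<partial>P) = (\<integral>\<omega>. (indicator {\<omega>\<in>space P. G \<omega> = 1} \<omega> :: real) \<partial>P)"
      by (rule Bochner_Integration.integral_cong) (auto simp: indicator_def)
    also have "\<dots> = measure P ({\<omega>\<in>space P. G \<omega> = 1} \<inter> space P)"
      by (rule Bochner_Integration.integral_indicator)
    also have "{\<omega>\<in>space P. G \<omega> = 1} \<inter> space P = {\<omega>\<in>space P. G \<omega> = 1}" by blast
    finally have mean: "(\<integral>\<omega>. of_bool (G \<omega> = 1) \<partial>P) = \<pi>1" .
    have bi: "integrable P (\<lambda>\<omega>. of_bool (G \<omega> = 1) :: real)"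
      by (rule integrable_const_bound[where B=1]) auto
    have "(\<integral>s. u s \<partial>\<mu>) = (\<integral>\<omega>. of_bool (G \<omega> = 1) - \<pi>1 \<partial>P) / real ?n"
      by (subst integral_distr) (auto simp: u_def)
    also have "(\<integral>\<omega>. of_bool (G \<omega> = 1) - \<pi>1 \<partial>P) = 0"
      by (subst Bochner_Integration.integral_diff[OF bi]) (simp_all add: mean prob_space)
    finally have u0: "(\<integral>s. u s \<partial>\<mu>) = 0" by simp
    have "(\<integral>s. (u s)\<^sup>2 \<partial>\<mu>) \<le> (\<integral>s. 1 / (real ?n)\<^sup>2 \<partial>\<mu>)"
      by (rule integral_mono[OF u2]) (use u_le in auto)
    also have "\<dots> = 1 / (real ?n)\<^sup>2" using law.prob_space by simp
    finally have uc: "(\<integral>s. (u s)\<^sup>2 \<partial>\<mu>) \<le> 1 / (real ?n)\<^sup>2" .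
    have "M.prob {\<omega>\<in>space M. \<bar>\<Sum>i\<in>{1..?n}. u (S i \<omega>)\<bar> > \<tau>}
      \<le> real (4 * card {1..?n}) * (1 / (real ?n)\<^sup>2) / \<tau>\<^sup>2"
      by (rule M.prob_iid_centred_sum_le[OF indep_initial _ _ u_m u2 u0 uc]) (use S_law \<tau> in auto)
    also have "\<dots> = 4 / (real ?n * \<tau>\<^sup>2)" using n by (simp add: field_simps power2_eq_square)
    also have "\<dots> \<le> 4 / (real k * \<tau>\<^sup>2)"
      using elim(1) L \<tau> by (intro divide_left_mono mult_right_mono mult_pos_pos) auto
    finally have le: "M.prob {\<omega>\<in>space M. \<bar>\<Sum>i = 1..?n. u (S i \<omega>)\<bar> > \<tau>} \<le> \<delta>"
      using elim(2) by simp
    have eq: "(\<Sum>i = 1..?n. u (S i \<omega>)) = pi_hat k \<omega> - \<pi>1" for \<omega>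
      using elim(1) L unfolding u_def pi_hat_def pi1_hat_def sum_divide_distrib[symmetric] sum_subtractf
      by (simp add: diff_divide_distrib)
    show ?case
      by (rule holds_outside_mono[OF M.holds_outside_prob le[unfolded eq]]) auto
  qed
qed

text \<open>The second moment of \<open>W k\<close> is the same for every k > 0, so Chebyshev's
  inequality gives one bound for all sample sizes.\<close>

lemma W_tight:
  assumes \<delta>: "\<delta> > 0"
  obtains b where "b > 0" "\<And>k. k > 0 \<Longrightarrow> holds_outside M \<delta> (\<lambda>\<omega>. \<bar>W k \<omega>\<bar> \<le> b)"
proof -
  define \<sigma> where "\<sigma> = (\<integral>s. (influence s)\<^sup>2 \<partial>\<mu>)"
  have \<sigma>: "\<sigma> \<ge> 0" unfolding \<sigma>_def by simp
  \<comment> \<open>Chosen so that 4 \<sigma> / b^2 <= \<delta>; taking \<sigma> + 1 in place of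
    \<sigma> keeps b positive when the variance vanishes.\<close>
  define b where "b = sqrt (4 * (\<sigma> + 1) / \<delta>)"
  have b: "b > 0" "b\<^sup>2 = 4 * (\<sigma> + 1) / \<delta>" using \<sigma> \<delta> by (auto simp: b_def)
  show thesis
  proof (rule that[OF b(1)])
    fix k :: nat assume "k > 0"
    let ?n = "L * k"
    have n: "real ?n > 0" using \<open>k > 0\<close> L by simp
    define u where "u s = influence s / sqrt (real ?n)" for s
    have u_m[measurable]: "u \<in> borel_measurable N" unfolding u_def[abs_def] by measurable
    have u_sq: "(u s)\<^sup>2 = (influence s)\<^sup>2 / real ?n" for s by (simp add: u_def power_divide)
    have u2: "integrable \<mu> (\<lambda>s. (u s)\<^sup>2)" unfolding u_sq using influence_law(1) by simp
    have u0: "(\<integral>s. u s \<partial>\<mu>) = 0" unfolding u_def using influence_law(2) by simp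
    have uc: "(\<integral>s. (u s)\<^sup>2 \<partial>\<mu>) \<le> \<sigma> / real ?n" unfolding u_sq \<sigma>_def by simp
    have "M.prob {\<omega>\<in>space M. \<bar>\<Sum>i\<in>{1..?n}. u (S i \<omega>)\<bar> > b}
      \<le> real (4 * card {1..?n}) * (\<sigma> / real ?n) / b\<^sup>2"
      by (rule M.prob_iid_centred_sum_le[OF indep_initial _ _ u_m u2 u0 uc]) (use S_law b in auto)
    also have "\<dots> = \<delta> * (\<sigma> / (\<sigma> + 1))" unfolding b(2) using \<open>k > 0\<close> L \<sigma> \<delta> by (simp add: field_simps)
    also have "\<dots> \<le> \<delta> * 1" using \<sigma> \<delta> by (intro mult_left_mono) auto
    finally have le: "M.prob {\<omega>\<in>space M. \<bar>\<Sum>i = 1..?n. u (S i \<omega>)\<bar> > b} \<le> \<delta>" by simp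
    have eq: "(\<Sum>i = 1..?n. u (S i \<omega>)) = W k \<omega>" for \<omega>
      unfolding u_def W_def sum_divide_distrib ..
    show "holds_outside M \<delta> (\<lambda>\<omega>. \<bar>W k \<omega>\<bar> \<le> b)"
      by (rule holds_outside_mono[OF M.holds_outside_prob le[unfolded eq]]) auto
  qed
qed

lemma Z_minus_W_vanishes:
  assumes \<eta>: "\<eta> > 0" and \<delta>: "\<delta> > 0"
  shows "\<forall>\<^sub>F k in sequentially. holds_outside M \<delta> (\<lambda>\<omega>. \<bar>Z k \<omega> - W k \<omega> / \<pi>1\<bar> \<le> \<eta>)"
proof -
  have \<delta>3: "\<delta> / 3 > 0" using \<delta> by simp
  obtain b where b: "b > 0" "\<And>k. k > 0 \<Longrightarrow> holds_outside M (\<delta> / 3) (\<lambda>\<omega>. \<bar>W k \<omega>\<bar> \<le> b)"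
    by (rule W_tight[OF \<delta>3]) blast
  \<comment> \<open>Once \<open>pi_hat\<close> is at least half of \<open>\<pi>1\<close>, replacing
    it by \<open>\<pi>1\<close> costs at most \<tau> times the first summand and the remainder
    \<open>R\<close> at most \<tau> times the second. The choice of \<tau> secures both this lower
    bound and \<tau> c <= \<eta>.\<close>
  define c where "c = 2 * b / \<pi>1\<^sup>2 + 2 / \<pi>1"
  have c: "c > 0" using b(1) \<pi>1_pos by (simp add: c_def add_pos_pos)
  define \<tau> where "\<tau> = min (\<pi>1 / 2) (\<eta> / c)"
  have \<tau>: "\<tau> > 0" using \<pi>1_pos c \<eta> by (simp add: \<tau>_def)
  have \<tau>_le: "\<tau> \<le> \<pi>1 / 2" "\<tau> \<le> \<eta> / c"
    unfolding \<tau>_def by (rule min.cobounded1, rule min.cobounded2)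
  from pi_hat_consistent[OF \<tau> \<delta>3] R_vanishes[OF \<tau> \<delta>3] eventually_gt_at_top[of 0]
  show ?thesis
  proof eventually_elim
    case (elim k)
    show ?case
    proof (rule holds_outside_mono[OF M.holds_outside_conj[OF b(2)[OF elim(3)] M.holds_outside_conj[OF elim(1,2)]]])
      fix \<omega> assume "\<bar>W k \<omega>\<bar> \<le> b \<and> \<bar>pi_hat k \<omega> - \<pi>1\<bar> \<le> \<tau> \<and> \<bar>R k \<omega>\<bar> \<le> \<tau>"
      then have Wb: "\<bar>W k \<omega>\<bar> \<le> b" and pb: "\<bar>pi_hat k \<omega> - \<pi>1\<bar> \<le> \<tau>" and Rb: "\<bar>R k \<omega>\<bar> \<le> \<tau>" by auto
      have ph: "pi_hat k \<omega> \<ge> \<pi>1 / 2" using pb \<tau>_le(1) by linarith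
      then have ph0: "pi_hat k \<omega> > 0" using \<pi>1_pos by linarith
      have split: "Z k \<omega> - W k \<omega> / \<pi>1 = W k \<omega> * (\<pi>1 - pi_hat k \<omega>) / (pi_hat k \<omega> * \<pi>1) + R k \<omega> / pi_hat k \<omega>"
        unfolding Z_expansion[OF elim(3) less_imp_neq[OF ph0, symmetric]] using ph0 \<pi>1_pos by (simp add: field_simps)
      have "\<bar>Z k \<omega> - W k \<omega> / \<pi>1\<bar> \<le> \<bar>W k \<omega> * (\<pi>1 - pi_hat k \<omega>) / (pi_hat k \<omega> * \<pi>1)\<bar> + \<bar>R k \<omega> / pi_hat k \<omega>\<bar>"
        unfolding split by (rule abs_triangle_ineq)
      also have "\<bar>W k \<omega> * (\<pi>1 - pi_hat k \<omega>) / (pi_hat k \<omega> * \<pi>1)\<bar> \<le> b * \<tau> / (\<pi>1 / 2 * \<pi>1)"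
        unfolding abs_divide abs_mult
      proof (rule frac_le)
        show "0 \<le> b * \<tau>" using b(1) \<tau> by simp
        show "\<bar>W k \<omega>\<bar> * \<bar>\<pi>1 - pi_hat k \<omega>\<bar> \<le> b * \<tau>"
          using pb by (intro mult_mono[OF Wb]) (simp_all add: abs_minus_commute less_imp_le[OF b(1)])
        show "0 < \<pi>1 / 2 * \<pi>1" by (intro mult_pos_pos half_gt_zero \<pi>1_pos)
        have "\<pi>1 / 2 * \<pi>1 \<le> pi_hat k \<omega> * \<pi>1" by (rule mult_right_mono[OF ph less_imp_le[OF \<pi>1_pos]])
        also have "\<dots> = \<bar>pi_hat k \<omega>\<bar> * \<bar>\<pi>1\<bar>" by (simp only: abs_of_pos[OF ph0] abs_of_pos[OF \<pi>1_pos])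
        finally show "\<pi>1 / 2 * \<pi>1 \<le> \<bar>pi_hat k \<omega>\<bar> * \<bar>\<pi>1\<bar>" .
      qed
      also have "\<bar>R k \<omega> / pi_hat k \<omega>\<bar> \<le> \<tau> / (\<pi>1 / 2)"
        unfolding abs_divide abs_of_pos[OF ph0]
        by (rule frac_le[OF less_imp_le[OF \<tau>] Rb half_gt_zero[OF \<pi>1_pos] ph])
      also have "b * \<tau> / (\<pi>1 / 2 * \<pi>1) + \<tau> / (\<pi>1 / 2) = \<tau> * c"
        using \<pi>1_pos by (simp add: c_def field_simps power2_eq_square)
      also have "\<dots> \<le> \<eta>" using \<tau>_le(2) c by (simp add: le_divide_eq)
      finally show "\<bar>Z k \<omega> - W k \<omega> / \<pi>1\<bar> \<le> \<eta>" by simp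
    qed simp
  qed
qed

lemma weak_conv_Z: "weak_conv_m (\<lambda>k. distr M borel (Z k)) (normal_law 0 V)"
proof (rule M.weak_conv_m_slutsky[OF Z_measurable])
  show "(\<lambda>\<omega>. W k \<omega> / \<pi>1) \<in> borel_measurable M" for k by measurable
  show "real_distribution (normal_law 0 V)" by (rule real_distribution_normal_law)
  have f2: "integrable \<mu> (\<lambda>s. (influence s / \<pi>1)\<^sup>2)"
    unfolding power_divide using influence_law(1) by simp
  have f0: "(\<integral>s. influence s / \<pi>1 \<partial>\<mu>) = 0" using influence_law(2) by simp
  have fV: "(\<integral>s. (influence s / \<pi>1)\<^sup>2 \<partial>\<mu>) = V"
    unfolding power_divide using influence_law(3) \<pi>1_pos by simp
  have "(\<lambda>s. influence s / \<pi>1) \<in> borel_measurable N" by measurable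
  from M.clt_iid[OF S_indep S_law this f2 f0]
  have clt: "weak_conv_m (\<lambda>n. distr M borel (\<lambda>\<omega>. (\<Sum>i = 1..n. influence (S i \<omega>) / \<pi>1) / sqrt (real n))) (normal_law 0 V)"
    unfolding fV .
  \<comment> \<open>Sample sizes run through the multiples of L only, so convergence of the
    distribution functions is passed to this subsequence.\<close>
  have sub: "filterlim (\<lambda>k. L * k) sequentially sequentially"
    using L by (intro mult_nat_left_at_top) auto
  have eq: "(\<lambda>\<omega>. (\<Sum>i = 1..L * k. influence (S i \<omega>) / \<pi>1) / sqrt (real (L * k))) = (\<lambda>\<omega>. W k \<omega> / \<pi>1)" for k
    unfolding W_def by (simp add: fun_eq_iff mult.commute flip: sum_divide_distrib)
  show "weak_conv_m (\<lambda>k. distr M borel (\<lambda>\<omega>. W k \<omega> / \<pi>1)) (normal_law 0 V)"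
    unfolding weak_conv_m_def weak_conv_def eq[symmetric]
  proof (intro allI impI)
    fix x assume "isCont (cdf (normal_law 0 V)) x"
    with clt have "(\<lambda>n. cdf (distr M borel (\<lambda>\<omega>. (\<Sum>i = 1..n. influence (S i \<omega>) / \<pi>1) / sqrt (real n))) x)
        \<longlonglongrightarrow> cdf (normal_law 0 V) x"
      unfolding weak_conv_m_def weak_conv_def by blast
    from filterlim_compose[OF this sub]
    show "(\<lambda>k. cdf (distr M borel (\<lambda>\<omega>. (\<Sum>i = 1..L * k. influence (S i \<omega>) / \<pi>1) / sqrt (real (L * k)))) x)
        \<longlonglongrightarrow> cdf (normal_law 0 V) x" .
  qed
  fix \<eta> :: real assume \<eta>: "\<eta> > 0"
  show "(\<lambda>k. M.prob {\<omega>\<in>space M. \<bar>Z k \<omega> - W k \<omega> / \<pi>1\<bar> > \<eta>}) \<longlonglongrightarrow> 0"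
  proof (rule tendstoI)
    fix e :: real assume "e > 0"
    then have "e / 2 > 0" by simp
    from Z_minus_W_vanishes[OF \<eta> this]
    show "\<forall>\<^sub>F k in sequentially. dist (M.prob {\<omega>\<in>space M. \<bar>Z k \<omega> - W k \<omega> / \<pi>1\<bar> > \<eta>}) 0 < e"
    proof eventually_elim
      case (elim k)
      from M.prob_le_of_holds_outside[OF elim] \<open>e > 0\<close> show ?case by simp
    qed
  qed
qed

end

theorem theorem2:
  fixes P :: "'w measure" and M :: "'v measure"
    and Y1 Y0 :: "nat \<Rightarrow> 'w \<Rightarrow> real" and G :: "'w \<Rightarrow> nat" and X :: "'w \<Rightarrow> 'x::euclidean_space"
    and T NG L :: nat
    and p \<mu>0 \<omega>t :: "nat \<Rightarrow> 'x \<Rightarrow> real" and mD m1D :: "'x \<Rightarrow> real"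
    and S :: "nat \<Rightarrow> 'v \<Rightarrow> 'x obs" and I :: "nat \<Rightarrow> nat \<Rightarrow> nat set"
    and mhat :: "nat \<Rightarrow> nat \<Rightarrow> (nat \<Rightarrow> 'x obs) \<Rightarrow> 'x \<Rightarrow> real"
    and phat what :: "nat \<Rightarrow> nat \<Rightarrow> (nat \<Rightarrow> 'x obs) \<Rightarrow> nat \<Rightarrow> 'x \<Rightarrow> real"
  defines "FX \<equiv> distr P borel X"
    and "train \<equiv> \<lambda>k l \<omega>. training L (I (L * k)) l (\<lambda>i. S i \<omega>)"
  assumes "prob_space P" and "prob_space M"
    \<comment> \<open>population\<close>
    and "T \<ge> 2" and "L \<ge> 1"
    and "\<And>t. t \<in> {1..T} \<Longrightarrow> Y1 t \<in> borel_measurable P"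
    and "\<And>t. t \<in> {1..T} \<Longrightarrow> Y0 t \<in> borel_measurable P"
    and "G \<in> P \<rightarrow>\<^sub>M count_space UNIV" and "X \<in> borel_measurable P"
    and "\<And>\<omega>. \<omega> \<in> space P \<Longrightarrow> G \<omega> \<in> {1..NG + 1}"
    and no_anticipation: "\<And>t. t \<in> {1..T - 1} \<Longrightarrow> AE \<omega> in P. Y1 t \<omega> = Y0 t \<omega>"
    and sampling: "iid_sample M (obs_space T) S (distr P (obs_space T) (observation T Y1 Y0 G X))"
    \<comment> \<open>propensities, regression functions, overlap and parallel trends\<close>
    and "\<And>g. g \<in> {1..NG + 1} \<Longrightarrow> regression_fn P X (\<lambda>\<omega>. of_bool (G \<omega> = g)) (p g)"
    and "regression_fn (given P (\<lambda>\<omega>. G \<omega> \<noteq> 1)) X (Delta_Y T Y1 Y0 G) mD"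
    and "regression_fn (given P (\<lambda>\<omega>. G \<omega> = 1)) X (Delta_Y T Y1 Y0 G) m1D"
    and overlap: "\<And>g. g \<in> {1..NG + 1} \<Longrightarrow> AE \<omega> in P. p g (X \<omega>) > 0"
    and "\<And>g. g \<in> {1..NG + 1} \<Longrightarrow>
           regression_fn (given P (\<lambda>\<omega>. G \<omega> = g)) X (\<lambda>\<omega>. Y0 T \<omega> - Y0 (T - 1) \<omega>) (\<mu>0 g)"
    and parallel_trends: "\<And>g. g \<in> {2..NG + 1} \<Longrightarrow> AE \<omega> in P. \<mu>0 1 (X \<omega>) = \<mu>0 g (X \<omega>)"
    \<comment> \<open>boundedness\<close>
    and "\<And>g. g \<in> {1..NG + 1} \<Longrightarrow>
           bounded_nn_regression (given P (\<lambda>\<omega>. G \<omega> = g)) X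
             (\<lambda>\<omega>. (Delta_Y T Y1 Y0 G \<omega> - mD (X \<omega>))\<^sup>2)"
    and "\<And>g. g \<in> {1..NG + 1} \<Longrightarrow> AE_bounded FX (\<lambda>x. 1 / p g x)"
    and "\<And>g. g \<in> {1..NG + 1} \<Longrightarrow> \<omega>t g \<in> borel_measurable borel"
    and "\<And>g. g \<in> {1..NG + 1} \<Longrightarrow> AE_bounded FX (\<omega>t g)"
    and "\<And>x. \<omega>t 1 x = 1"
    \<comment> \<open>folds and measurability of the first-stage estimators in data and covariates\<close>
    and "\<And>n. L dvd n \<Longrightarrow> equal_folds n L (I n)"
    and "\<And>n l. L dvd n \<Longrightarrow> l \<in> {1..L} \<Longrightarrow>
           (\<lambda>(d, x). mhat n l d x)
             \<in> borel_measurable ((\<Pi>\<^sub>M i\<in>fold_compl L (I n) l. obs_space T) \<Otimes>\<^sub>M borel)"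
    and "\<And>n l g. L dvd n \<Longrightarrow> l \<in> {1..L} \<Longrightarrow> g \<in> {1..NG + 1} \<Longrightarrow>
           (\<lambda>(d, x). phat n l d g x)
             \<in> borel_measurable ((\<Pi>\<^sub>M i\<in>fold_compl L (I n) l. obs_space T) \<Otimes>\<^sub>M borel)"
    and "\<And>n l g. L dvd n \<Longrightarrow> l \<in> {1..L} \<Longrightarrow> g \<in> {1..NG + 1} \<Longrightarrow>
           (\<lambda>(d, x). what n l d g x)
             \<in> borel_measurable ((\<Pi>\<^sub>M i\<in>fold_compl L (I n) l. obs_space T) \<Otimes>\<^sub>M borel)"
    and "\<And>n l d x. what n l d 1 x = 1"
    \<comment> \<open>first-stage rates, along the sample sizes \<open>n = L * k\<close>\<close>
    and "\<And>k l. l \<in> {1..L} \<Longrightarrow>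
           AE \<omega> in M. \<forall>x\<in>support FX. (\<Sum>g = 2..NG + 1. what (L * k) l (train k l \<omega>) g x) = 1"
    and "\<And>l g. l \<in> {1..L} \<Longrightarrow> g \<in> {1..NG + 1} \<Longrightarrow>
           O_p M (\<lambda>k \<omega>. sup_norm_on (support FX) (what (L * k) l (train k l \<omega>) g))"
    and "\<And>l. l \<in> {1..L} \<Longrightarrow>
           o_p M (\<lambda>k. 1) (\<lambda>k \<omega>. L2_norm FX (\<lambda>x. mhat (L * k) l (train k l \<omega>) x - mD x))"
    and "\<And>l g. l \<in> {1..L} \<Longrightarrow> g \<in> {2..NG + 1} \<Longrightarrow>
           o_p M (\<lambda>k. 1) (\<lambda>k \<omega>. L2_norm FX (\<lambda>x.
             phat (L * k) l (train k l \<omega>) 1 x / phat (L * k) l (train k l \<omega>) g x - p 1 x / p g x))"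
    and "\<And>l g. l \<in> {1..L} \<Longrightarrow> g \<in> {2..NG + 1} \<Longrightarrow>
           o_p M (\<lambda>k. 1) (\<lambda>k \<omega>. L2_norm FX (\<lambda>x. what (L * k) l (train k l \<omega>) g x - \<omega>t g x))"
    and "\<And>l g. l \<in> {1..L} \<Longrightarrow> g \<in> {2..NG + 1} \<Longrightarrow>
           o_p M (\<lambda>k. 1 / sqrt (real (L * k))) (\<lambda>k \<omega>.
             L2_norm FX (\<lambda>x.
               phat (L * k) l (train k l \<omega>) 1 x / phat (L * k) l (train k l \<omega>) g x - p 1 x / p g x) *
             L2_norm FX (\<lambda>x. mhat (L * k) l (train k l \<omega>) x - mD x))"
  shows "weak_conv_m
           (\<lambda>k. distr M borel (\<lambda>\<omega>. sqrt (real (L * k)) *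
              (theta_hat T NG L (L * k) (I (L * k)) (mhat (L * k)) (phat (L * k)) (what (L * k))
                 (\<lambda>i. S i \<omega>) - ATT P T Y1 Y0 G)))
           (normal_law 0 (V_PT P T NG Y1 Y0 G X p mD m1D \<omega>t))"
proof -
  interpret P: prob_space P by fact
  interpret M: prob_space M by fact
  have X: "X \<in> borel_measurable P" by fact
  have supp: "AE x in FX. x \<in> support FX" by (rule AE_in_support) (simp add: FX_def)
  \<comment> \<open>Implied by the condition on the weights: without control groups their sum is
    empty, hence 0 and not 1. The condition speaks about points of the support, so the support has
    to be shown nonempty first.\<close>
  have NG: "NG \<ge> 1"
  proof (rule ccontr)
    assume "\<not> NG \<ge> 1"
    then have NG0: "NG = 0" by simp
    interpret FX: prob_space FX unfolding FX_def by (rule P.prob_space_distr[OF X])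
    have "support FX \<noteq> {}"
    proof
      assume "support FX = {}"
      with supp have "AE x in FX. False" by simp
      then show False by simp
    qed
    then obtain x where x: "x \<in> support FX" by blast
    have "1 \<in> {1..L}" using assms(6) by simp
    from assms(30)[OF this] have "AE \<omega> in M. False"
      by eventually_elim (use x NG0 in auto)
    then show False by simp
  qed
  let ?H = "{1..NG + 1}"
  let ?Q = "\<lambda>g. given P (\<lambda>\<omega>. G \<omega> = g)"
  have "\<exists>c. \<forall>g\<in>?H. AE x in FX. \<bar>1 / p g x\<bar> \<le> c g"
    using assms(21) unfolding AE_bounded_def by (intro bchoice) auto
  then obtain c1 where c1: "\<And>g. g \<in> ?H \<Longrightarrow> AE x in FX. \<bar>1 / p g x\<bar> \<le> c1 g" by blast
  have "\<exists>c. \<forall>g\<in>?H. AE x in FX. \<bar>\<omega>t g x\<bar> \<le> c g"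
    using assms(23) unfolding AE_bounded_def by (intro bchoice) auto
  then obtain c2 where c2: "\<And>g. g \<in> ?H \<Longrightarrow> AE x in FX. \<bar>\<omega>t g x\<bar> \<le> c2 g" by blast
  have "\<exists>c. \<forall>g\<in>?H. AE \<omega> in ?Q g. nn_cond_exp (?Q g) (vimage_algebra (space P) X borel)
      (\<lambda>\<omega>. ennreal ((Delta_Y T Y1 Y0 G \<omega> - mD (X \<omega>))\<^sup>2)) \<omega> \<le> ennreal (c g)"
    using assms(20) unfolding bounded_nn_regression_def space_given by (intro bchoice) auto
  then obtain c3 where c3: "\<And>g. g \<in> ?H \<Longrightarrow> AE \<omega> in ?Q g. nn_cond_exp (?Q g) (vimage_algebra (space P) X borel)
      (\<lambda>\<omega>. ennreal ((Delta_Y T Y1 Y0 G \<omega> - mD (X \<omega>))\<^sup>2)) \<omega> \<le> ennreal (c3 g)" by blast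
  \<comment> \<open>One constant for all groups and all three bounds. Absolute values are taken
    because a bound such as \<open>c3 g\<close>, used under \<open>ennreal\<close>, may be
    negative.\<close>
  define C where "C = (\<Sum>g\<in>?H. \<bar>c1 g\<bar> + \<bar>c2 g\<bar> + \<bar>c3 g\<bar>)"
  have C: "C \<ge> 0" unfolding C_def by (intro sum_nonneg) auto
  have C_ge: "\<bar>c1 g\<bar> + \<bar>c2 g\<bar> + \<bar>c3 g\<bar> \<le> C" if "g \<in> ?H" for g
    unfolding C_def by (rule member_le_sum[OF that]) auto
  have ov: "AE \<omega> in P. 1 / p g (X \<omega>) \<le> C" if g: "g \<in> ?H" for g
    using AE_distrD[OF X c1[OF g, unfolded FX_def]] by eventually_elim (use C_ge[OF g] in linarith)
  have wb: "AE \<omega> in P. \<bar>\<omega>t g (X \<omega>)\<bar> \<le> C" if g: "g \<in> ?H" for g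
    using AE_distrD[OF X c2[OF g, unfolded FX_def]] by eventually_elim (use C_ge[OF g] in linarith)
  have sm: "AE \<omega> in ?Q g. nn_cond_exp (?Q g) (vimage_algebra (space P) X borel)
      (\<lambda>\<omega>. ennreal ((Delta_Y T Y1 Y0 G \<omega> - mD (X \<omega>))\<^sup>2)) \<omega> \<le> ennreal C" if g: "g \<in> ?H" for g
    using c3[OF g]
  proof eventually_elim
    case (elim \<omega>)
    have "c3 g \<le> C" using C_ge[OF g] by linarith
    then show ?case by (rule order_trans[OF elim ennreal_leI])
  qed
  have sub: "g \<in> {2..NG + 1} \<Longrightarrow> g \<in> ?H" for g by auto
  interpret crossfit_did P G X NG p C Y1 Y0 T \<mu>0 mD m1D M S \<omega>t L I mhat phat what
    by unfold_locales
      (fact NG C ov sm wb[OF sub] assms(3-6) assms(9-19) assms(22)[OF sub] assms(25-28)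
        assms(7,8) assms(30-35)[unfolded FX_def train_def])+
  show ?thesis using weak_conv_Z unfolding Z_def[abs_def] .
qed

end
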